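(* Fix $\rho\in[-1,1]$. For every $\beta=(\sigma,\tau)\in\mathbb{R}^2$, the limit $$p(\beta):=\lim_{N\to\infty}p_N(\beta)$$ exists in probability and in $L^q$ for every $q\ge1$, and is given by $$p(\beta)=\begin{cases}1+\tfrac12(\sigma^2-\tau^2),&\beta\in\overline{B}_1,\\ \sqrt2\,|\sigma|,&\beta\in\overline{B}_2,\\ \tfrac12+\sigma^2,&\beta\in\overline{B}_3.\end{cases}$$
   Context: Let $(X_1,Y_1),(X_2,Y_2),\ldots$ be i.i.d. zero-mean bivariate real Gaussian vectors with $\mathrm{Var}\,X_k=\mathrm{Var}\,Y_k=1$ and $\mathrm{Corr}(X_k,Y_k)=\rho$. For $N\in\mathbb{N}$ put $n=\log N$ (natural logarithm) and, for $\beta=(\sigma,\tau)\in\mathbb{R}^2$, $\mathcal{Z}_N(\beta)=\sum_{k=1}^N e^{\sqrt n(\sigma X_k+i\tau Y_k)}$ and $p_N(\beta)=\frac1n\log|\mathcal{Z}_N(\beta)|$. Define $B_2=\{(\sigma,\tau)\in\mathbb{R}^2\colon 2\sigma^2>1,\ |\sigma|+|\tau|>\sqrt2\}$, $B_3=\{(\sigma,\tau)\in\mathbb{R}^2\colon 2\sigma^2<1,\ \sigma^2+\tau^2>1\}$, $B_1=\mathbb{R}^2\setminus\overline{B_2\cup B_3}$ (bar denotes closure). *)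

theory Defs
  imports "HOL-Probability.Probability"
begin

text \<open>The normal law with mean \<open>m\<close> and standard deviation \<open>s \<ge> 0\<close>, where \<open>s = 0\<close> gives the
  Dirac measure at \<open>m\<close>. The degenerate case is needed below, since linear combinations of the
  components may be constant.\<close>

definition normal_law :: "real \<Rightarrow> real \<Rightarrow> real measure" where
  "normal_law m s =
     (if s = 0 then return borel m else density lborel (\<lambda>x. ennreal (normal_density m s x)))"

definition gaussian_rv :: "'a measure \<Rightarrow> ('a \<Rightarrow> real) \<Rightarrow> bool" where
  "gaussian_rv M Z \<longleftrightarrow> Z \<in> borel_measurable M \<and> (\<exists>m. \<exists>s\<ge>0. distr M borel Z = normal_law m s)"

text \<open>Gaussian vectors are defined by their linear combinations, so that singular covariance
  matrices (correlation \<open>1\<close> or \<open>-1\<close>) are included.\<close>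

definition bivariate_gaussian :: "'a measure \<Rightarrow> ('a \<Rightarrow> real) \<Rightarrow> ('a \<Rightarrow> real) \<Rightarrow> bool" where
  "bivariate_gaussian M U V \<longleftrightarrow> (\<forall>a b. gaussian_rv M (\<lambda>\<omega>. a * U \<omega> + b * V \<omega>))"

definition cov :: "'a measure \<Rightarrow> ('a \<Rightarrow> real) \<Rightarrow> ('a \<Rightarrow> real) \<Rightarrow> real" where
  "cov M U V = (LINT \<omega>|M. (U \<omega> - prob_space.expectation M U) * (V \<omega> - prob_space.expectation M V))"

definition corr :: "'a measure \<Rightarrow> ('a \<Rightarrow> real) \<Rightarrow> ('a \<Rightarrow> real) \<Rightarrow> real" where
  "corr M U V = cov M U V / (sqrt (prob_space.variance M U) * sqrt (prob_space.variance M V))"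

text \<open>The sequence of vectors is indexed by \<open>k \<ge> 1\<close>; \<open>X 0\<close> and \<open>Y 0\<close> are unconstrained and
  unused.\<close>

definition gaussian_iid_sequence ::
    "'a measure \<Rightarrow> real \<Rightarrow> (nat \<Rightarrow> 'a \<Rightarrow> real) \<Rightarrow> (nat \<Rightarrow> 'a \<Rightarrow> real) \<Rightarrow> bool" where
  "gaussian_iid_sequence M \<rho> X Y \<longleftrightarrow>
     prob_space.indep_vars M (\<lambda>_. borel) (\<lambda>k \<omega>. (X k \<omega>, Y k \<omega>)) {1..} \<and>
     (\<forall>k\<ge>1. distr M borel (\<lambda>\<omega>. (X k \<omega>, Y k \<omega>)) = distr M borel (\<lambda>\<omega>. (X 1 \<omega>, Y 1 \<omega>))) \<and>
     (\<forall>k\<ge>1. bivariate_gaussian M (X k) (Y k) \<and>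
        prob_space.expectation M (X k) = 0 \<and> prob_space.expectation M (Y k) = 0 \<and>
        prob_space.variance M (X k) = 1 \<and> prob_space.variance M (Y k) = 1 \<and>
        corr M (X k) (Y k) = \<rho>)"

definition partition_fn ::
    "(nat \<Rightarrow> 'a \<Rightarrow> real) \<Rightarrow> (nat \<Rightarrow> 'a \<Rightarrow> real) \<Rightarrow> nat \<Rightarrow> real \<times> real \<Rightarrow> 'a \<Rightarrow> complex" where
  "partition_fn X Y N \<beta> \<omega> = (case \<beta> of (\<sigma>, \<tau>) \<Rightarrow>
     (\<Sum>k=1..N. exp (complex_of_real (sqrt (ln (real N))) *
        (complex_of_real (\<sigma> * X k \<omega>) + \<i> * complex_of_real (\<tau> * Y k \<omega>)))))"

text \<open>By the conventions \<open>x / 0 = 0\<close> and \<open>ln 0 = 0\<close> this is a total real function. The first one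
  affects only \<open>N \<le> 1\<close>; the second one only the event that the partition function vanishes, which
  for \<open>N \<ge> 1\<close> is a null event.\<close>

definition log_partition_fn ::
    "(nat \<Rightarrow> 'a \<Rightarrow> real) \<Rightarrow> (nat \<Rightarrow> 'a \<Rightarrow> real) \<Rightarrow> nat \<Rightarrow> real \<times> real \<Rightarrow> 'a \<Rightarrow> real" where
  "log_partition_fn X Y N \<beta> \<omega> = 1 / ln (real N) * ln (cmod (partition_fn X Y N \<beta> \<omega>))"

text \<open>Measurability is part of the definition because the measure of a non-measurable set
  is \<open>0\<close> by convention.\<close>

definition converges_in_probability ::
    "'a measure \<Rightarrow> (nat \<Rightarrow> 'a \<Rightarrow> real) \<Rightarrow> ('a \<Rightarrow> real) \<Rightarrow> bool" where
  "converges_in_probability M f g \<longleftrightarrow>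
     (\<forall>N. f N \<in> borel_measurable M) \<and> g \<in> borel_measurable M \<and>
     (\<forall>\<epsilon>>0. (\<lambda>N. measure M {\<omega> \<in> space M. \<bar>f N \<omega> - g \<omega>\<bar> > \<epsilon>}) \<longlonglongrightarrow> 0)"

definition in_Lq :: "'a measure \<Rightarrow> real \<Rightarrow> ('a \<Rightarrow> real) \<Rightarrow> bool" where
  "in_Lq M q f \<longleftrightarrow> f \<in> borel_measurable M \<and> integrable M (\<lambda>\<omega>. \<bar>f \<omega>\<bar> powr q)"

text \<open>Membership of \<open>f N\<close> in \<open>L\<^sup>q\<close> is required explicitly, since the Bochner integral of a
  non-integrable function is \<open>0\<close>. It is required for large \<open>N\<close> only, as the first terms of the
  sequence of interest need not be defined.\<close>

definition converges_in_Lq ::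
    "'a measure \<Rightarrow> real \<Rightarrow> (nat \<Rightarrow> 'a \<Rightarrow> real) \<Rightarrow> ('a \<Rightarrow> real) \<Rightarrow> bool" where
  "converges_in_Lq M q f g \<longleftrightarrow>
     (\<forall>\<^sub>F N in sequentially. in_Lq M q (f N)) \<and> in_Lq M q g \<and>
     (\<lambda>N. LINT \<omega>|M. \<bar>f N \<omega> - g \<omega>\<bar> powr q) \<longlonglongrightarrow> 0"

definition B2 :: "(real \<times> real) set" where
  "B2 = {(\<sigma>, \<tau>). 2 * \<sigma>\<^sup>2 > 1 \<and> \<bar>\<sigma>\<bar> + \<bar>\<tau>\<bar> > sqrt 2}"

definition B3 :: "(real \<times> real) set" where
  "B3 = {(\<sigma>, \<tau>). 2 * \<sigma>\<^sup>2 < 1 \<and> \<sigma>\<^sup>2 + \<tau>\<^sup>2 > 1}"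

definition B1 :: "(real \<times> real) set" where
  "B1 = UNIV - closure (B2 \<union> B3)"

end

theory Submission
  imports Defs
begin

text \<open>
  Put \<open>n = ln N\<close> and \<open>W\<^sub>k = exp (sqrt n * (\<sigma> X\<^sub>k + \<i> \<tau> Y\<^sub>k))\<close>, so that the partition function is
  \<open>Z = W\<^sub>1 + \<dots> + W\<^sub>N\<close>. Two exponents compete. The mean of \<open>Z\<close> has modulus \<open>exp (n \<mu>)\<close> with
  \<open>\<mu> = 1 + (\<sigma>\<^sup>2 - \<tau>\<^sup>2) / 2\<close>. The fluctuations of \<open>Z\<close> have order \<open>exp (n \<kappa>)\<close>, where \<open>\<kappa> = 1/2 + \<sigma>\<^sup>2\<close> is the
  exponent of the standard deviation as long as \<open>2 \<sigma>\<^sup>2 \<le> 1\<close>; for larger \<open>\<bar>\<sigma>\<bar>\<close> the variance is due to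
  values of \<open>X\<^sub>k\<close> beyond \<open>sqrt (2 n)\<close>, which do not occur in a sample of size \<open>N\<close>, and the largest
  summands give \<open>\<kappa> = sqrt 2 * \<bar>\<sigma>\<bar>\<close> instead. For \<open>\<bar>\<sigma>\<bar> \<le> sqrt 2\<close> the limit is the larger of \<open>\<mu>\<close> and \<open>\<kappa>\<close>; for
  \<open>\<bar>\<sigma>\<bar> > sqrt 2\<close> even the mean is due to values that do not occur, and the limit is \<open>\<kappa>\<close>. The region
  \<open>B1\<close> is the one where \<open>\<mu>\<close> wins, and in \<open>B2\<close> and \<open>B3\<close> it is \<open>\<kappa>\<close> in its two forms.

  Upper bounds, and the lower bound where \<open>\<mu>\<close> wins, come from Markov's inequality. The expectation of
  \<open>\<bar>Z - E Z\<bar>\<close> is at most \<open>3 exp (n \<kappa>)\<close> for \<open>\<bar>\<sigma>\<bar> \<le> sqrt 2\<close> (\<open>partition_fn_deviation\<close>). This is a second moment bound if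
  \<open>2 \<sigma>\<^sup>2 \<le> 1\<close>; for larger \<open>\<bar>\<sigma>\<bar>\<close> it is a second moment bound for the summands with \<open>X\<^sub>k\<close> below
  \<open>sqrt (2 n)\<close> (above \<open>- sqrt (2 n)\<close> for negative \<open>\<sigma>\<close>) and a first moment bound for the others. For
  \<open>\<bar>\<sigma>\<bar> \<ge> sqrt 2\<close> the moment of \<open>\<bar>Z\<bar>\<close> of order \<open>sqrt 2 / \<bar>\<sigma>\<bar> \<le> 1\<close> is used, which is subadditive.

  The lower bound by \<open>\<kappa>\<close> says that \<open>Z\<close> does not concentrate on a scale below \<open>exp (n \<kappa>)\<close>
  (\<open>partition_fn_lower_phase\<close>). Let \<open>\<phi>\<close> be the characteristic function of \<open>Re W\<^sub>1\<close>. Smoothing with an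
  independent standard normal \<open>g\<close> bounds the probability of \<open>\<bar>Re Z\<bar> \<le> L\<close> by \<open>2 E \<bar>\<phi> (g / L)\<bar>\<^sup>N\<close>. For every \<open>x\<close>,
  \<open>Re W\<^sub>1\<close> is of size \<open>exp (n \<sigma> x)\<close> with either sign with probability \<open>exp (- n x\<^sup>2 / 2)\<close> up to
  factors of lower order: \<open>X\<^sub>1\<close> has to be near \<open>x * sqrt n\<close> and the phase \<open>\<tau> * sqrt n * Y\<^sub>1\<close> near
  an even or an odd multiple of \<open>\<pi>\<close> (\<open>two_phase_windows\<close>). This keeps \<open>\<bar>\<phi>\<bar>\<close> away from \<open>1\<close>, and the bound
  tends to \<open>0\<close> for \<open>L = exp (n l)\<close> with \<open>l < \<sigma> x + (1 - x\<^sup>2 / 2) / 2\<close> and \<open>x\<^sup>2 < 2\<close>. The supremum of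
  the right-hand side over \<open>x\<close> is \<open>\<kappa>\<close>. For \<open>\<tau> = 0\<close> all summands are positive and
  the largest one suffices.

  Convergence in \<open>L\<^sup>q\<close> follows from convergence in probability because \<open>E exp \<bar>p\<^sub>N\<bar>\<close> is bounded
  (\<open>log_partition_fn_exp_moment\<close>), that is, \<open>E \<bar>Z\<bar> powr (1 / n)\<close> and \<open>E \<bar>Z\<bar> powr (- 1 / n)\<close> are. The second
  one is small ball control: whatever the other summands are, the distance of \<open>Z\<close> from \<open>0\<close> is at least
  \<open>\<bar>W\<^sub>1\<bar>\<close> times the sine of the angle between \<open>W\<^sub>1\<close> and their sum, and for \<open>\<tau> \<noteq> 0\<close> this angle is spread out
  because \<open>Y\<^sub>1\<close> has a density.
\<close>

section \<open>Normal laws\<close>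

lemma normal_law_eq_distr:
  assumes "s \<ge> 0"
  shows "normal_law m s = distr std_normal_distribution borel (\<lambda>x. m + s * x)"
proof (cases "s = 0")
  case True
  interpret real_distribution std_normal_distribution by (rule real_dist_normal_dist)
  show ?thesis using True by (simp add: normal_law_def)
next
  case False
  interpret real_distribution std_normal_distribution by (rule real_dist_normal_dist)
  have "distributed std_normal_distribution lborel (\<lambda>x. x) std_normal_density"
    by (auto simp: distributed_def intro!: measure_eqI simp: emeasure_distr)
  from normal_density_affine[OF this, of s m] False assms
  have "distributed std_normal_distribution lborel (\<lambda>x. m + s * x) (normal_density m s)"
    by simp
  from distributed_distr_eq_density[OF this] show ?thesis
    using False by (simp add: normal_law_def cong: distr_cong)
qed

text \<open>Completing the square and translating the density reduces the integral to the characteristic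
  function. Complex \<open>c\<close> are needed for the mean of the summands, where \<open>X\<close> and \<open>Y\<close> may be dependent.\<close>

lemma std_normal_cexp:
  fixes c :: complex
  shows "integrable std_normal_distribution (\<lambda>x. exp (c * of_real x))"
    and "(LINT x|std_normal_distribution. exp (c * of_real x)) = exp (c\<^sup>2 / 2)"
proof -
  define a b where "a = Re c" and "b = Im c"
  have c: "c = of_real a + \<i> * of_real b" by (simp add: a_def b_def complex_eq_iff)
  have eq: "std_normal_density (a + x) *\<^sub>R exp (c * of_real (a + x)) =
      exp (a\<^sup>2/2 + \<i> * a * b) * (std_normal_density x *\<^sub>R iexp (b * x))" for x
  proof -
    have "exp (- (a + x)\<^sup>2 / 2) * exp (c * of_real (a + x)) =
        exp (of_real (- (a + x)\<^sup>2 / 2) + c * of_real (a + x))"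
      by (simp only: exp_add exp_of_real)
    also have "of_real (- (a + x)\<^sup>2 / 2) + c * of_real (a + x) =
        (a\<^sup>2/2 + \<i> * a * b) + (of_real (- x\<^sup>2 / 2) + \<i> * (b * x))"
      by (simp add: c complex_eq_iff field_simps power2_eq_square)
    also have "exp \<dots> = exp (a\<^sup>2/2 + \<i> * a * b) * (exp (- x\<^sup>2 / 2) * iexp (b * x))"
      by (simp only: exp_add exp_of_real of_real_mult mult.assoc)
    finally show ?thesis
      by (simp add: std_normal_density_def scaleR_conv_of_real field_simps del: of_real_add)
  qed
  interpret real_distribution std_normal_distribution by (rule real_dist_normal_dist)
  have ib: "integrable lborel (\<lambda>x. std_normal_density x *\<^sub>R iexp (b * x))"
    by (subst integrable_density[symmetric]) (auto intro!: integrable_iexp)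
  have "integrable lborel (\<lambda>x. std_normal_density (a + x) *\<^sub>R exp (c * of_real (a + x)))"
    unfolding eq by (intro Bochner_Integration.integrable_mult_right) (rule ib)
  then have "integrable lborel (\<lambda>x. std_normal_density (a + 1 * x) *\<^sub>R exp (c * of_real (a + 1 * x)))"
    by simp
  then have "integrable lborel (\<lambda>x. std_normal_density x *\<^sub>R exp (c * of_real x))"
    by (subst (asm) lborel_integrable_real_affine_iff) auto
  then show "integrable std_normal_distribution (\<lambda>x. exp (c * of_real x))"
    by (subst integrable_density) auto
  have "(LINT x|std_normal_distribution. exp (c * of_real x)) =
      (LINT x|lborel. std_normal_density x *\<^sub>R exp (c * of_real x))"
    by (subst integral_density) auto
  also have "\<dots> = (LINT x|lborel. std_normal_density (a + x) *\<^sub>R exp (c * of_real (a + x)))"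
    by (subst lborel_integral_real_affine[where c=1 and t=a]) auto
  also have "\<dots> = exp (a\<^sup>2/2 + \<i> * a * b) * (LINT x|lborel. std_normal_density x *\<^sub>R iexp (b * x))"
    unfolding eq by (rule integral_mult_right_zero)
  also have "(LINT x|lborel. std_normal_density x *\<^sub>R iexp (b * x)) = char std_normal_distribution b"
    unfolding char_def by (subst integral_density) auto
  also have "\<dots> = exp (- (b\<^sup>2) / 2)"
    by (simp add: char_std_normal_distribution)
  also have "exp (a\<^sup>2/2 + \<i> * a * b) * of_real (exp (- (b\<^sup>2) / 2)) = exp (a\<^sup>2/2 + \<i> * a * b + of_real (- (b\<^sup>2) / 2))"
    by (simp only: exp_add exp_of_real)
  also have "a\<^sup>2/2 + \<i> * a * b + of_real (- (b\<^sup>2) / 2) = c\<^sup>2 / 2"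
    by (simp add: c complex_eq_iff power2_eq_square field_simps)
  finally show "(LINT x|std_normal_distribution. exp (c * of_real x)) = exp (c\<^sup>2 / 2)" .
qed

lemma (in prob_space) normal_law_cexp:
  fixes c :: complex
  assumes [measurable]: "U \<in> borel_measurable M" and U: "distr M borel U = normal_law m s" and s: "s \<ge> 0"
  shows "integrable M (\<lambda>\<omega>. exp (c * of_real (U \<omega>)))"
    and "(LINT \<omega>|M. exp (c * of_real (U \<omega>))) = exp (c * m + c\<^sup>2 * s\<^sup>2 / 2)"
proof -
  have E: "exp (c * (of_real m + of_real s * of_real x)) = exp (c * m) * exp (c * s * of_real x)" for x
    by (simp add: exp_add algebra_simps)
  have "integrable (distr M borel U) (\<lambda>x. exp (c * of_real x))"
    unfolding U normal_law_eq_distr[OF s]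
    by (subst integrable_distr_eq) (auto simp: E std_normal_cexp)
  then show "integrable M (\<lambda>\<omega>. exp (c * of_real (U \<omega>)))"
    by (subst (asm) integrable_distr_eq) auto
  have "(LINT \<omega>|M. exp (c * of_real (U \<omega>))) = (LINT x|distr M borel U. exp (c * of_real x))"
    by (subst integral_distr) auto
  also have "\<dots> = exp (c * m) * (LINT x|std_normal_distribution. exp (c * s * of_real x))"
    unfolding U normal_law_eq_distr[OF s] by (subst integral_distr) (auto simp: E)
  also have "\<dots> = exp (c * m + c\<^sup>2 * s\<^sup>2 / 2)"
    by (simp add: std_normal_cexp exp_add power_mult_distrib)
  finally show "(LINT \<omega>|M. exp (c * of_real (U \<omega>))) = exp (c * m + c\<^sup>2 * s\<^sup>2 / 2)" .
qed

lemma (in prob_space) normal_law_moments: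
  assumes [measurable]: "U \<in> borel_measurable M" and U: "distr M borel U = normal_law m s" and s: "s \<ge> 0"
  shows "integrable M U" "integrable M (\<lambda>\<omega>. (U \<omega>)\<^sup>2)" "expectation U = m" "variance U = s\<^sup>2"
proof -
  let ?N = "std_normal_distribution"
  interpret N: real_distribution ?N by (rule real_dist_normal_dist)
  have i1: "integrable ?N (\<lambda>x. x)" and i2: "integrable ?N (\<lambda>x. x\<^sup>2)"
    using integrable_std_normal_distribution_moment[of 1] integrable_std_normal_distribution_moment[of 2] by simp_all
  have e1: "(LINT x|?N. x) = 0"
    using integral_std_normal_distribution_moment_odd[of 1] by simp
  have e2: "(LINT x|?N. x\<^sup>2) = 1"
    using std_normal_distribution_even_moments[of 1] by simp
  have j: "integrable ?N (\<lambda>x. m + s * x)" "integrable ?N (\<lambda>x. (m + s * x)\<^sup>2)"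
    using i1 i2 by (auto simp: power2_sum power_mult_distrib)
  have tr: "integrable M (\<lambda>\<omega>. f (U \<omega>)) \<longleftrightarrow> integrable ?N (\<lambda>x. f (m + s * x))"
     "(LINT \<omega>|M. f (U \<omega>)) = (LINT x|?N. f (m + s * x))" if [measurable]: "f \<in> borel_measurable borel" for f :: "real \<Rightarrow> real"
  proof -
    have "integrable M (\<lambda>\<omega>. f (U \<omega>)) \<longleftrightarrow> integrable (distr M borel U) f"
      by (subst integrable_distr_eq) auto
    also have "\<dots> \<longleftrightarrow> integrable ?N (\<lambda>x. f (m + s * x))"
      unfolding U normal_law_eq_distr[OF s] by (subst integrable_distr_eq) auto
    finally show "integrable M (\<lambda>\<omega>. f (U \<omega>)) \<longleftrightarrow> integrable ?N (\<lambda>x. f (m + s * x))" .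
    have "(LINT \<omega>|M. f (U \<omega>)) = (LINT x|distr M borel U. f x)"
      by (subst integral_distr) auto
    also have "\<dots> = (LINT x|?N. f (m + s * x))"
      unfolding U normal_law_eq_distr[OF s] by (subst integral_distr) auto
    finally show "(LINT \<omega>|M. f (U \<omega>)) = (LINT x|?N. f (m + s * x))" .
  qed
  show "integrable M U" using tr(1)[of "\<lambda>x. x"] j by simp
  show "integrable M (\<lambda>\<omega>. (U \<omega>)\<^sup>2)" using tr(1)[of "\<lambda>x. x\<^sup>2"] j by simp
  have "expectation U = (LINT x|?N. m + s * x)" using tr(2)[of "\<lambda>x. x"] by simp
  also have "\<dots> = (LINT x|?N. m) + s * (LINT x|?N. x)"
    using i1 by (subst Bochner_Integration.integral_add) auto
  finally show m: "expectation U = m" unfolding e1 using N.prob_space by simp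
  have "variance U = (LINT x|?N. (m + s * x - m)\<^sup>2)"
    unfolding m by (rule tr(2)[of "\<lambda>x. (x - m)\<^sup>2"]) simp
  also have "\<dots> = (LINT x|?N. s\<^sup>2 * x\<^sup>2)" by (simp add: power_mult_distrib)
  also have "\<dots> = s\<^sup>2 * (LINT x|?N. x\<^sup>2)" by (rule integral_mult_right_zero)
  finally show "variance U = s\<^sup>2" unfolding e2 by simp
qed


section \<open>Independence from characteristic functions\<close>

lemma borel_measurable_cis [measurable]: "cis \<in> borel_measurable borel"
  by (intro borel_measurable_continuous_onI continuous_intros)

lemma (in prob_space) char_eq_distr:
  "char (distr M borel U) t = (LINT \<omega>|M. cis (t * U \<omega>))" if [measurable]: "U \<in> borel_measurable M"
  unfolding char_def by (subst integral_distr) (auto simp: cis_conv_exp)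

lemma (in prob_space) density_prob_space:
  assumes [measurable]: "h \<in> borel_measurable M" and h: "\<And>\<omega>. 0 \<le> h \<omega>" "integrable M h" "expectation h = 1"
  shows "prob_space (density M h)"
proof
  show "emeasure (density M (\<lambda>x. ennreal (h x))) (space (density M (\<lambda>x. ennreal (h x)))) = 1"
    using h by (simp add: emeasure_density nn_integral_eq_integral cong: nn_integral_cong_simp)
qed

text \<open>Uniqueness of characteristic functions under a change of measure: unless \<open>h\<close> vanishes almost surely,
  dividing it by its expectation gives a probability density, under which \<open>U\<close> has the same characteristic
  function as before.\<close>

lemma (in prob_space) weighted_law_eq:
  fixes U h :: "'a \<Rightarrow> real"
  assumes [measurable]: "U \<in> borel_measurable M" "h \<in> borel_measurable M"
    and h0: "\<And>\<omega>. 0 \<le> h \<omega>" and h1: "\<And>\<omega>. h \<omega> \<le> K" 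
    and eq: "\<And>t. (LINT \<omega>|M. h \<omega> *\<^sub>R cis (t * U \<omega>)) = expectation h *\<^sub>R (LINT \<omega>|M. cis (t * U \<omega>))"
    and B: "B \<in> sets borel"
  shows "(LINT \<omega>|M. h \<omega> * indicator B (U \<omega>)) = expectation h * (LINT \<omega>|M. indicator B (U \<omega>))"
proof -
  have ih: "integrable M h" by (rule integrable_const_bound[where B=K]) (use h0 h1 in auto)
  have [measurable]: "B \<in> sets borel" by fact
  show ?thesis
  proof (cases "expectation h = 0")
    case True
    then have "AE \<omega> in M. h \<omega> = 0" using integral_nonneg_eq_0_iff_AE[OF ih] h0 by auto
    then have "(LINT \<omega>|M. h \<omega> * indicator B (U \<omega>)) = (LINT \<omega>|M. 0)"
      by (intro integral_cong_AE) auto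
    with True show ?thesis by simp
  next
    case False
    define c where "c = expectation h"
    have c: "c > 0" using False h0 Bochner_Integration.integral_nonneg[of M h] unfolding c_def by fastforce
    define Q where "Q = density M (\<lambda>\<omega>. ennreal (h \<omega> / c))"
    interpret Q: prob_space Q
      unfolding Q_def using h0 c ih by (intro density_prob_space) (auto simp: c_def)
    have [measurable]: "U \<in> borel_measurable Q" by (simp add: Q_def)
    have "char (distr Q borel U) = char (distr M borel U)"
    proof
      fix t
      have "char (distr Q borel U) t = (LINT \<omega>|Q. cis (t * U \<omega>))" by (rule Q.char_eq_distr) simp
      also have "\<dots> = (LINT \<omega>|M. (h \<omega> / c) *\<^sub>R cis (t * U \<omega>))"
        unfolding Q_def using h0 c by (subst integral_density) auto
      also have "\<dots> = (LINT \<omega>|M. (1/c) *\<^sub>R (h \<omega> *\<^sub>R cis (t * U \<omega>)))" by simp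
      also have "\<dots> = (1/c) *\<^sub>R (LINT \<omega>|M. h \<omega> *\<^sub>R cis (t * U \<omega>))"
        by (rule integral_scaleR_right) 
      also have "\<dots> = char (distr M borel U) t"
        unfolding eq c_def[symmetric] char_eq_distr[OF \<open>U \<in> borel_measurable M\<close>] using c by simp
      finally show "char (distr Q borel U) t = char (distr M borel U) t" .
    qed
    then have "distr Q borel U = distr M borel U"
      by (intro Levy_uniqueness real_distribution_distr Q.real_distribution_distr) auto
    moreover have "(LINT \<omega>|Q. indicator B (U \<omega>) :: real) = (LINT x|distr Q borel U. indicator B x)"
      by (subst integral_distr) auto
    moreover have "(LINT \<omega>|M. indicator B (U \<omega>) :: real) = (LINT x|distr M borel U. indicator B x)"
      by (subst integral_distr) auto
    ultimately have "(LINT \<omega>|Q. indicator B (U \<omega>) :: real) = (LINT \<omega>|M. indicator B (U \<omega>))"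
      by simp
    also have "(LINT \<omega>|Q. indicator B (U \<omega>) :: real) = (LINT \<omega>|M. (h \<omega> / c) *\<^sub>R indicator B (U \<omega>))"
      unfolding Q_def using h0 c by (subst integral_density) auto
    finally show ?thesis using c by (simp add: c_def[symmetric] field_simps)
  qed
qed

text \<open>Two applications of one-dimensional uniqueness replace the uniqueness theorem in the plane. The
  weights \<open>1 + cos (t V)\<close> and \<open>1 + sin (t V)\<close> are nonnegative and do not change the law of \<open>U\<close>, hence
  \<open>E [cis (t V); U \<in> B]\<close> factors; this says that the weight \<open>indicator B U\<close> does not change the law
  of \<open>V\<close>.\<close>

lemma (in prob_space) indep_var_if_joint_char:
  fixes U V :: "'a \<Rightarrow> real"
  assumes [measurable]: "U \<in> borel_measurable M" "V \<in> borel_measurable M"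
    and joint: "\<And>s t. (LINT \<omega>|M. cis (s * U \<omega> + t * V \<omega>)) = (LINT \<omega>|M. cis (s * U \<omega>)) * (LINT \<omega>|M. cis (t * V \<omega>))"
  shows "indep_var borel U borel V"
proof -
  have ie: "integrable M (\<lambda>\<omega>. cis (f \<omega>))" if [measurable]: "f \<in> borel_measurable M" for f
    by (rule integrable_const_bound[where B=1]) auto
  have ic: "integrable M (\<lambda>\<omega>. cos (f \<omega>))" "integrable M (\<lambda>\<omega>. sin (f \<omega>))" if [measurable]: "f \<in> borel_measurable M" for f :: "'a \<Rightarrow> real"
    by (rule integrable_const_bound[where B=1]; simp)+
  have Ecis: "(LINT \<omega>|M. cis (f \<omega>)) = Complex (expectation (\<lambda>\<omega>. cos (f \<omega>))) (expectation (\<lambda>\<omega>. sin (f \<omega>)))"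
    if [measurable]: "f \<in> borel_measurable M" for f
    using integral_Re[OF ie[of f]] integral_Im[OF ie[of f]] by (simp add: complex_eq_iff)
  have coscis: "(LINT \<omega>|M. cos (t * V \<omega>) *\<^sub>R cis (s * U \<omega>)) = expectation (\<lambda>\<omega>. cos (t * V \<omega>)) *\<^sub>R (LINT \<omega>|M. cis (s * U \<omega>))" 
    and sincis: "(LINT \<omega>|M. sin (t * V \<omega>) *\<^sub>R cis (s * U \<omega>)) = expectation (\<lambda>\<omega>. sin (t * V \<omega>)) *\<^sub>R (LINT \<omega>|M. cis (s * U \<omega>))" for s t
  proof -
    let ?C = "Complex (expectation (\<lambda>\<omega>. cos (t * V \<omega>)))  (expectation (\<lambda>\<omega>. sin (t * V \<omega>)))"
    let ?D = "Complex (expectation (\<lambda>\<omega>. cos (t * V \<omega>)))  (- expectation (\<lambda>\<omega>. sin (t * V \<omega>)))"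
    let ?I = "(LINT \<omega>|M. cis (s * U \<omega>))"
    have eC: "(LINT \<omega>|M. cis (t * V \<omega>)) = ?C" by (rule Ecis) simp
    have p: "(LINT \<omega>|M. cis (s * U \<omega> + t * V \<omega>)) = ?I * ?C"
      by (simp only: joint eC)
    have eD: "(LINT \<omega>|M. cis ((-t) * V \<omega>)) = ?D" by (subst Ecis) (simp_all)
    have m: "(LINT \<omega>|M. cis (s * U \<omega> + (-t) * V \<omega>)) = ?I * ?D"
      by (simp only: joint eD)
    have "cos (t * V \<omega>) *\<^sub>R cis (s * U \<omega>) = (1/2) * (cis (s * U \<omega> + t * V \<omega>) + cis (s * U \<omega> + (-t) * V \<omega>))" for \<omega>
      by (simp add: complex_eq_iff cos_add sin_add cos_diff sin_diff)
    then have "(LINT \<omega>|M. cos (t * V \<omega>) *\<^sub>R cis (s * U \<omega>)) = (1/2) * (LINT \<omega>|M. cis (s * U \<omega> + t * V \<omega>) + cis (s * U \<omega> + (-t) * V \<omega>))"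
      by (simp only: integral_mult_right_zero)
    also have "(LINT \<omega>|M. cis (s * U \<omega> + t * V \<omega>) + cis (s * U \<omega> + (-t) * V \<omega>)) = (LINT \<omega>|M. cis (s * U \<omega> + t * V \<omega>)) + (LINT \<omega>|M. cis (s * U \<omega> + (-t) * V \<omega>))"
      by (rule Bochner_Integration.integral_add; rule ie; simp)
    also have "\<dots> = ?I * ?C + ?I * ?D" by (simp only: p m)
    also have "(1/2) * (?I * ?C + ?I * ?D) = expectation (\<lambda>\<omega>. cos (t * V \<omega>)) *\<^sub>R ?I"
      by (simp add: Complex_eq scaleR_conv_of_real algebra_simps)
    finally show "(LINT \<omega>|M. cos (t * V \<omega>) *\<^sub>R cis (s * U \<omega>)) = expectation (\<lambda>\<omega>. cos (t * V \<omega>)) *\<^sub>R (LINT \<omega>|M. cis (s * U \<omega>))" .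
    have "sin (t * V \<omega>) *\<^sub>R cis (s * U \<omega>) = (-\<i>/2) * (cis (s * U \<omega> + t * V \<omega>) - cis (s * U \<omega> + (-t) * V \<omega>))" for \<omega>
      by (simp add: complex_eq_iff cos_add sin_add cos_diff sin_diff)
    then have "(LINT \<omega>|M. sin (t * V \<omega>) *\<^sub>R cis (s * U \<omega>)) = (-\<i>/2) * (LINT \<omega>|M. cis (s * U \<omega> + t * V \<omega>) - cis (s * U \<omega> + (-t) * V \<omega>))"
      by (simp only: integral_mult_right_zero)
    also have "(LINT \<omega>|M. cis (s * U \<omega> + t * V \<omega>) - cis (s * U \<omega> + (-t) * V \<omega>)) = (LINT \<omega>|M. cis (s * U \<omega> + t * V \<omega>)) - (LINT \<omega>|M. cis (s * U \<omega> + (-t) * V \<omega>))"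
      by (rule Bochner_Integration.integral_diff; rule ie; simp)
    also have "\<dots> = ?I * ?C - ?I * ?D" by (simp only: p m)
    also have "(-\<i>/2) * (?I * ?C - ?I * ?D) = expectation (\<lambda>\<omega>. sin (t * V \<omega>)) *\<^sub>R ?I"
      by (simp add: Complex_eq scaleR_conv_of_real algebra_simps)
    finally show "(LINT \<omega>|M. sin (t * V \<omega>) *\<^sub>R cis (s * U \<omega>)) = expectation (\<lambda>\<omega>. sin (t * V \<omega>)) *\<^sub>R (LINT \<omega>|M. cis (s * U \<omega>))" .
  qed
  have trig: "(LINT \<omega>|M. f (t * V \<omega>) * indicator B (U \<omega>)) = (LINT \<omega>|M. f (t * V \<omega>)) * (LINT \<omega>|M. indicator B (U \<omega>))"
    if B[measurable]: "B \<in> sets borel" and f: "f = cos \<or> f = sin" for B t and f :: "real \<Rightarrow> real"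
  proof -
    have [measurable]: "f \<in> borel_measurable borel" using f by auto
    have fb: "-1 \<le> f x" "f x \<le> 1" for x using f by auto
    have fa: "\<bar>f x\<bar> \<le> 1" for x using f by auto
    have fi: "integrable M (\<lambda>\<omega>. f (t * V \<omega>))" using f ic by auto
    have fib: "integrable M (\<lambda>\<omega>. f (t * V \<omega>) * indicator B (U \<omega>))"
      by (rule integrable_const_bound[where B=1]) (auto simp: indicator_def fa)
    have bi: "integrable M (\<lambda>\<omega>. indicator B (U \<omega>) :: real)"
      by (rule integrable_const_bound[where B=1]) (auto simp: indicator_def)
    have fie: "integrable M (\<lambda>\<omega>. f (t * V \<omega>) *\<^sub>R cis (s * U \<omega>))" for s
      by (rule integrable_const_bound[where B=1]) (auto simp: fa)
    have "(LINT \<omega>|M. (1 + f (t * V \<omega>)) * indicator B (U \<omega>)) = expectation (\<lambda>\<omega>. 1 + f (t * V \<omega>)) * (LINT \<omega>|M. indicator B (U \<omega>))"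
    proof (rule weighted_law_eq[where K=2])
      show "0 \<le> 1 + f (t * V \<omega>)" "1 + f (t * V \<omega>) \<le> 2" for \<omega> using fb[of "t * V \<omega>"] by auto
      show "(LINT \<omega>|M. (1 + f (t * V \<omega>)) *\<^sub>R cis (s * U \<omega>)) =
          expectation (\<lambda>\<omega>. 1 + f (t * V \<omega>)) *\<^sub>R (LINT \<omega>|M. cis (s * U \<omega>))" for s
      proof -
        have "(LINT \<omega>|M. (1 + f (t * V \<omega>)) *\<^sub>R cis (s * U \<omega>)) = (LINT \<omega>|M. cis (s * U \<omega>)) + (LINT \<omega>|M. f (t * V \<omega>) *\<^sub>R cis (s * U \<omega>))"
          unfolding scaleR_add_left scaleR_one by (rule Bochner_Integration.integral_add) (auto intro: ie fie)
        also have "(LINT \<omega>|M. f (t * V \<omega>) *\<^sub>R cis (s * U \<omega>)) = expectation (\<lambda>\<omega>. f (t * V \<omega>)) *\<^sub>R (LINT \<omega>|M. cis (s * U \<omega>))"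
          using f coscis[of t s] sincis[of t s] by auto
        finally show ?thesis using fi by (simp add: scaleR_add_left prob_space)
      qed
    qed auto
    then show ?thesis using fi fib bi by (simp add: distrib_right prob_space)
  qed
  have main: "prob {\<omega>\<in>space M. U \<omega> \<in> B \<and> V \<omega> \<in> C} = prob {\<omega>\<in>space M. U \<omega> \<in> B} * prob {\<omega>\<in>space M. V \<omega> \<in> C}"
    if [measurable]: "B \<in> sets borel" "C \<in> sets borel" for B C
  proof -
    let ?i = "\<lambda>\<omega>. indicator B (U \<omega>) :: real"
    have bf: "integrable M (\<lambda>\<omega>. cos (t * V \<omega>) * ?i \<omega>)" "integrable M (\<lambda>\<omega>. sin (t * V \<omega>) * ?i \<omega>)"
       "integrable M (\<lambda>\<omega>. ?i \<omega> *\<^sub>R cis (t * V \<omega>))" for t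
      by (rule integrable_const_bound[where B=1]; auto simp: indicator_def)+
    have "(LINT \<omega>|M. ?i \<omega> * indicator C (V \<omega>)) = expectation ?i * (LINT \<omega>|M. indicator C (V \<omega>))"
    proof (rule weighted_law_eq[where K=1])
      show "0 \<le> ?i \<omega>" "?i \<omega> \<le> 1" for \<omega> by (auto simp: indicator_def)
      show "(LINT \<omega>|M. ?i \<omega> *\<^sub>R cis (t * V \<omega>)) = expectation ?i *\<^sub>R (LINT \<omega>|M. cis (t * V \<omega>))" for t
      proof -
        have "(LINT \<omega>|M. ?i \<omega> *\<^sub>R cis (t * V \<omega>)) = Complex (LINT \<omega>|M. cos (t * V \<omega>) * ?i \<omega>) (LINT \<omega>|M. sin (t * V \<omega>) * ?i \<omega>)"
          using integral_Re[OF bf(3)[of t]] integral_Im[OF bf(3)[of t]] by (simp add: complex_eq_iff mult.commute)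
        also have "\<dots> = expectation ?i *\<^sub>R (LINT \<omega>|M. cis (t * V \<omega>))"
          using trig[of B cos t] trig[of B sin t] by (subst Ecis) (simp_all add: complex_eq_iff)
        finally show ?thesis .
      qed
    qed auto
    moreover have "(LINT \<omega>|M. ?i \<omega> * indicator C (V \<omega>)) = (LINT \<omega>|M. indicator {\<omega>\<in>space M. U \<omega> \<in> B \<and> V \<omega> \<in> C} \<omega>)"
      by (intro Bochner_Integration.integral_cong) (auto simp: indicator_def)
    moreover have "expectation ?i = (LINT \<omega>|M. indicator {\<omega>\<in>space M. U \<omega> \<in> B} \<omega>)"
      by (intro Bochner_Integration.integral_cong) (auto simp: indicator_def)
    moreover have "(LINT \<omega>|M. indicator C (V \<omega>)) = (LINT \<omega>|M. indicator {\<omega>\<in>space M. V \<omega> \<in> C} \<omega> :: real)"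
      by (intro Bochner_Integration.integral_cong) (auto simp: indicator_def)
    ultimately show ?thesis by simp
  qed
  have "indep_set (sigma_sets (space M) {U -` A \<inter> space M |A. A \<in> sets borel}) (sigma_sets (space M) {V -` A \<inter> space M |A. A \<in> sets borel})"
  proof (intro indep_set_sigma_sets indep_setI)
    fix a b assume "a \<in> {U -` A \<inter> space M |A. A \<in> sets borel}" "b \<in> {V -` A \<inter> space M |A. A \<in> sets borel}"
    then obtain B C where BC: "B \<in> sets borel" "C \<in> sets borel" "a = U -` B \<inter> space M" "b = V -` C \<inter> space M" by auto
    have "a = {\<omega>\<in>space M. U \<omega> \<in> B}" "b = {\<omega>\<in>space M. V \<omega> \<in> C}" "a \<inter> b = {\<omega>\<in>space M. U \<omega> \<in> B \<and> V \<omega> \<in> C}"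
      using BC by auto
    then show "prob (a \<inter> b) = prob a * prob b" using main[OF BC(1,2)] by simp
  next
    have "Int_stable {W -` A \<inter> space M |A. A \<in> sets borel}" for W :: "'a \<Rightarrow> real"
      unfolding Int_stable_def by (auto, rule_tac x="A \<inter> Aa" in exI, auto)
    then show "Int_stable {U -` A \<inter> space M |A. A \<in> sets borel}" "Int_stable {V -` A \<inter> space M |A. A \<in> sets borel}" by auto
  qed auto
  then show ?thesis unfolding indep_var_eq by simp
qed

section \<open>Gaussian pairs\<close>

lemma (in prob_space) gaussian_rv_standardized:
  assumes "gaussian_rv M U" "expectation U = 0" "variance U = v"
  shows "distr M borel U = normal_law 0 (sqrt v)"
proof -
  from assms(1) obtain m s where [measurable]: "U \<in> borel_measurable M" and s: "s \<ge> 0" and U: "distr M borel U = normal_law m s"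
    unfolding gaussian_rv_def by auto
  from normal_law_moments[OF _ U s] assms(2,3) have "m = 0" "s\<^sup>2 = v" by auto
  then show ?thesis using U s by auto
qed

lemma (in prob_space) bivariate_gaussian_combination:
  assumes G: "bivariate_gaussian M U V"
    and m: "expectation U = 0" "expectation V = 0" "variance U = 1" "variance V = 1" "corr M U V = \<rho>"
  shows "U \<in> borel_measurable M" "V \<in> borel_measurable M"
    and "distr M borel (\<lambda>\<omega>. a * U \<omega> + b * V \<omega>) = normal_law 0 (sqrt (a\<^sup>2 + 2 * \<rho> * a * b + b\<^sup>2))"
    and "0 \<le> a\<^sup>2 + 2 * \<rho> * a * b + b\<^sup>2"
proof -
  have g: "gaussian_rv M (\<lambda>\<omega>. a * U \<omega> + b * V \<omega>)" for a b
    using G by (simp add: bivariate_gaussian_def)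
  have gU: "gaussian_rv M U" using g[of 1 0] by simp
  have gV: "gaussian_rv M V" using g[of 0 1] by simp
  have gUV: "gaussian_rv M (\<lambda>\<omega>. U \<omega> + V \<omega>)" using g[of 1 1] by simp
  show [measurable]: "U \<in> borel_measurable M" "V \<in> borel_measurable M"
    using gU gV unfolding gaussian_rv_def by blast+
  have iq: "integrable M W" "integrable M (\<lambda>\<omega>. (W \<omega>)\<^sup>2)" if "gaussian_rv M W" for W
    using that normal_law_moments(1,2)[of W] unfolding gaussian_rv_def by blast+
  note [simp] = iq[OF gU] iq[OF gV]
  have "(\<lambda>\<omega>. U \<omega> * V \<omega>) = (\<lambda>\<omega>. ((U \<omega> + V \<omega>)\<^sup>2 - (U \<omega>)\<^sup>2 - (V \<omega>)\<^sup>2) / 2)"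
    by (auto simp: power2_sum)
  then have [simp]: "integrable M (\<lambda>\<omega>. U \<omega> * V \<omega>)"
    using iq(2)[OF gUV] by simp
  have c: "expectation (\<lambda>\<omega>. U \<omega> * V \<omega>) = \<rho>" "expectation (\<lambda>\<omega>. (U \<omega>)\<^sup>2) = 1" "expectation (\<lambda>\<omega>. (V \<omega>)\<^sup>2) = 1"
    using m by (simp_all add: corr_def cov_def)
  have e0: "expectation (\<lambda>\<omega>. a * U \<omega> + b * V \<omega>) = 0" using m by simp
  have "variance (\<lambda>\<omega>. a * U \<omega> + b * V \<omega>) = expectation (\<lambda>\<omega>. a\<^sup>2 * (U \<omega>)\<^sup>2 + 2 * a * b * (U \<omega> * V \<omega>) + b\<^sup>2 * (V \<omega>)\<^sup>2)"
    unfolding e0 by (intro Bochner_Integration.integral_cong) (auto simp: power2_eq_square algebra_simps)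
  also have "\<dots> = a\<^sup>2 + 2 * \<rho> * a * b + b\<^sup>2"
    by (simp add: c)
  finally have v: "variance (\<lambda>\<omega>. a * U \<omega> + b * V \<omega>) = a\<^sup>2 + 2 * \<rho> * a * b + b\<^sup>2" .
  show "distr M borel (\<lambda>\<omega>. a * U \<omega> + b * V \<omega>) = normal_law 0 (sqrt (a\<^sup>2 + 2 * \<rho> * a * b + b\<^sup>2))"
    by (rule gaussian_rv_standardized[OF g e0 v])
  show "0 \<le> a\<^sup>2 + 2 * \<rho> * a * b + b\<^sup>2"
    unfolding v[symmetric] by (rule variance_positive)
qed

text \<open>The residual \<open>U - \<rho> V\<close> is uncorrelated with \<open>V\<close>, and since all linear combinations are normal the joint
  characteristic function factors. This also covers correlation \<open>\<plusminus>1\<close>, where \<open>U - \<rho> V\<close> is almost surely \<open>0\<close>.\<close>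

lemma (in prob_space) bivariate_gaussian_regression:
  assumes G: "bivariate_gaussian M U V"
    and m: "expectation U = 0" "expectation V = 0" "variance U = 1" "variance V = 1" "corr M U V = \<rho>"
  shows "distr M borel (\<lambda>\<omega>. U \<omega> - \<rho> * V \<omega>) = normal_law 0 (sqrt (1 - \<rho>\<^sup>2))"
    and "indep_var borel (\<lambda>\<omega>. U \<omega> - \<rho> * V \<omega>) borel V"
proof -
  note comb = bivariate_gaussian_combination[OF assms]
  note [measurable] = comb(1,2)
  show "distr M borel (\<lambda>\<omega>. U \<omega> - \<rho> * V \<omega>) = normal_law 0 (sqrt (1 - \<rho>\<^sup>2))"
    using comb(3)[of 1 "-\<rho>"] by (simp add: power2_eq_square)
  show "indep_var borel (\<lambda>\<omega>. U \<omega> - \<rho> * V \<omega>) borel V"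
  proof (rule indep_var_if_joint_char)
    fix s t :: real
    have ch: "expectation (\<lambda>\<omega>. cis (a * U \<omega> + b * V \<omega>)) = of_real (exp (- (a\<^sup>2 + 2 * \<rho> * a * b + b\<^sup>2) / 2))" for a b
    proof -
      have "expectation (\<lambda>\<omega>. cis (a * U \<omega> + b * V \<omega>)) = expectation (\<lambda>\<omega>. exp (\<i> * of_real (a * U \<omega> + b * V \<omega>)))"
        by (simp only: cis_conv_exp)
      also have "\<dots> = exp (\<i> * of_real 0 + \<i>\<^sup>2 * of_real ((sqrt (a\<^sup>2 + 2 * \<rho> * a * b + b\<^sup>2))\<^sup>2) / 2)"
        by (rule normal_law_cexp(2)[OF _ comb(3)]) (use comb(4) in auto)
      also have "\<dots> = exp (of_real (- (a\<^sup>2 + 2 * \<rho> * a * b + b\<^sup>2) / 2))"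
        using comb(4)[of a b] by simp
      finally show ?thesis by (simp only: exp_of_real)
    qed
    have "(\<lambda>\<omega>. cis (s * (U \<omega> - \<rho> * V \<omega>) + t * V \<omega>)) = (\<lambda>\<omega>. cis (s * U \<omega> + (t - s * \<rho>) * V \<omega>))"
      by (simp add: algebra_simps)
    moreover have "(\<lambda>\<omega>. cis (s * (U \<omega> - \<rho> * V \<omega>))) = (\<lambda>\<omega>. cis (s * U \<omega> + (- s * \<rho>) * V \<omega>))"
      by (simp add: algebra_simps)
    moreover have "(\<lambda>\<omega>. cis (t * V \<omega>)) = (\<lambda>\<omega>. cis (0 * U \<omega> + t * V \<omega>))" by simp
    ultimately show "expectation (\<lambda>\<omega>. cis (s * (U \<omega> - \<rho> * V \<omega>) + t * V \<omega>)) =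
        expectation (\<lambda>\<omega>. cis (s * (U \<omega> - \<rho> * V \<omega>))) * expectation (\<lambda>\<omega>. cis (t * V \<omega>))"
      by (simp only: ch flip: of_real_mult exp_add)
         (simp add: power2_eq_square field_simps)
  qed auto
qed

lemma (in prob_space) normal_law_exp:
  assumes [measurable]: "U \<in> borel_measurable M" and U: "distr M borel U = normal_law 0 s" and s: "s \<ge> 0"
  shows "integrable M (\<lambda>\<omega>. exp (c * U \<omega>))"
    and "expectation (\<lambda>\<omega>. exp (c * U \<omega>)) = exp (c\<^sup>2 * s\<^sup>2 / 2)"
proof -
  have eq: "exp (of_real c * of_real (U \<omega>)) = complex_of_real (exp (c * U \<omega>))" for \<omega>
    by (simp only: of_real_mult exp_of_real[symmetric])
  have eq2: "exp (of_real c * of_real 0 + (of_real c)\<^sup>2 * of_real (s\<^sup>2) / 2) = complex_of_real (exp (c\<^sup>2 * s\<^sup>2 / 2))"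
    unfolding exp_of_real[symmetric] by simp
  from normal_law_cexp[OF assms, of "of_real c"]
  show "integrable M (\<lambda>\<omega>. exp (c * U \<omega>))" "expectation (\<lambda>\<omega>. exp (c * U \<omega>)) = exp (c\<^sup>2 * s\<^sup>2 / 2)"
    unfolding eq eq2 integral_complex_of_real complex_of_real_integrable_eq of_real_eq_iff by auto
qed

section \<open>The summands of the partition function\<close>

locale gaussian_sample = prob_space M for M :: "'a measure" +
  fixes \<rho> :: real and X Y :: "nat \<Rightarrow> 'a \<Rightarrow> real"
  assumes rho: "\<rho> \<in> {-1..1}" and sequence: "gaussian_iid_sequence M \<rho> X Y"
begin

lemma indep_pairs: "indep_vars (\<lambda>_. borel) (\<lambda>k \<omega>. (X k \<omega>, Y k \<omega>)) {1..}"
  and same_law: "k \<ge> 1 \<Longrightarrow> distr M borel (\<lambda>\<omega>. (X k \<omega>, Y k \<omega>)) = distr M borel (\<lambda>\<omega>. (X 1 \<omega>, Y 1 \<omega>))"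
  and pair_gaussian: "k \<ge> 1 \<Longrightarrow> bivariate_gaussian M (X k) (Y k)"
  and pair_moments: "k \<ge> 1 \<Longrightarrow> expectation (X k) = 0" "k \<ge> 1 \<Longrightarrow> expectation (Y k) = 0"
     "k \<ge> 1 \<Longrightarrow> variance (X k) = 1" "k \<ge> 1 \<Longrightarrow> variance (Y k) = 1" "k \<ge> 1 \<Longrightarrow> corr M (X k) (Y k) = \<rho>"
  using sequence unfolding gaussian_iid_sequence_def by blast+

lemma measurable_X [measurable]: "k \<ge> 1 \<Longrightarrow> X k \<in> borel_measurable M"
  and measurable_Y [measurable]: "k \<ge> 1 \<Longrightarrow> Y k \<in> borel_measurable M"
  using bivariate_gaussian_combination(1,2)[OF pair_gaussian pair_moments] by auto

lemma law_X: "k \<ge> 1 \<Longrightarrow> distr M borel (X k) = normal_law 0 1"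
  and law_Y: "k \<ge> 1 \<Longrightarrow> distr M borel (Y k) = normal_law 0 1"
  using bivariate_gaussian_combination(3)[OF pair_gaussian pair_moments, of k 1 0]
    bivariate_gaussian_combination(3)[OF pair_gaussian pair_moments, of k 0 1] by simp_all

lemma regression:
  assumes "k \<ge> 1"
  shows "distr M borel (\<lambda>\<omega>. X k \<omega> - \<rho> * Y k \<omega>) = normal_law 0 (sqrt (1 - \<rho>\<^sup>2))"
    and "indep_var borel (\<lambda>\<omega>. X k \<omega> - \<rho> * Y k \<omega>) borel (Y k)"
  using bivariate_gaussian_regression[OF pair_gaussian pair_moments] assms by auto

lemma exp_X:
  assumes "k \<ge> 1"
  shows "integrable M (\<lambda>\<omega>. exp (c * X k \<omega>))" "expectation (\<lambda>\<omega>. exp (c * X k \<omega>)) = exp (c\<^sup>2 / 2)"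
  using normal_law_exp[OF measurable_X law_X, of k c] assms by simp_all

lemma integral_pair:
  fixes f :: "real \<times> real \<Rightarrow> 'b :: {banach, second_countable_topology}"
  assumes [measurable]: "f \<in> borel_measurable borel" and k: "k \<ge> 1"
  shows "(LINT \<omega>|M. f (X k \<omega>, Y k \<omega>)) = (LINT \<omega>|M. f (X 1 \<omega>, Y 1 \<omega>))"
proof -
  have [measurable]: "(\<lambda>\<omega>. (X j \<omega>, Y j \<omega>)) \<in> borel_measurable M" if "j \<ge> 1" for j
    using that by measurable
  have "(LINT \<omega>|M. f (X j \<omega>, Y j \<omega>)) = (LINT z|distr M borel (\<lambda>\<omega>. (X j \<omega>, Y j \<omega>)). f z)" if "j \<ge> 1" for j
    using that by (subst integral_distr) auto
  from this[OF k] this[of 1] show ?thesis unfolding same_law[OF k] by simp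
qed

text \<open>The summand of the partition function as a function of the pair \<open>(X, Y)\<close>.\<close>

definition weight :: "real \<times> real \<Rightarrow> nat \<Rightarrow> real \<times> real \<Rightarrow> complex" where
  "weight \<beta> N z = exp (complex_of_real (sqrt (ln (real N))) *
     (complex_of_real (fst \<beta> * fst z) + \<i> * complex_of_real (snd \<beta> * snd z)))"

lemma weight_measurable [measurable]: "weight \<beta> N \<in> borel_measurable borel"
  unfolding weight_def[abs_def]
  by (intro borel_measurable_continuous_onI continuous_intros)

lemma partition_fn_eq: "partition_fn X Y N \<beta> \<omega> = (\<Sum>k=1..N. weight \<beta> N (X k \<omega>, Y k \<omega>))"
  by (simp add: partition_fn_def weight_def split: prod.splits)

lemma norm_weight: "norm (weight \<beta> N (x, y)) = exp (sqrt (ln N) * fst \<beta> * x)"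
  by (simp add: weight_def mult.assoc)

lemma partition_fn_measurable [measurable]: "partition_fn X Y N \<beta> \<in> borel_measurable M"
proof -
  have [measurable]: "(\<lambda>\<omega>. (X k \<omega>, Y k \<omega>)) \<in> borel_measurable M" if "k \<ge> 1" for k
    using that by measurable
  show ?thesis unfolding partition_fn_eq[abs_def] by (intro borel_measurable_sum) auto
qed

text \<open>With \<open>V = X - \<rho> Y\<close>, the weight is a product of a function of \<open>V\<close> and one of the independent
  variable \<open>Y\<close>, namely \<open>exp (c Y)\<close> with complex \<open>c\<close>.\<close>

lemma weight_mean:
  assumes k: "k \<ge> 1" and N: "N \<ge> 1"
  shows "integrable M (\<lambda>\<omega>. weight (\<sigma>, \<tau>) N (X k \<omega>, Y k \<omega>))"
    and "norm (LINT \<omega>|M. weight (\<sigma>, \<tau>) N (X k \<omega>, Y k \<omega>)) = exp (ln N * (\<sigma>\<^sup>2 - \<tau>\<^sup>2) / 2)"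
proof -
  define r where "r = sqrt (ln (real N))"
  have r2: "r\<^sup>2 = ln N" using N by (simp add: r_def)
  note [measurable] = measurable_X[OF k] measurable_Y[OF k]
  define V where "V \<omega> = X k \<omega> - \<rho> * Y k \<omega>" for \<omega>
  have [measurable]: "V \<in> borel_measurable M" unfolding V_def by measurable
  have V: "distr M borel V = normal_law 0 (sqrt (1 - \<rho>\<^sup>2))" and ind: "indep_var borel V borel (Y k)"
    using regression[OF k] unfolding V_def by auto
  have s: "0 \<le> 1 - \<rho>\<^sup>2" using rho by (simp add: abs_square_le_1 abs_le_iff)
  define c where "c = of_real r * Complex (\<sigma> * \<rho>) \<tau>"
  have w: "weight (\<sigma>, \<tau>) N (X k \<omega>, Y k \<omega>) = exp (of_real (r * \<sigma>) * of_real (V \<omega>)) * exp (c * of_real (Y k \<omega>))" for \<omega>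
    unfolding weight_def r_def[symmetric] exp_add[symmetric]
    by (rule arg_cong[where f=exp]) (simp add: c_def V_def complex_eq_iff algebra_simps)
  have ind': "indep_var borel (\<lambda>\<omega>. exp (complex_of_real (r * \<sigma>) * of_real (V \<omega>))) borel (\<lambda>\<omega>. exp (c * of_real (Y k \<omega>)))"
    using indep_var_compose[OF ind, of "\<lambda>v. exp (complex_of_real (r * \<sigma>) * of_real v)" borel "\<lambda>v. exp (c * of_real v)" borel]
    by (simp add: comp_def)
  have i1: "integrable M (\<lambda>\<omega>. exp (complex_of_real (r * \<sigma>) * of_real (V \<omega>)))"
    and e1: "(LINT \<omega>|M. exp (complex_of_real (r * \<sigma>) * of_real (V \<omega>))) = exp ((of_real (r * \<sigma>))\<^sup>2 * of_real (1 - \<rho>\<^sup>2) / 2)"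
    using normal_law_cexp[OF _ V, of "of_real (r * \<sigma>)"] s by simp_all
  have i2: "integrable M (\<lambda>\<omega>. exp (c * of_real (Y k \<omega>)))"
    and e2: "(LINT \<omega>|M. exp (c * of_real (Y k \<omega>))) = exp (c\<^sup>2 / 2)"
    using normal_law_cexp[OF _ law_Y[OF k], of c] by simp_all
  show "integrable M (\<lambda>\<omega>. weight (\<sigma>, \<tau>) N (X k \<omega>, Y k \<omega>))"
    unfolding w by (rule indep_var_integrable[OF ind' i1 i2])
  have "(LINT \<omega>|M. weight (\<sigma>, \<tau>) N (X k \<omega>, Y k \<omega>)) = exp ((of_real (r * \<sigma>))\<^sup>2 * of_real (1 - \<rho>\<^sup>2) / 2) * exp (c\<^sup>2 / 2)"
    unfolding w by (subst indep_var_lebesgue_integral[OF ind' i1 i2]) (simp only: e1 e2)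
  also have "norm \<dots> = exp ((r * \<sigma>)\<^sup>2 * (1 - \<rho>\<^sup>2) / 2 + r\<^sup>2 * ((\<sigma> * \<rho>)\<^sup>2 - \<tau>\<^sup>2) / 2)"
    by (simp add: norm_mult exp_add c_def power2_eq_square algebra_simps)
  also have "\<dots> = exp (r\<^sup>2 * (\<sigma>\<^sup>2 - \<tau>\<^sup>2) / 2)"
    by (rule arg_cong[where f=exp]) (simp add: power2_eq_square field_simps)
  finally show "norm (LINT \<omega>|M. weight (\<sigma>, \<tau>) N (X k \<omega>, Y k \<omega>)) = exp (ln N * (\<sigma>\<^sup>2 - \<tau>\<^sup>2) / 2)"
    by (simp add: r2)
qed

end

section \<open>Deviation of the partition function from its mean\<close>

text \<open>The covariances vanish, so the second moment of the centred sum is at most \<open>c\<^sup>2\<close>; the first moment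
  is then at most \<open>c\<close> since \<open>2 c t \<le> t\<^sup>2 + c\<^sup>2\<close>.\<close>

lemma (in prob_space) L1_deviation_indep_sum:
  fixes G :: "'i \<Rightarrow> 'a \<Rightarrow> complex" and B c :: real
  assumes ind: "indep_vars (\<lambda>_. borel) G I" and fin: "finite I"
    and int: "\<And>k. k \<in> I \<Longrightarrow> integrable M (\<lambda>\<omega>. (norm (G k \<omega>))\<^sup>2)"
    and B: "\<And>k. k \<in> I \<Longrightarrow> expectation (\<lambda>\<omega>. (norm (G k \<omega>))\<^sup>2) \<le> B"
    and c: "c > 0" "card I * B \<le> c\<^sup>2"
  shows "integrable M (\<lambda>\<omega>. norm ((\<Sum>k\<in>I. G k \<omega>) - (\<Sum>k\<in>I. expectation (G k))))" (is "integrable M ?D")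
    and "expectation (\<lambda>\<omega>. norm ((\<Sum>k\<in>I. G k \<omega>) - (\<Sum>k\<in>I. expectation (G k)))) \<le> c"
proof -
  have [measurable]: "k \<in> I \<Longrightarrow> G k \<in> borel_measurable M" for k
    using ind by (auto simp: indep_vars_def)
  have iG: "integrable M (G k)" if "k \<in> I" for k
  proof (rule Bochner_Integration.integrable_bound)
    show "integrable M (\<lambda>\<omega>. 1 + (norm (G k \<omega>))\<^sup>2)" using int[OF that] by simp
    have "norm (G k \<omega>) \<le> 1 + (norm (G k \<omega>))\<^sup>2" for \<omega>
      using zero_le_power2[of "norm (G k \<omega>) - 1"] by (simp add: power2_diff) (smt (verit) norm_ge_zero)
    then show "AE \<omega> in M. norm (G k \<omega>) \<le> norm (1 + (norm (G k \<omega>))\<^sup>2)" by (simp add: abs_of_nonneg)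
  qed (use that in measurable)
  define H where "H k \<omega> = G k \<omega> - expectation (G k)" for k \<omega>
  have [measurable]: "k \<in> I \<Longrightarrow> H k \<in> borel_measurable M" for k unfolding H_def by measurable
  have iH: "integrable M (H k)" and eH: "expectation (H k) = 0" if "k \<in> I" for k
    unfolding H_def using iG[OF that] by (simp_all add: prob_space)
  have HH: "integrable M (\<lambda>\<omega>. H j \<omega> * cnj (H k \<omega>))"
    "expectation (\<lambda>\<omega>. H j \<omega> * cnj (H k \<omega>)) = 0" if jk: "j \<in> I" "k \<in> I" "j \<noteq> k" for j k
  proof -
    define h where "h i z = (if i = k then cnj (z - expectation (G i)) else z - expectation (G i))" for i z
    have [measurable]: "h i \<in> borel_measurable borel" for i
      unfolding h_def[abs_def] by (cases "i = k") (auto intro!: borel_measurable_continuous_onI continuous_intros)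
    have ind2: "indep_vars (\<lambda>_. borel) (\<lambda>i \<omega>. h i (G i \<omega>)) {j, k}"
      by (rule indep_vars_compose2[OF indep_vars_subset[OF ind]]) (use jk in auto)
    have hj: "(\<lambda>\<omega>. h j (G j \<omega>)) = H j" and hk: "(\<lambda>\<omega>. h k (G k \<omega>)) = (\<lambda>\<omega>. cnj (H k \<omega>))"
      using jk by (auto simp: h_def H_def)
    have ih: "integrable M (\<lambda>\<omega>. h i (G i \<omega>))" if "i \<in> {j, k}" for i
      using that iH jk hj hk by auto
    have pr: "(\<lambda>\<omega>. \<Prod>i\<in>{j, k}. h i (G i \<omega>)) = (\<lambda>\<omega>. H j \<omega> * cnj (H k \<omega>))"
      using jk by (auto simp: h_def H_def)
    show "integrable M (\<lambda>\<omega>. H j \<omega> * cnj (H k \<omega>))"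
      using indep_vars_integrable[OF _ ind2 ih] unfolding pr by simp
    have "expectation (\<lambda>\<omega>. H j \<omega> * cnj (H k \<omega>)) = (\<Prod>i\<in>{j, k}. expectation (\<lambda>\<omega>. h i (G i \<omega>)))"
      using indep_vars_lebesgue_integral[OF _ ind2 ih] unfolding pr by simp
    also have "\<dots> = 0" using jk eH by (simp add: hj)
    finally show "expectation (\<lambda>\<omega>. H j \<omega> * cnj (H k \<omega>)) = 0" .
  qed
  have H2: "integrable M (\<lambda>\<omega>. (norm (H k \<omega>))\<^sup>2)" "expectation (\<lambda>\<omega>. (norm (H k \<omega>))\<^sup>2) \<le> B" if k: "k \<in> I" for k
  proof -
    let ?e = "expectation (G k)"
    define S where "S \<omega> = Re (cnj ?e * G k \<omega>)" for \<omega>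
    have eq: "(norm (H k \<omega>))\<^sup>2 = (norm (G k \<omega>))\<^sup>2 - 2 * S \<omega> + (norm ?e)\<^sup>2" for \<omega>
      unfolding H_def S_def cmod_power2 by (simp add: power2_eq_square algebra_simps)
    have i3: "integrable M S"
      unfolding S_def[abs_def] using iG[OF k] by (intro integrable_Re integrable_mult_right) auto
    show "integrable M (\<lambda>\<omega>. (norm (H k \<omega>))\<^sup>2)" unfolding eq using int[OF k] i3 by auto
    have "expectation S = Re (expectation (\<lambda>\<omega>. cnj ?e * G k \<omega>))"
      unfolding S_def using iG[OF k] by (intro integral_Re integrable_mult_right) auto
    also have "\<dots> = (norm ?e)\<^sup>2"
      by (simp add: cmod_power2) (simp add: power2_eq_square)
    finally have "expectation (\<lambda>\<omega>. (norm (H k \<omega>))\<^sup>2) = expectation (\<lambda>\<omega>. (norm (G k \<omega>))\<^sup>2) - (norm ?e)\<^sup>2"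
      unfolding eq using int[OF k] i3 by (simp add: prob_space)
    with B[OF k] show "expectation (\<lambda>\<omega>. (norm (H k \<omega>))\<^sup>2) \<le> B"
      using zero_le_power2[of "norm ?e"] by linarith
  qed
  have sq: "complex_of_real ((norm (\<Sum>k\<in>I. H k \<omega>))\<^sup>2) = (\<Sum>j\<in>I. \<Sum>k\<in>I. H j \<omega> * cnj (H k \<omega>))" for \<omega>
    by (simp add: complex_norm_square sum_product del: of_real_power)
  have iHH: "integrable M (\<lambda>\<omega>. H j \<omega> * cnj (H k \<omega>))" if "j \<in> I" "k \<in> I" for j k
    using that HH(1)[of j k] H2(1)[of k] by (cases "j = k") (auto simp del: of_real_power simp flip: complex_norm_square)
  have "integrable M (\<lambda>\<omega>. complex_of_real ((norm (\<Sum>k\<in>I. H k \<omega>))\<^sup>2))"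
    unfolding sq by (intro Bochner_Integration.integrable_sum iHH)
  then have iS: "integrable M (\<lambda>\<omega>. (norm (\<Sum>k\<in>I. H k \<omega>))\<^sup>2)"
    by (simp only: complex_of_real_integrable_eq)
  have "complex_of_real (expectation (\<lambda>\<omega>. (norm (\<Sum>k\<in>I. H k \<omega>))\<^sup>2)) = expectation (\<lambda>\<omega>. \<Sum>j\<in>I. \<Sum>k\<in>I. H j \<omega> * cnj (H k \<omega>))"
    unfolding sq[symmetric] by (rule integral_complex_of_real[symmetric])
  also have "\<dots> = (\<Sum>j\<in>I. \<Sum>k\<in>I. expectation (\<lambda>\<omega>. H j \<omega> * cnj (H k \<omega>)))"
    by (subst Bochner_Integration.integral_sum, intro Bochner_Integration.integrable_sum iHH, assumption+)
      (intro sum.cong Bochner_Integration.integral_sum iHH; simp)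
  also have "\<dots> = (\<Sum>j\<in>I. \<Sum>k\<in>I. if k = j then expectation (\<lambda>\<omega>. H j \<omega> * cnj (H j \<omega>)) else 0)"
    by (intro sum.cong refl) (use HH(2) in auto)
  also have "\<dots> = (\<Sum>j\<in>I. complex_of_real (expectation (\<lambda>\<omega>. (norm (H j \<omega>))\<^sup>2)))"
    using fin by (simp del: of_real_power flip: complex_norm_square integral_complex_of_real)
  finally have "expectation (\<lambda>\<omega>. (norm (\<Sum>k\<in>I. H k \<omega>))\<^sup>2) = (\<Sum>j\<in>I. expectation (\<lambda>\<omega>. (norm (H j \<omega>))\<^sup>2))"
    by (simp only: of_real_sum[symmetric] of_real_eq_iff)
  also have "\<dots> \<le> (\<Sum>j\<in>I. B)" by (intro sum_mono H2(2))
  finally have e2: "expectation (\<lambda>\<omega>. (norm (\<Sum>k\<in>I. H k \<omega>))\<^sup>2) \<le> c\<^sup>2" using c(2) by simp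
  have D: "?D = (\<lambda>\<omega>. norm (\<Sum>k\<in>I. H k \<omega>))" by (simp add: H_def sum_subtractf)
  have le: "norm (\<Sum>k\<in>I. H k \<omega>) \<le> (1 / (2 * c)) * (norm (\<Sum>k\<in>I. H k \<omega>))\<^sup>2 + c / 2" for \<omega>
  proof -
    have "0 \<le> (norm (\<Sum>k\<in>I. H k \<omega>) - c)\<^sup>2" by simp
    then show ?thesis using c(1) by (simp add: power2_eq_square field_simps)
  qed
  have iR: "integrable M (\<lambda>\<omega>. (1 / (2 * c)) * (norm (\<Sum>k\<in>I. H k \<omega>))\<^sup>2 + c / 2)" using iS by simp
  show iD: "integrable M ?D"
    unfolding D by (rule Bochner_Integration.integrable_bound[OF iR]) (use le in \<open>auto intro!: order_trans[OF le]\<close>)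
  have "expectation ?D \<le> expectation (\<lambda>\<omega>. (1 / (2 * c)) * (norm (\<Sum>k\<in>I. H k \<omega>))\<^sup>2 + c / 2)"
    unfolding D by (rule integral_mono) (use iD iR le in \<open>auto simp: D\<close>)
  also have "\<dots> = (1 / (2 * c)) * expectation (\<lambda>\<omega>. (norm (\<Sum>k\<in>I. H k \<omega>))\<^sup>2) + c / 2"
    using iS by (simp add: prob_space)
  also have "\<dots> \<le> (1 / (2 * c)) * c\<^sup>2 + c / 2"
    using e2 c by (intro add_mono mult_left_mono) auto
  also have "\<dots> = c" using c by (simp add: power2_eq_square)
  finally show "expectation ?D \<le> c" .
qed

context gaussian_sample
begin

definition mean_weight :: "real \<times> real \<Rightarrow> nat \<Rightarrow> complex" where
  "mean_weight \<beta> N = (LINT \<omega>|M. weight \<beta> N (X 1 \<omega>, Y 1 \<omega>))"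

lemma measurable_pair [measurable]: "k \<ge> 1 \<Longrightarrow> (\<lambda>\<omega>. (X k \<omega>, Y k \<omega>)) \<in> borel_measurable M"
  by measurable

text \<open>Split into the summands with \<open>(X, Y)\<close> in \<open>T\<close>, which are controlled by their variance, and the
  others, which are controlled by their absolute value and by the part of the mean they contribute.\<close>

lemma partition_fn_L1_deviation:
  fixes c d :: real
  assumes T: "T \<in> sets borel" and N: "N \<ge> 1" and c: "c > 0"
    and i1: "integrable M (\<lambda>\<omega>. (norm (weight \<beta> N (X 1 \<omega>, Y 1 \<omega>)))\<^sup>2 * indicator T (X 1 \<omega>, Y 1 \<omega>))"
    and b1: "N * expectation (\<lambda>\<omega>. (norm (weight \<beta> N (X 1 \<omega>, Y 1 \<omega>)))\<^sup>2 * indicator T (X 1 \<omega>, Y 1 \<omega>)) \<le> c\<^sup>2"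
    and b2: "N * expectation (\<lambda>\<omega>. norm (weight \<beta> N (X 1 \<omega>, Y 1 \<omega>)) * indicator (- T) (X 1 \<omega>, Y 1 \<omega>)) \<le> d"
  shows "integrable M (\<lambda>\<omega>. norm (partition_fn X Y N \<beta> \<omega> - N * mean_weight \<beta> N))"
    and "expectation (\<lambda>\<omega>. norm (partition_fn X Y N \<beta> \<omega> - N * mean_weight \<beta> N)) \<le> c + 2 * d"
proof -
  note [measurable] = T
  have [measurable]: "- T \<in> sets borel" using T by auto
  define F where "F z = weight \<beta> N z * indicator T z" for z
  define K where "K z = weight \<beta> N z * indicator (- T) z" for z
  have [measurable]: "F \<in> borel_measurable borel" "K \<in> borel_measurable borel"
    unfolding F_def K_def by measurable
  have FK: "weight \<beta> N z = F z + K z" for z by (auto simp: F_def K_def indicator_def)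
  define P where "P k \<omega> = (X k \<omega>, Y k \<omega>)" for k \<omega>
  have [measurable]: "k \<ge> 1 \<Longrightarrow> P k \<in> borel_measurable M" for k unfolding P_def by measurable
  have W: "integrable M (\<lambda>\<omega>. weight \<beta> N (P k \<omega>))" if "k \<ge> 1" for k
    using weight_mean(1)[OF that N, of "fst \<beta>" "snd \<beta>"] by (simp add: P_def)
  have iF: "integrable M (\<lambda>\<omega>. F (P k \<omega>))" and iK: "integrable M (\<lambda>\<omega>. K (P k \<omega>))" if "k \<ge> 1" for k
    by (rule Bochner_Integration.integrable_bound[OF W[OF that]]; use that in \<open>auto simp: F_def K_def indicator_def\<close>)+
  have tr: "expectation (\<lambda>\<omega>. f (P k \<omega>)) = expectation (\<lambda>\<omega>. f (P 1 \<omega>))" if "k \<ge> 1" "f \<in> borel_measurable borel"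
    for f :: "real \<times> real \<Rightarrow> 'c :: {banach, second_countable_topology}" and k
    unfolding P_def by (rule integral_pair) (use that in auto)
  have nF: "(norm (F z))\<^sup>2 = (norm (weight \<beta> N z))\<^sup>2 * indicator T z" for z
    by (auto simp: F_def indicator_def)
  have nK: "norm (K z) = norm (weight \<beta> N z) * indicator (- T) z" for z
    by (auto simp: K_def indicator_def)
  have iF2: "integrable M (\<lambda>\<omega>. (norm (F (P k \<omega>)))\<^sup>2)" if "k \<ge> 1" for k
  proof -
    have "integrable (distr M borel (P k)) (\<lambda>z. (norm (F z))\<^sup>2) = integrable (distr M borel (P 1)) (\<lambda>z. (norm (F z))\<^sup>2)"
      using same_law[OF that] unfolding P_def by simp
    then show ?thesis using i1 that by (subst (asm) (1 2) integrable_distr_eq) (auto simp: nF P_def)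
  qed
  have ind: "indep_vars (\<lambda>_. borel) (\<lambda>k \<omega>. F (P k \<omega>)) {1..N}"
    unfolding P_def by (rule indep_vars_compose2[OF indep_vars_subset[OF indep_pairs]]) auto
  have dev: "integrable M (\<lambda>\<omega>. norm ((\<Sum>k=1..N. F (P k \<omega>)) - (\<Sum>k=1..N. expectation (\<lambda>\<omega>. F (P k \<omega>)))))"
    "expectation (\<lambda>\<omega>. norm ((\<Sum>k=1..N. F (P k \<omega>)) - (\<Sum>k=1..N. expectation (\<lambda>\<omega>. F (P k \<omega>))))) \<le> c"
  proof -
    have i: "integrable M (\<lambda>\<omega>. (norm (F (P k \<omega>)))\<^sup>2)" if "k \<in> {1..N}" for k
      using iF2 that by simp
    have e: "expectation (\<lambda>\<omega>. (norm (F (P k \<omega>)))\<^sup>2) \<le> expectation (\<lambda>\<omega>. (norm (F (P 1 \<omega>)))\<^sup>2)" if "k \<in> {1..N}" for k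
      using tr[of k "\<lambda>z. (norm (F z))\<^sup>2"] that by (simp del: One_nat_def)
    have b: "real (card {1..N}) * expectation (\<lambda>\<omega>. (norm (F (P 1 \<omega>)))\<^sup>2) \<le> c\<^sup>2"
      using b1 unfolding nF P_def by simp
    show "integrable M (\<lambda>\<omega>. norm ((\<Sum>k=1..N. F (P k \<omega>)) - (\<Sum>k=1..N. expectation (\<lambda>\<omega>. F (P k \<omega>)))))"
      by (rule L1_deviation_indep_sum(1)[OF ind _ i e c b]) auto
    show "expectation (\<lambda>\<omega>. norm ((\<Sum>k=1..N. F (P k \<omega>)) - (\<Sum>k=1..N. expectation (\<lambda>\<omega>. F (P k \<omega>))))) \<le> c"
      by (rule L1_deviation_indep_sum(2)[OF ind _ i e c b]) auto
  qed
  have sF: "(\<Sum>k=1..N. expectation (\<lambda>\<omega>. F (P k \<omega>))) = N * expectation (\<lambda>\<omega>. F (P 1 \<omega>))"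
  proof -
    have "(\<Sum>k=1..N. expectation (\<lambda>\<omega>. F (P k \<omega>))) = (\<Sum>k=1..N. expectation (\<lambda>\<omega>. F (P 1 \<omega>)))"
      by (intro sum.cong refl tr) auto
    then show ?thesis by simp
  qed
  have mw: "mean_weight \<beta> N = expectation (\<lambda>\<omega>. F (P 1 \<omega>)) + expectation (\<lambda>\<omega>. K (P 1 \<omega>))"
    using iF[of 1] iK[of 1] by (simp add: mean_weight_def FK flip: P_def)
  have le: "norm (partition_fn X Y N \<beta> \<omega> - N * mean_weight \<beta> N)
      \<le> norm ((\<Sum>k=1..N. F (P k \<omega>)) - (\<Sum>k=1..N. expectation (\<lambda>\<omega>. F (P k \<omega>)))) +
        (\<Sum>k=1..N. norm (K (P k \<omega>))) + N * norm (expectation (\<lambda>\<omega>. K (P 1 \<omega>)))" for \<omega>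
  proof -
    have "partition_fn X Y N \<beta> \<omega> - N * mean_weight \<beta> N = ((\<Sum>k=1..N. F (P k \<omega>)) - N * expectation (\<lambda>\<omega>. F (P 1 \<omega>)))
        + (\<Sum>k=1..N. K (P k \<omega>)) - N * expectation (\<lambda>\<omega>. K (P 1 \<omega>))"
      by (simp add: partition_fn_eq FK sum.distrib mw algebra_simps flip: P_def)
    also have "norm \<dots> \<le> norm ((\<Sum>k=1..N. F (P k \<omega>)) - N * expectation (\<lambda>\<omega>. F (P 1 \<omega>))) + norm (\<Sum>k=1..N. K (P k \<omega>)) + norm (N * expectation (\<lambda>\<omega>. K (P 1 \<omega>)))"
      by (meson norm_triangle_ineq norm_triangle_ineq4 add_right_mono order_trans)
    also have "\<dots> \<le> norm ((\<Sum>k=1..N. F (P k \<omega>)) - N * expectation (\<lambda>\<omega>. F (P 1 \<omega>))) + (\<Sum>k=1..N. norm (K (P k \<omega>))) + N * norm (expectation (\<lambda>\<omega>. K (P 1 \<omega>)))"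
      by (intro add_mono norm_sum) (auto simp: norm_mult)
    finally show ?thesis unfolding sF .
  qed
  let ?R = "\<lambda>\<omega>. norm ((\<Sum>k=1..N. F (P k \<omega>)) - (\<Sum>k=1..N. expectation (\<lambda>\<omega>. F (P k \<omega>)))) +
        (\<Sum>k=1..N. norm (K (P k \<omega>))) + N * norm (expectation (\<lambda>\<omega>. K (P 1 \<omega>)))"
  have iKs: "integrable M (\<lambda>\<omega>. \<Sum>k=1..N. norm (K (P k \<omega>)))"
    by (intro Bochner_Integration.integrable_sum integrable_norm iK) auto
  have iR: "integrable M ?R" using dev(1) iKs by simp
  show iD: "integrable M (\<lambda>\<omega>. norm (partition_fn X Y N \<beta> \<omega> - N * mean_weight \<beta> N))"
    by (rule Bochner_Integration.integrable_bound[OF iR]) (auto intro!: AE_I2 order_trans[OF le])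
  have "expectation (\<lambda>\<omega>. norm (partition_fn X Y N \<beta> \<omega> - N * mean_weight \<beta> N)) \<le> expectation ?R"
    by (rule integral_mono[OF iD iR le])
  also have "\<dots> = expectation (\<lambda>\<omega>. norm ((\<Sum>k=1..N. F (P k \<omega>)) - (\<Sum>k=1..N. expectation (\<lambda>\<omega>. F (P k \<omega>)))))
     + expectation (\<lambda>\<omega>. \<Sum>k=1..N. norm (K (P k \<omega>))) + N * norm (expectation (\<lambda>\<omega>. K (P 1 \<omega>)))"
    using dev(1) iKs by (simp add: prob_space)
  also have "expectation (\<lambda>\<omega>. \<Sum>k=1..N. norm (K (P k \<omega>))) = (\<Sum>k=1..N. expectation (\<lambda>\<omega>. norm (K (P k \<omega>))))"
    by (intro Bochner_Integration.integral_sum integrable_norm iK) auto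
  also have "\<dots> = (\<Sum>k=1..N. expectation (\<lambda>\<omega>. norm (K (P 1 \<omega>))))"
    by (intro sum.cong refl tr[of _ "\<lambda>z. norm (K z)"]) auto
  also have "\<dots> = N * expectation (\<lambda>\<omega>. norm (K (P 1 \<omega>)))" by simp
  finally have "expectation (\<lambda>\<omega>. norm (partition_fn X Y N \<beta> \<omega> - N * mean_weight \<beta> N)) \<le>
      c + N * expectation (\<lambda>\<omega>. norm (K (P 1 \<omega>))) + N * norm (expectation (\<lambda>\<omega>. K (P 1 \<omega>)))"
    using dev(2) by linarith
  also have "N * norm (expectation (\<lambda>\<omega>. K (P 1 \<omega>))) \<le> N * expectation (\<lambda>\<omega>. norm (K (P 1 \<omega>)))"
    by (intro mult_left_mono integral_norm_bound) auto
  finally show "expectation (\<lambda>\<omega>. norm (partition_fn X Y N \<beta> \<omega> - N * mean_weight \<beta> N)) \<le> c + 2 * d"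
    using b2 by (simp add: nK P_def)
qed

lemma partition_fn_L1_deviation_small:
  assumes N: "N \<ge> 1" 
  shows "integrable M (\<lambda>\<omega>. norm (partition_fn X Y N (\<sigma>, \<tau>) \<omega> - N * mean_weight (\<sigma>, \<tau>) N))"
    and "expectation (\<lambda>\<omega>. norm (partition_fn X Y N (\<sigma>, \<tau>) \<omega> - N * mean_weight (\<sigma>, \<tau>) N)) \<le> exp (ln N * (1/2 + \<sigma>\<^sup>2))"
proof -
  define r where "r = sqrt (ln (real N))"
  have r2: "r\<^sup>2 = ln N" using N by (simp add: r_def)
  have n2: "(norm (weight (\<sigma>, \<tau>) N (X 1 \<omega>, Y 1 \<omega>)))\<^sup>2 = exp ((2 * r * \<sigma>) * X 1 \<omega>)" for \<omega>
    by (simp add: norm_weight r_def power2_eq_square flip: exp_add)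
  have "real N * exp ((2 * r * \<sigma>)\<^sup>2 / 2) = exp (r\<^sup>2) * exp ((2 * r * \<sigma>)\<^sup>2 / 2)" using N by (simp add: r2)
  also have "\<dots> = (exp (r\<^sup>2 * (1/2 + \<sigma>\<^sup>2)))\<^sup>2"
    by (simp add: power2_eq_square algebra_simps flip: exp_add)
  finally have e: "real N * exp ((2 * r * \<sigma>)\<^sup>2 / 2) = (exp (ln N * (1/2 + \<sigma>\<^sup>2)))\<^sup>2" unfolding r2 .
  have "integrable M (\<lambda>\<omega>. norm (partition_fn X Y N (\<sigma>, \<tau>) \<omega> - N * mean_weight (\<sigma>, \<tau>) N)) \<and>
      expectation (\<lambda>\<omega>. norm (partition_fn X Y N (\<sigma>, \<tau>) \<omega> - N * mean_weight (\<sigma>, \<tau>) N)) \<le> exp (ln N * (1/2 + \<sigma>\<^sup>2)) + 2 * 0"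
    by (intro conjI partition_fn_L1_deviation[where T=UNIV and c="exp (ln N * (1/2 + \<sigma>\<^sup>2))" and d=0] N) (use exp_X[of 1 "2 * r * \<sigma>"] e in \<open>simp_all add: n2 del: One_nat_def\<close>)
  then show "integrable M (\<lambda>\<omega>. norm (partition_fn X Y N (\<sigma>, \<tau>) \<omega> - N * mean_weight (\<sigma>, \<tau>) N))"
    "expectation (\<lambda>\<omega>. norm (partition_fn X Y N (\<sigma>, \<tau>) \<omega> - N * mean_weight (\<sigma>, \<tau>) N)) \<le> exp (ln N * (1/2 + \<sigma>\<^sup>2))"
    by simp_all
qed

text \<open>Truncation at \<open>\<bar>X\<bar> = sqrt (2 n)\<close> (in the direction of the sign of \<open>\<sigma>\<close>), the size of the maximum of
  the sample. In both parts the indicator is bounded by an exponential that equals \<open>1\<close> at the truncation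
  level and turns the integrand into a multiple of \<open>exp (\<plusminus> sqrt 2 * sqrt n * X)\<close>. The hypotheses on \<open>\<sigma>\<close>
  are what makes both exponentials monotone in the right direction.\<close>

lemma partition_fn_L1_deviation_large:
  assumes N: "N \<ge> 1" and s: "1 \<le> 2 * \<sigma>\<^sup>2" "\<bar>\<sigma>\<bar> \<le> sqrt 2"
  shows "expectation (\<lambda>\<omega>. norm (partition_fn X Y N (\<sigma>, \<tau>) \<omega> - N * mean_weight (\<sigma>, \<tau>) N)) \<le> 3 * exp (ln N * (sqrt 2 * \<bar>\<sigma>\<bar>))"
proof -
  define r where "r = sqrt (ln (real N))"
  have r2: "r\<^sup>2 = ln N" and r0: "r \<ge> 0" using N by (simp_all add: r_def)
  define a where "a = \<bar>\<sigma>\<bar>"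
  define e where "e = sgn \<sigma>"
  have e: "e * e = 1" "\<sigma> = a * e" using s by (auto simp: e_def a_def sgn_if abs_if)
  have "(sqrt 2 / 2)\<^sup>2 \<le> a\<^sup>2" using s by (simp add: a_def power_divide)
  then have "sqrt 2 / 2 \<le> a" by (rule power2_le_imp_le) (simp add: a_def)
  then have a: "sqrt 2 / 2 \<le> a" "a \<le> sqrt 2" using s by (auto simp: a_def)
  define T where "T = {z :: real \<times> real. e * fst z \<le> sqrt 2 * r}"
  have T: "T \<in> sets borel" unfolding T_def
    by (intro borel_closed closed_Collect_le continuous_intros)
  have q2: "sqrt 2 * sqrt 2 = (2::real)" by simp
  have w: "norm (weight (\<sigma>, \<tau>) N (x, y)) = exp (r * a * (e * x))" for x y
    by (simp add: norm_weight r_def e(2) mult_ac)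
  have p1: "(norm (weight (\<sigma>, \<tau>) N z))\<^sup>2 * indicator T z \<le> exp (sqrt 2 * r * (2 * a - sqrt 2) * r) * exp (sqrt 2 * r * e * fst z)" for z
  proof (cases "z \<in> T")
    case True
    have "2 * a * (r * (e * fst z)) = (2 * a - sqrt 2) * r * (e * fst z) + sqrt 2 * r * e * fst z"
      by (simp add: algebra_simps)
    also have "\<dots> \<le> (2 * a - sqrt 2) * r * (sqrt 2 * r) + sqrt 2 * r * e * fst z"
      using True a r0 unfolding T_def by (intro add_right_mono mult_left_mono mult_nonneg_nonneg) auto
    finally have "exp (2 * a * (r * (e * fst z))) \<le> exp (sqrt 2 * r * (2 * a - sqrt 2) * r + sqrt 2 * r * e * fst z)"
      by (simp add: mult_ac)
    then show ?thesis using True w[of "fst z" "snd z"] by (simp add: power2_eq_square mult_ac flip: exp_add)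
  qed simp
  have p2: "norm (weight (\<sigma>, \<tau>) N z) * indicator (- T) z \<le> exp (- (sqrt 2 * r * (sqrt 2 - a) * r)) * exp (sqrt 2 * r * e * fst z)" for z
  proof (cases "z \<in> T")
    case False
    have "a * (r * (e * fst z)) = - (sqrt 2 - a) * r * (e * fst z) + sqrt 2 * r * e * fst z"
      by (simp add: algebra_simps)
    also have "\<dots> \<le> - (sqrt 2 - a) * r * (sqrt 2 * r) + sqrt 2 * r * e * fst z"
      using False a r0 unfolding T_def by (intro add_right_mono mult_left_mono_neg) (auto simp: mult_nonneg_nonneg mult_le_0_iff)
    finally have "exp (a * (r * (e * fst z))) \<le> exp (- (sqrt 2 * r * (sqrt 2 - a) * r) + sqrt 2 * r * e * fst z)"
      by (simp add: algebra_simps)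
    then show ?thesis using False w[of "fst z" "snd z"] by (simp add: mult_ac flip: exp_add)
  qed simp
  have E: "integrable M (\<lambda>\<omega>. exp (sqrt 2 * r * e * X 1 \<omega>))" "expectation (\<lambda>\<omega>. exp (sqrt 2 * r * e * X 1 \<omega>)) = exp (r\<^sup>2)"
    using exp_X[of 1 "sqrt 2 * r * e"] by (auto simp: power_mult_distrib power2_eq_square[of e] e(1))
  note [measurable] = T
  have i1: "integrable M (\<lambda>\<omega>. (norm (weight (\<sigma>, \<tau>) N (X 1 \<omega>, Y 1 \<omega>)))\<^sup>2 * indicator T (X 1 \<omega>, Y 1 \<omega>))"
    by (rule Bochner_Integration.integrable_bound[OF integrable_mult_right[OF E(1), of "exp (sqrt 2 * r * (2 * a - sqrt 2) * r)"]])
       (auto intro!: AE_I2 order_trans[OF p1])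
  have i2: "integrable M (\<lambda>\<omega>. norm (weight (\<sigma>, \<tau>) N (X 1 \<omega>, Y 1 \<omega>)) * indicator (- T) (X 1 \<omega>, Y 1 \<omega>))"
    by (rule Bochner_Integration.integrable_bound[OF integrable_mult_right[OF E(1), of "exp (- (sqrt 2 * r * (sqrt 2 - a) * r))"]])
       (auto intro!: AE_I2 order_trans[OF p2])
  have eN: "real N = exp (r\<^sup>2)" using N by (simp add: r2)
  have "expectation (\<lambda>\<omega>. (norm (weight (\<sigma>, \<tau>) N (X 1 \<omega>, Y 1 \<omega>)))\<^sup>2 * indicator T (X 1 \<omega>, Y 1 \<omega>))
      \<le> expectation (\<lambda>\<omega>. exp (sqrt 2 * r * (2 * a - sqrt 2) * r) * exp (sqrt 2 * r * e * X 1 \<omega>))"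
    by (intro integral_mono i1 integrable_mult_right E(1)) (use p1 in auto)
  also have "\<dots> = exp (sqrt 2 * r * (2 * a - sqrt 2) * r) * exp (r\<^sup>2)" using E by simp
  finally have "real N * expectation (\<lambda>\<omega>. (norm (weight (\<sigma>, \<tau>) N (X 1 \<omega>, Y 1 \<omega>)))\<^sup>2 * indicator T (X 1 \<omega>, Y 1 \<omega>))
      \<le> exp (r\<^sup>2) * (exp (sqrt 2 * r * (2 * a - sqrt 2) * r) * exp (r\<^sup>2))"
    unfolding eN by (rule mult_left_mono) simp
  also have "\<dots> = exp (r\<^sup>2 + (sqrt 2 * r * (2 * a - sqrt 2) * r + r\<^sup>2))" by (simp only: exp_add)
  also have "r\<^sup>2 + (sqrt 2 * r * (2 * a - sqrt 2) * r + r\<^sup>2) = r\<^sup>2 * (sqrt 2 * a) + r\<^sup>2 * (sqrt 2 * a)"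
    using q2 by (simp add: power2_eq_square algebra_simps)
  also have "exp \<dots> = (exp (r\<^sup>2 * (sqrt 2 * a)))\<^sup>2" by (simp only: exp_add power2_eq_square)
  finally have b1: "real N * expectation (\<lambda>\<omega>. (norm (weight (\<sigma>, \<tau>) N (X 1 \<omega>, Y 1 \<omega>)))\<^sup>2 * indicator T (X 1 \<omega>, Y 1 \<omega>)) \<le> (exp (r\<^sup>2 * (sqrt 2 * a)))\<^sup>2" .
  have "expectation (\<lambda>\<omega>. norm (weight (\<sigma>, \<tau>) N (X 1 \<omega>, Y 1 \<omega>)) * indicator (- T) (X 1 \<omega>, Y 1 \<omega>))
      \<le> expectation (\<lambda>\<omega>. exp (- (sqrt 2 * r * (sqrt 2 - a) * r)) * exp (sqrt 2 * r * e * X 1 \<omega>))"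
    by (intro integral_mono i2 integrable_mult_right E(1)) (use p2 in auto)
  also have "\<dots> = exp (- (sqrt 2 * r * (sqrt 2 - a) * r)) * exp (r\<^sup>2)" using E by simp
  finally have "real N * expectation (\<lambda>\<omega>. norm (weight (\<sigma>, \<tau>) N (X 1 \<omega>, Y 1 \<omega>)) * indicator (- T) (X 1 \<omega>, Y 1 \<omega>))
      \<le> exp (r\<^sup>2) * (exp (- (sqrt 2 * r * (sqrt 2 - a) * r)) * exp (r\<^sup>2))"
    unfolding eN by (rule mult_left_mono) simp
  also have "\<dots> = exp (r\<^sup>2 + (- (sqrt 2 * r * (sqrt 2 - a) * r) + r\<^sup>2))" by (simp only: exp_add)
  also have "r\<^sup>2 + (- (sqrt 2 * r * (sqrt 2 - a) * r) + r\<^sup>2) = r\<^sup>2 * (sqrt 2 * a)"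
    using q2 by (simp add: power2_eq_square algebra_simps)
  finally have b2: "real N * expectation (\<lambda>\<omega>. norm (weight (\<sigma>, \<tau>) N (X 1 \<omega>, Y 1 \<omega>)) * indicator (- T) (X 1 \<omega>, Y 1 \<omega>)) \<le> exp (r\<^sup>2 * (sqrt 2 * a))" .
  have "expectation (\<lambda>\<omega>. norm (partition_fn X Y N (\<sigma>, \<tau>) \<omega> - N * mean_weight (\<sigma>, \<tau>) N)) \<le> exp (r\<^sup>2 * (sqrt 2 * a)) + 2 * exp (r\<^sup>2 * (sqrt 2 * a))"
    by (rule partition_fn_L1_deviation(2)[OF T N _ i1 b1 b2]) simp
  then show ?thesis by (simp add: r2 a_def)
qed

end

section \<open>Upper bounds, and the lower bound where the mean dominates\<close>

lemma exp_ln_tendsto_0: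
  assumes "a < 0"
  shows "(\<lambda>N. C * exp (ln (real N) * a)) \<longlonglongrightarrow> 0"
proof -
  have "filterlim (\<lambda>N. - a * ln (real N)) at_top sequentially"
    using assms by (intro filterlim_tendsto_pos_mult_at_top[OF tendsto_const] filterlim_compose[OF ln_at_top] filterlim_real_sequentially) auto
  then have "(\<lambda>N. exp (- (- a * ln (real N)))) \<longlonglongrightarrow> 0"
    by (intro filterlim_compose[OF exp_at_bot] filterlim_compose[OF filterlim_uminus_at_bot_at_top])
  then have "(\<lambda>N. C * exp (- (- a * ln (real N)))) \<longlonglongrightarrow> C * 0"
    by (intro tendsto_intros)
  then show ?thesis by (simp add: mult.commute)
qed

text \<open>With \<open>A\<close> the sum, each ratio \<open>f i / A\<close> lies in \<open>[0, 1]\<close> and hence is at most its \<open>s\<close>-th power.\<close>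

lemma sum_powr_le:
  fixes f :: "'i \<Rightarrow> real"
  assumes "finite I" and f: "\<And>i. i \<in> I \<Longrightarrow> 0 \<le> f i" and s: "0 < s" "s \<le> 1"
  shows "(\<Sum>i\<in>I. f i) powr s \<le> (\<Sum>i\<in>I. f i powr s)"
proof (cases "(\<Sum>i\<in>I. f i) = 0")
  case True
  then show ?thesis by (simp add: sum_nonneg)
next
  case False
  define A where "A = (\<Sum>i\<in>I. f i)"
  have A: "A > 0" using False sum_nonneg[of I f] f unfolding A_def by fastforce
  have le: "f i / A \<le> (f i / A) powr s" if "i \<in> I" for i
  proof (cases "f i = 0")
    case False
    have "f i \<le> A" unfolding A_def using assms(1) f that by (intro member_le_sum) auto
    then have "(f i / A) powr 1 \<le> (f i / A) powr s"
      using False f[OF that] A s by (intro powr_mono') auto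
    then show ?thesis using f[OF that] A by simp
  qed simp
  have "1 = (\<Sum>i\<in>I. f i / A)" using A by (simp add: A_def flip: sum_divide_distrib)
  also have "\<dots> \<le> (\<Sum>i\<in>I. (f i / A) powr s)" by (intro sum_mono le)
  also have "\<dots> = (\<Sum>i\<in>I. f i powr s) / A powr s"
    using f A by (simp add: powr_divide sum_divide_distrib)
  finally show ?thesis using A by (simp add: A_def[symmetric] field_simps)
qed

lemma (in prob_space) Markov_prob:
  assumes "integrable M u" "\<And>\<omega>. 0 \<le> u \<omega>" "0 < (c::real)" "expectation u \<le> B"
  shows "prob {\<omega>\<in>space M. c \<le> u \<omega>} \<le> B / c"
proof -
  have "prob {\<omega>\<in>space M. c \<le> u \<omega>} \<le> expectation u / c"
    by (rule integral_Markov_inequality_measure[where A="{}"]) (use assms in auto)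
  also have "\<dots> \<le> B / c" using assms by (intro divide_right_mono) auto
  finally show ?thesis .
qed

text \<open>The exponent of the standard deviation of the partition function and, beyond \<open>2 \<sigma>\<^sup>2 = 1\<close>, of its
  largest summand.\<close>

definition fluctuation_exponent :: "real \<Rightarrow> real" where
  "fluctuation_exponent \<sigma> = (if 2 * \<sigma>\<^sup>2 \<le> 1 then 1/2 + \<sigma>\<^sup>2 else sqrt 2 * \<bar>\<sigma>\<bar>)"

lemma fluctuation_exponent_large:
  assumes "1 \<le> 2 * \<sigma>\<^sup>2"
  shows "fluctuation_exponent \<sigma> = sqrt 2 * \<bar>\<sigma>\<bar>"
proof (cases "2 * \<sigma>\<^sup>2 \<le> 1")
  case True
  then have "\<sigma>\<^sup>2 = 1 / 2" using assms by simp
  then have "\<bar>\<sigma>\<bar> = sqrt (1 / 2)" by (metis real_sqrt_abs)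
  then have "sqrt 2 * \<bar>\<sigma>\<bar> = sqrt (2 * (1 / 2))" by (simp only: real_sqrt_mult)
  with \<open>\<sigma>\<^sup>2 = 1 / 2\<close> show ?thesis by (simp add: fluctuation_exponent_def)
qed (simp add: fluctuation_exponent_def)

context gaussian_sample
begin

lemma partition_fn_deviation:
  assumes N: "N \<ge> 1" and s: "\<bar>\<sigma>\<bar> \<le> sqrt 2"
  shows "integrable M (\<lambda>\<omega>. norm (partition_fn X Y N (\<sigma>, \<tau>) \<omega> - N * mean_weight (\<sigma>, \<tau>) N))"
    and "expectation (\<lambda>\<omega>. norm (partition_fn X Y N (\<sigma>, \<tau>) \<omega> - N * mean_weight (\<sigma>, \<tau>) N)) \<le> 3 * exp (ln N * fluctuation_exponent \<sigma>)"
proof -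
  show "integrable M (\<lambda>\<omega>. norm (partition_fn X Y N (\<sigma>, \<tau>) \<omega> - N * mean_weight (\<sigma>, \<tau>) N))"
    by (rule partition_fn_L1_deviation_small[OF N])
  show "expectation (\<lambda>\<omega>. norm (partition_fn X Y N (\<sigma>, \<tau>) \<omega> - N * mean_weight (\<sigma>, \<tau>) N)) \<le> 3 * exp (ln N * fluctuation_exponent \<sigma>)"
  proof (cases "2 * \<sigma>\<^sup>2 \<le> 1")
    case True
    have "expectation (\<lambda>\<omega>. norm (partition_fn X Y N (\<sigma>, \<tau>) \<omega> - N * mean_weight (\<sigma>, \<tau>) N)) \<le> 1 * exp (ln N * (1/2 + \<sigma>\<^sup>2))"
      using partition_fn_L1_deviation_small(2)[OF N] by simp
    also have "\<dots> \<le> 3 * exp (ln N * (1/2 + \<sigma>\<^sup>2))" by (intro mult_right_mono) auto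
    finally show ?thesis using True by (simp add: fluctuation_exponent_def)
  next
    case False
    then show ?thesis using partition_fn_L1_deviation_large[OF N, of \<sigma> \<tau>] s by (simp add: fluctuation_exponent_def)
  qed
qed

lemma norm_mean:
  assumes N: "N \<ge> 1"
  shows "norm (N * mean_weight (\<sigma>, \<tau>) N) = exp (ln N * (1 + (\<sigma>\<^sup>2 - \<tau>\<^sup>2) / 2))"
proof -
  have "norm (N * mean_weight (\<sigma>, \<tau>) N) = exp (ln N) * exp (ln N * (\<sigma>\<^sup>2 - \<tau>\<^sup>2) / 2)"
    using weight_mean(2)[OF order_refl N] N by (simp add: norm_mult mean_weight_def)
  then show ?thesis by (simp add: algebra_simps flip: exp_add)
qed

lemma partition_fn_upper_small:
  assumes s: "\<bar>\<sigma>\<bar> \<le> sqrt 2" and l: "fluctuation_exponent \<sigma> < l" "1 + (\<sigma>\<^sup>2 - \<tau>\<^sup>2) / 2 < l"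
  shows "(\<lambda>N. prob {\<omega>\<in>space M. exp (ln N * l) \<le> norm (partition_fn X Y N (\<sigma>, \<tau>) \<omega>)}) \<longlonglongrightarrow> 0"
proof (rule tendsto_sandwich[OF _ _ tendsto_const])
  let ?\<kappa> = "fluctuation_exponent \<sigma>" and ?\<mu> = "1 + (\<sigma>\<^sup>2 - \<tau>\<^sup>2) / 2"
  let ?u = "\<lambda>N. 3 * exp (ln (real N) * (?\<kappa> - l)) + 1 * exp (ln (real N) * (?\<mu> - l))"
  have "?u \<longlonglongrightarrow> 0 + 0" by (intro tendsto_add exp_ln_tendsto_0) (use l in auto)
  then show "?u \<longlonglongrightarrow> 0" by simp
  show "\<forall>\<^sub>F N in sequentially. prob {\<omega>\<in>space M. exp (ln N * l) \<le> norm (partition_fn X Y N (\<sigma>, \<tau>) \<omega>)} \<le> ?u N"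
    using eventually_ge_at_top[of 1]
  proof eventually_elim
    case (elim N)
    let ?Z = "partition_fn X Y N (\<sigma>, \<tau>)"
    let ?D = "\<lambda>\<omega>. norm (?Z \<omega> - N * mean_weight (\<sigma>, \<tau>) N) + exp (ln N * ?\<mu>)"
    have iD: "integrable M ?D" using partition_fn_deviation(1)[OF elim s] by simp
    have "{\<omega>\<in>space M. exp (ln N * l) \<le> norm (?Z \<omega>)} \<subseteq> {\<omega>\<in>space M. exp (ln N * l) \<le> ?D \<omega>}"
    proof safe
      fix \<omega> assume "exp (ln N * l) \<le> norm (?Z \<omega>)"
      also have "norm (?Z \<omega>) \<le> norm (?Z \<omega> - N * mean_weight (\<sigma>, \<tau>) N) + norm (N * mean_weight (\<sigma>, \<tau>) N)"
        by (metis diff_add_cancel norm_triangle_ineq)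
      finally show "exp (ln N * l) \<le> ?D \<omega>" unfolding norm_mean[OF elim] .
    qed
    moreover have "{\<omega>\<in>space M. exp (ln N * l) \<le> ?D \<omega>} \<in> events" using iD by measurable
    ultimately have "prob {\<omega>\<in>space M. exp (ln N * l) \<le> norm (?Z \<omega>)} \<le> prob {\<omega>\<in>space M. exp (ln N * l) \<le> ?D \<omega>}"
      by (rule finite_measure_mono)
    also have "\<dots> \<le> (3 * exp (ln N * ?\<kappa>) + exp (ln N * ?\<mu>)) / exp (ln N * l)"
      by (rule Markov_prob[OF iD]) (use partition_fn_deviation[OF elim s, of \<tau>] in \<open>auto simp: prob_space\<close>)
    also have "\<dots> = ?u N" by (simp add: exp_diff right_diff_distrib add_divide_distrib)
    finally show ?case .
  qed
qed (auto intro!: always_eventually)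

text \<open>The order \<open>s = sqrt 2 / \<bar>\<sigma>\<bar>\<close> turns each summand into \<open>exp (\<plusminus> sqrt 2 * sqrt n * X\<^sub>k)\<close> with expectation
  \<open>N\<close>, so the moment of order \<open>s\<close> is at most \<open>N\<^sup>2 = exp (s * n * sqrt 2 * \<bar>\<sigma>\<bar>)\<close>.\<close>

lemma partition_fn_upper_large:
  assumes s: "sqrt 2 \<le> \<bar>\<sigma>\<bar>" and l: "sqrt 2 * \<bar>\<sigma>\<bar> < l"
  shows "(\<lambda>N. prob {\<omega>\<in>space M. exp (ln N * l) \<le> norm (partition_fn X Y N (\<sigma>, \<tau>) \<omega>)}) \<longlonglongrightarrow> 0"
proof (rule tendsto_sandwich[OF _ _ tendsto_const])
  define s where "s = sqrt 2 / \<bar>\<sigma>\<bar>"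
  have "0 < \<bar>\<sigma>\<bar>" by (rule less_le_trans[OF _ assms(1)]) simp
  then have s0: "0 < s" "s \<le> 1" using assms by (simp_all add: s_def)
  have ss: "(s * \<sigma>)\<^sup>2 = 2" using assms(1) by (auto simp: s_def power_mult_distrib power_divide)
  have "s * (sqrt 2 * \<bar>\<sigma>\<bar>) < s * l" using l s0 by simp
  moreover have "s * (sqrt 2 * \<bar>\<sigma>\<bar>) = 2" using assms(1) by (auto simp: s_def)
  ultimately have sl: "2 - s * l < 0" by simp
  show "(\<lambda>N. 1 * exp (ln (real N) * (2 - s * l))) \<longlonglongrightarrow> 0" by (intro exp_ln_tendsto_0 sl)
  show "\<forall>\<^sub>F N in sequentially. prob {\<omega>\<in>space M. exp (ln N * l) \<le> norm (partition_fn X Y N (\<sigma>, \<tau>) \<omega>)} \<le> 1 * exp (ln (real N) * (2 - s * l))"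
    using eventually_ge_at_top[of 1]
  proof eventually_elim
    case (elim N)
    define r where "r = sqrt (ln (real N))"
    have r2: "r\<^sup>2 = ln N" using elim by (simp add: r_def)
    let ?Z = "partition_fn X Y N (\<sigma>, \<tau>)"
    let ?D = "\<lambda>\<omega>. (\<Sum>k=1..N. exp (r * (s * \<sigma>) * X k \<omega>))"
    have iD: "integrable M ?D" by (intro Bochner_Integration.integrable_sum exp_X) auto
    have "expectation ?D = (\<Sum>k=1..N. expectation (\<lambda>\<omega>. exp (r * (s * \<sigma>) * X k \<omega>)))"
      by (intro Bochner_Integration.integral_sum exp_X) auto
    also have "\<dots> = (\<Sum>k=1..N. exp ((r * (s * \<sigma>))\<^sup>2 / 2))"
      by (intro sum.cong refl exp_X) auto
    also have "(r * (s * \<sigma>))\<^sup>2 / 2 = ln N" unfolding power_mult_distrib[of r] ss r2 by simp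
    also have "(\<Sum>k=1..N. exp (ln (real N))) = exp (ln N) * exp (ln N)" using elim by simp
    finally have eD: "expectation ?D = exp (ln N) * exp (ln N)" .
    have "{\<omega>\<in>space M. exp (ln N * l) \<le> norm (?Z \<omega>)} \<subseteq> {\<omega>\<in>space M. exp (s * (ln N * l)) \<le> ?D \<omega>}"
    proof safe
      fix \<omega> assume a: "exp (ln N * l) \<le> norm (?Z \<omega>)"
      have "exp (s * (ln N * l)) = exp (ln N * l) powr s" by (simp add: powr_def)
      also have "\<dots> \<le> norm (?Z \<omega>) powr s" using a s0 by (intro powr_mono2) auto
      also have "\<dots> \<le> (\<Sum>k=1..N. norm (weight (\<sigma>, \<tau>) N (X k \<omega>, Y k \<omega>))) powr s"
        unfolding partition_fn_eq using s0 by (intro powr_mono2 norm_sum) auto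
      also have "\<dots> \<le> (\<Sum>k=1..N. norm (weight (\<sigma>, \<tau>) N (X k \<omega>, Y k \<omega>)) powr s)"
        using s0 by (intro sum_powr_le) auto
      also have "\<dots> = ?D \<omega>"
        by (intro sum.cong refl) (simp add: norm_weight powr_def r_def mult_ac)
      finally show "exp (s * (ln N * l)) \<le> ?D \<omega>" .
    qed
    moreover have "{\<omega>\<in>space M. exp (s * (ln N * l)) \<le> ?D \<omega>} \<in> events" using iD by measurable
    ultimately have "prob {\<omega>\<in>space M. exp (ln N * l) \<le> norm (?Z \<omega>)} \<le> prob {\<omega>\<in>space M. exp (s * (ln N * l)) \<le> ?D \<omega>}"
      by (rule finite_measure_mono)
    also have "\<dots> \<le> (exp (ln N) * exp (ln N)) / exp (s * (ln N * l))"
      by (rule Markov_prob[OF iD _ _ eq_refl[OF eD]]) (auto intro!: sum_nonneg)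
    also have "\<dots> = exp (ln N + ln N - s * (ln N * l))" by (simp only: exp_add exp_diff)
    also have "\<dots> = 1 * exp (ln N * (2 - s * l))" by (simp add: algebra_simps)
    finally show ?case .
  qed
qed (auto intro!: always_eventually)

text \<open>If the mean dominates the fluctuations, \<open>Z\<close> can only be small by deviating from its mean by at
  least half of it.\<close>

lemma partition_fn_lower_mean:
  assumes s: "\<bar>\<sigma>\<bar> \<le> sqrt 2" and l: "l < 1 + (\<sigma>\<^sup>2 - \<tau>\<^sup>2) / 2"
    and d: "fluctuation_exponent \<sigma> < 1 + (\<sigma>\<^sup>2 - \<tau>\<^sup>2) / 2"
  shows "(\<lambda>N. prob {\<omega>\<in>space M. norm (partition_fn X Y N (\<sigma>, \<tau>) \<omega>) \<le> exp (ln N * l)}) \<longlonglongrightarrow> 0"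
proof (rule tendsto_sandwich[OF _ _ tendsto_const])
  let ?\<kappa> = "fluctuation_exponent \<sigma>" and ?\<mu> = "1 + (\<sigma>\<^sup>2 - \<tau>\<^sup>2) / 2"
  show "(\<lambda>N. 6 * exp (ln (real N) * (?\<kappa> - ?\<mu>))) \<longlonglongrightarrow> 0"
    by (intro exp_ln_tendsto_0) (use d in auto)
  have "(\<lambda>N. 1 * exp (ln (real N) * (l - ?\<mu>))) \<longlonglongrightarrow> 0"
    by (intro exp_ln_tendsto_0) (use l in auto)
  then have "\<forall>\<^sub>F N in sequentially. 1 * exp (ln (real N) * (l - ?\<mu>)) < 1 / 2"
    by (rule order_tendstoD) simp
  then show "\<forall>\<^sub>F N in sequentially. prob {\<omega>\<in>space M. norm (partition_fn X Y N (\<sigma>, \<tau>) \<omega>) \<le> exp (ln N * l)} \<le> 6 * exp (ln (real N) * (?\<kappa> - ?\<mu>))"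
    using eventually_ge_at_top[of 1]
  proof eventually_elim
    case (elim N)
    let ?Z = "partition_fn X Y N (\<sigma>, \<tau>)"
    let ?D = "\<lambda>\<omega>. norm (?Z \<omega> - N * mean_weight (\<sigma>, \<tau>) N)"
    have iD: "integrable M ?D" using partition_fn_deviation(1)[OF elim(2) s] by simp
    have h: "exp (ln N * l) \<le> exp (ln N * ?\<mu>) / 2"
    proof -
      have "exp (ln N * l) = exp (ln N * ?\<mu>) * exp (ln N * (l - ?\<mu>))"
        by (simp only: exp_add[symmetric] distrib_left[symmetric]) simp
      also have "\<dots> \<le> exp (ln N * ?\<mu>) * (1 / 2)" using elim(1) by (intro mult_left_mono) auto
      finally show ?thesis by simp
    qed
    have "{\<omega>\<in>space M. norm (?Z \<omega>) \<le> exp (ln N * l)} \<subseteq> {\<omega>\<in>space M. exp (ln N * ?\<mu>) / 2 \<le> ?D \<omega>}"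
    proof safe
      fix \<omega> assume a: "norm (?Z \<omega>) \<le> exp (ln N * l)"
      have "exp (ln N * ?\<mu>) = norm (N * mean_weight (\<sigma>, \<tau>) N)" by (simp only: norm_mean[OF elim(2)])
      also have "\<dots> \<le> norm (?Z \<omega>) + ?D \<omega>"
        by (metis norm_minus_commute diff_add_cancel norm_triangle_ineq add.commute)
      finally show "exp (ln N * ?\<mu>) / 2 \<le> ?D \<omega>" using a h by linarith
    qed
    moreover have "{\<omega>\<in>space M. exp (ln N * ?\<mu>) / 2 \<le> ?D \<omega>} \<in> events" using iD by measurable
    ultimately have "prob {\<omega>\<in>space M. norm (?Z \<omega>) \<le> exp (ln N * l)} \<le> prob {\<omega>\<in>space M. exp (ln N * ?\<mu>) / 2 \<le> ?D \<omega>}"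
      by (rule finite_measure_mono)
    also have "\<dots> \<le> (3 * exp (ln N * ?\<kappa>)) / (exp (ln N * ?\<mu>) / 2)"
      by (rule Markov_prob[OF iD]) (use partition_fn_deviation[OF elim(2) s, of \<tau>] in auto)
    also have "\<dots> = 6 * exp (ln (real N) * (?\<kappa> - ?\<mu>))" by (simp add: exp_diff right_diff_distrib)
    finally show ?case .
  qed
qed (auto intro!: always_eventually)

end

section \<open>Concentration and characteristic functions\<close>

lemma half_le_sin:
  assumes "0 \<le> x" "x \<le> pi / 2"
  shows "x / 2 \<le> sin x"
proof -
  have "\<bar>sin x - (\<Sum>m<3. sin_coeff m * x ^ m)\<bar> \<le> inverse (fact 3) * \<bar>x\<bar> ^ 3"
    by (rule Maclaurin_sin_bound)
  then have "\<bar>sin x - x\<bar> \<le> x ^ 3 / 6"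
    using assms(1) by (simp add: sin_coeff_def numeral_3_eq_3)
  then have "x - sin x \<le> x ^ 3 / 6" by linarith
  also have "x ^ 3 / 6 \<le> x / 2"
  proof -
    have "x \<le> 1.6" using assms(2) pi_approx by simp
    then have "x * x \<le> 1.6 * 1.6" using assms(1) by (intro mult_mono) auto
    then have "x * (x * x) \<le> x * 3" using assms(1) by (intro mult_left_mono) auto
    then show ?thesis by (simp add: power3_eq_cube)
  qed
  finally show ?thesis by simp
qed

lemma one_minus_cos_ge:
  assumes "0 \<le> x" "x \<le> pi / 2"
  shows "x\<^sup>2 / 8 \<le> 1 - cos x"
proof -
  have "x / 4 \<le> sin (x / 2)" using half_le_sin[of "x / 2"] assms by simp
  then have "(x / 4)\<^sup>2 \<le> (sin (x / 2))\<^sup>2" using assms by (intro power_mono) auto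
  moreover have "cos x = 1 - 2 * (sin (x / 2))\<^sup>2" using cos_double_sin[of "x / 2"] by simp
  ultimately show ?thesis by (simp add: power_divide)
qed

lemma cos_le_cos_beyond:
  assumes "0 \<le> d" "d \<le> pi / 2" "d \<le> x" "x \<le> 3 * pi / 2"
  shows "cos x \<le> cos d"
proof (cases "x \<le> pi")
  case True
  then show ?thesis using assms by (intro cos_monotone_0_pi_le) auto
next
  case False
  have "0 \<le> cos (x - pi)" using False assms by (intro cos_ge_zero) auto
  then have "cos x \<le> 0" by simp
  moreover have "0 \<le> cos d" using assms by (intro cos_ge_zero) auto
  ultimately show ?thesis by simp
qed

text \<open>Rotate so that the expectation of \<open>cis u\<close> becomes real, by an angle \<open>\<alpha>\<close> in \<open>(-\<pi>, \<pi>]\<close>. If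
  \<open>\<alpha> \<le> 0\<close> then \<open>u - \<alpha>\<close> lies in \<open>[d, 3\<pi>/2]\<close> on \<open>A\<close>, where the cosine is at most \<open>cos d\<close>; otherwise the
  same holds for \<open>\<alpha> - u\<close> on \<open>B\<close>. One of the two sets is always useful, whatever \<open>\<alpha>\<close> is.\<close>

lemma (in prob_space) norm_char_le_two_sets:
  fixes u :: "'a \<Rightarrow> real"
  assumes [measurable]: "u \<in> borel_measurable M" and A: "A \<in> events" "B \<in> events" "p \<le> prob A" "p \<le> prob B"
    and d: "0 \<le> d" "d \<le> pi / 2"
    and uA: "\<And>\<omega>. \<omega> \<in> A \<Longrightarrow> d \<le> u \<omega> \<and> u \<omega> \<le> pi / 2"
    and uB: "\<And>\<omega>. \<omega> \<in> B \<Longrightarrow> - (pi / 2) \<le> u \<omega> \<and> u \<omega> \<le> - d"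
  shows "norm (expectation (\<lambda>\<omega>. cis (u \<omega>))) \<le> 1 - p * (1 - cos d)"
proof -
  define z where "z = expectation (\<lambda>\<omega>. cis (u \<omega>))"
  define \<alpha> where "\<alpha> = Arg z"
  have \<alpha>: "-pi < \<alpha>" "\<alpha> \<le> pi" using Arg_bounded[of z] by (auto simp: \<alpha>_def)
  have icos: "integrable M (\<lambda>\<omega>. cos (u \<omega> - \<alpha>))" by (rule integrable_const_bound[where B=1]) auto
  have "z = of_real (norm z) * cis \<alpha>"
    using rcis_cmod_Arg[of z] by (simp add: \<alpha>_def rcis_def)
  then have "z * cis (- \<alpha>) = of_real (norm z) * (cis \<alpha> * cis (- \<alpha>))" by (simp add: mult.assoc)
  also have "\<dots> = of_real (norm z)" by (simp add: cis_mult)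
  finally have "norm z = Re (z * cis (- \<alpha>))" by simp
  also have "z * cis (- \<alpha>) = expectation (\<lambda>\<omega>. cis (u \<omega> - \<alpha>))"
    unfolding z_def by (subst integral_mult_left_zero[symmetric]) (simp add: cis_mult)
  also have "Re \<dots> = expectation (\<lambda>\<omega>. cos (u \<omega> - \<alpha>))"
    by (subst integral_Re[symmetric]) (auto intro!: integrable_const_bound[where B=1])
  finally have z: "norm z = expectation (\<lambda>\<omega>. cos (u \<omega> - \<alpha>))" .
  have cd: "0 \<le> 1 - cos d" by simp
  have main: "norm z \<le> 1 - p * (1 - cos d)"
    if C: "C \<in> events" "p \<le> prob C" "\<And>\<omega>. \<omega> \<in> C \<Longrightarrow> cos (u \<omega> - \<alpha>) \<le> cos d" for C
  proof -
    have "expectation (\<lambda>\<omega>. cos (u \<omega> - \<alpha>)) \<le> expectation (\<lambda>\<omega>. 1 - (1 - cos d) * indicator C \<omega>)"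
      using C by (intro integral_mono icos Bochner_Integration.integrable_diff integrable_mult_right integrable_real_indicator)
        (auto split: split_indicator simp: emeasure_eq_measure)
    also have "\<dots> = 1 - (1 - cos d) * prob C" using C(1)
      by (subst Bochner_Integration.integral_diff) (auto simp: prob_space emeasure_eq_measure intro!: integrable_mult_right integrable_real_indicator)
    also have "\<dots> \<le> 1 - p * (1 - cos d)" using mult_right_mono[OF C(2) cd] by (simp add: mult.commute)
    finally show ?thesis unfolding z .
  qed
  have "norm z \<le> 1 - p * (1 - cos d)"
  proof (cases "\<alpha> \<le> 0")
    case True
    show ?thesis
    proof (rule main[OF A(1,3)])
      fix \<omega> assume "\<omega> \<in> A"
      then show "cos (u \<omega> - \<alpha>) \<le> cos d" using uA[of \<omega>] \<alpha> d True by (intro cos_le_cos_beyond) auto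
    qed
  next
    case False
    show ?thesis
    proof (rule main[OF A(2,4)])
      fix \<omega> assume "\<omega> \<in> B"
      then have "cos (- (u \<omega> - \<alpha>)) \<le> cos d" using uB[of \<omega>] \<alpha> d False by (intro cos_le_cos_beyond) auto
      then show "cos (u \<omega> - \<alpha>) \<le> cos d" by (simp only: cos_minus)
    qed
  qed
  then show ?thesis by (simp add: z_def)
qed

text \<open>The indicator of \<open>[-L, L]\<close> is at most \<open>exp (1/2)\<close> times the Gaussian kernel \<open>exp (- S\<^sup>2 / (2 L\<^sup>2))\<close>, and
  this kernel is the characteristic function of a standard normal variable at \<open>S / L\<close>.\<close>

lemma (in prob_space) concentration_le_char:
  fixes S :: "'a \<Rightarrow> real"
  assumes S[measurable]: "S \<in> borel_measurable M" and L: "L > 0"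
  shows "prob {\<omega>\<in>space M. \<bar>S \<omega>\<bar> \<le> L} \<le> 2 * (LINT g|std_normal_distribution. norm (expectation (\<lambda>\<omega>. cis (g / L * S \<omega>))))"
proof -
  let ?N = "std_normal_distribution"
  interpret N: real_distribution ?N by (rule real_dist_normal_dist)
  interpret P: pair_prob_space M ?N ..
  have [measurable]: "(\<lambda>(\<omega>, g). cis (g / L * S \<omega>)) \<in> borel_measurable (M \<Otimes>\<^sub>M ?N)" by measurable
  have ip: "integrable (M \<Otimes>\<^sub>M ?N) (\<lambda>(\<omega>, g). cis (g / L * S \<omega>))"
    by (rule P.integrable_const_bound[where B=1]) auto
  have inner: "(LINT g|?N. cis (g / L * S \<omega>)) = complex_of_real (exp (- ((S \<omega> / L)\<^sup>2) / 2))" for \<omega>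
  proof -
    have "(LINT g|?N. cis (g / L * S \<omega>)) = char ?N (S \<omega> / L)"
      unfolding char_def cis_conv_exp by (simp add: field_simps)
    then show ?thesis by (simp add: char_std_normal_distribution)
  qed
  have ie: "integrable M (\<lambda>\<omega>. exp (- ((S \<omega> / L)\<^sup>2) / 2))"
    by (rule integrable_const_bound[where B=1]) auto
  have "complex_of_real (expectation (\<lambda>\<omega>. exp (- ((S \<omega> / L)\<^sup>2) / 2))) = (LINT \<omega>|M. LINT g|?N. cis (g / L * S \<omega>))"
    unfolding inner by (rule integral_complex_of_real[symmetric])
  also have "\<dots> = (LINT g|?N. LINT \<omega>|M. cis (g / L * S \<omega>))"
    using P.Fubini_integral[OF ip] by simp
  finally have eq: "complex_of_real (expectation (\<lambda>\<omega>. exp (- ((S \<omega> / L)\<^sup>2) / 2))) = (LINT g|?N. LINT \<omega>|M. cis (g / L * S \<omega>))" .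
  have e2: "exp (1 / 2) \<le> (2::real)"
  proof -
    have "exp (1/2 :: real) \<le> 1 + 1/2 + (1/2)\<^sup>2" by (rule exp_bound) auto
    also have "\<dots> \<le> 2" by (simp add: power2_eq_square)
    finally show ?thesis .
  qed
  have "prob {\<omega>\<in>space M. \<bar>S \<omega>\<bar> \<le> L} = expectation (indicator {\<omega>\<in>space M. \<bar>S \<omega>\<bar> \<le> L})" by simp
  also have "\<dots> \<le> expectation (\<lambda>\<omega>. 2 * exp (- ((S \<omega> / L)\<^sup>2) / 2))"
  proof (rule integral_mono)
    fix \<omega> assume "\<omega> \<in> space M"
    show "indicator {\<omega> \<in> space M. \<bar>S \<omega>\<bar> \<le> L} \<omega> \<le> 2 * exp (- ((S \<omega> / L)\<^sup>2) / 2)"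
    proof (cases "\<bar>S \<omega>\<bar> \<le> L")
      case True
      then have "\<bar>S \<omega> / L\<bar> \<le> 1" using L by simp
      then have "(S \<omega> / L)\<^sup>2 \<le> 1" by (simp only: abs_square_le_1)
      then have "1 \<le> exp (1/2) * exp (- ((S \<omega> / L)\<^sup>2) / 2)" by (simp flip: exp_add)
      also have "\<dots> \<le> 2 * exp (- ((S \<omega> / L)\<^sup>2) / 2)" using e2 by (intro mult_right_mono) auto
      finally show ?thesis by (auto simp: indicator_def)
    qed (auto simp: indicator_def)
  qed (use ie in \<open>auto intro!: integrable_real_indicator simp: emeasure_eq_measure\<close>)
  also have "\<dots> = 2 * expectation (\<lambda>\<omega>. exp (- ((S \<omega> / L)\<^sup>2) / 2))" by simp
  also have "expectation (\<lambda>\<omega>. exp (- ((S \<omega> / L)\<^sup>2) / 2)) \<le> norm (complex_of_real (expectation (\<lambda>\<omega>. exp (- ((S \<omega> / L)\<^sup>2) / 2))))"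
    by simp
  also have "\<dots> \<le> (LINT g|?N. norm (expectation (\<lambda>\<omega>. cis (g / L * S \<omega>))))"
    unfolding eq by (rule integral_norm_bound)
  finally show ?thesis by simp
qed

lemma measure_std_normal_Icc_ge:
  assumes "d \<ge> 0" "\<bar>a\<bar> \<le> K" "\<bar>a + d\<bar> \<le> K"
  shows "d * exp (- K\<^sup>2 / 2) / 3 \<le> measure std_normal_distribution {a..a+d}"
proof -
  interpret N: real_distribution std_normal_distribution by (rule real_dist_normal_dist)
  have "sqrt (2 * pi) \<le> 3"
    using pi_approx by (intro real_le_lsqrt) (auto simp: power2_eq_square)
  then have c: "exp (- K\<^sup>2 / 2) / 3 \<le> std_normal_density x" if "x \<in> {a..a+d}" for x
  proof -
    have "\<bar>x\<bar> \<le> K" using that assms by auto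
    then have "x\<^sup>2 \<le> K\<^sup>2" by (metis abs_ge_zero power2_abs power_mono)
    then have "exp (- K\<^sup>2 / 2) \<le> exp (- x\<^sup>2 / 2)" by simp
    moreover have "1 / 3 \<le> 1 / sqrt (2 * pi)" using \<open>sqrt (2 * pi) \<le> 3\<close> by (intro divide_left_mono) auto
    ultimately have "1 / 3 * exp (- K\<^sup>2 / 2) \<le> 1 / sqrt (2 * pi) * exp (- x\<^sup>2 / 2)" by (intro mult_mono) auto
    then show ?thesis by (simp add: std_normal_density_def)
  qed
  have "ennreal (d * exp (- K\<^sup>2 / 2) / 3) = ennreal (exp (- K\<^sup>2 / 2) / 3) * emeasure lborel {a..a+d}"
    using assms(1) by (simp add: ennreal_mult'[symmetric] mult_ac)
  also have "\<dots> = (\<integral>\<^sup>+x. ennreal (exp (- K\<^sup>2 / 2) / 3) * indicator {a..a+d} x \<partial>lborel)"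
    by (subst nn_integral_cmult_indicator) auto
  also have "\<dots> \<le> (\<integral>\<^sup>+x. ennreal (std_normal_density x) * indicator {a..a+d} x \<partial>lborel)"
    by (intro nn_integral_mono) (use c in \<open>auto simp: indicator_def intro: ennreal_leI\<close>)
  also have "\<dots> = emeasure std_normal_distribution {a..a+d}"
    by (subst emeasure_density) auto
  finally show ?thesis
    by (simp add: N.emeasure_eq_measure)
qed

text \<open>Windows of width of order \<open>1 / sqrt n\<close> at \<open>y * sqrt n\<close> have probability \<open>exp (- n y\<^sup>2 / 2)\<close> up to
  polynomial factors, which \<open>exp (- n \<epsilon>)\<close> absorbs. The bound is uniform in the position of the window
  because the windows used below are placed by rounding a phase.\<close>

lemma std_normal_window:
  fixes y c d \<epsilon> :: real
  assumes "c \<ge> 0" "d > 0" "\<epsilon> > 0"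
  shows "\<exists>n0. \<forall>n\<ge>n0. n \<ge> 1 \<and> (\<forall>a. \<bar>a - y * sqrt n\<bar> \<le> c / sqrt n \<and> \<bar>a + d / sqrt n - y * sqrt n\<bar> \<le> c / sqrt n
      \<longrightarrow> exp (- n * (y\<^sup>2 / 2 + \<epsilon>)) \<le> measure std_normal_distribution {a..a + d / sqrt n})"
proof -
  define C where "C = d / 3 * exp (- \<bar>y\<bar> * c - c\<^sup>2 / 2)"
  have C: "C > 0" using assms by (simp add: C_def)
  show ?thesis
  proof (intro exI[of _ "max 1 (2 / (C * \<epsilon>\<^sup>2))"] allI impI conjI)
    fix n assume n: "n \<ge> max 1 (2 / (C * \<epsilon>\<^sup>2))"
    then show n1: "n \<ge> 1" by simp
    have s1: "sqrt n \<ge> 1" "sqrt n * sqrt n = n" using n1 by auto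
    have sn: "sqrt n \<le> n" using mult_left_mono[of 1 "sqrt n" "sqrt n"] s1 by simp
    fix a assume a: "\<bar>a - y * sqrt n\<bar> \<le> c / sqrt n \<and> \<bar>a + d / sqrt n - y * sqrt n\<bar> \<le> c / sqrt n"
    define K where "K = \<bar>y\<bar> * sqrt n + c / sqrt n"
    have yy: "\<bar>y * sqrt n\<bar> = \<bar>y\<bar> * sqrt n" using n1 by (simp add: abs_mult)
    have K: "\<bar>a\<bar> \<le> K" "\<bar>a + d / sqrt n\<bar> \<le> K" using a yy unfolding K_def by linarith+
    have "K\<^sup>2 / 2 = n * (y\<^sup>2 / 2) + \<bar>y\<bar> * c + c\<^sup>2 / (2 * n)"
      unfolding K_def using s1 n1 by (simp add: power2_eq_square field_simps)
    also have "c\<^sup>2 / (2 * n) \<le> c\<^sup>2 / 2" using n1 by (intro divide_left_mono) auto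
    finally have K2: "K\<^sup>2 / 2 \<le> n * (y\<^sup>2 / 2) + \<bar>y\<bar> * c + c\<^sup>2 / 2" by simp
    have "2 \<le> n * (C * \<epsilon>\<^sup>2)" using n C assms(3) by (simp add: pos_divide_le_eq)
    then have "n \<le> C * ((n * \<epsilon>)\<^sup>2 / 2)" using n1 mult_left_mono[of 2 "n * (C * \<epsilon>\<^sup>2)" n]
      by (simp add: power2_eq_square mult_ac)
    also have "(n * \<epsilon>)\<^sup>2 / 2 \<le> exp (n * \<epsilon>)"
      using exp_lower_Taylor_quadratic[of "n * \<epsilon>"] n1 assms(3) by (smt (verit) mult_nonneg_nonneg)
    finally have "n \<le> C * exp (n * \<epsilon>)" using C by simp
    then have "1 * exp (- (n * \<epsilon>)) \<le> C / n" using n1 by (simp add: field_simps exp_minus)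
    also have "C / n \<le> C / sqrt n" using C sn s1 n1 by (intro divide_left_mono mult_pos_pos) auto
    finally have e: "exp (- (n * \<epsilon>)) \<le> C / sqrt n" by simp
    have "exp (- n * (y\<^sup>2 / 2 + \<epsilon>)) = exp (- (n * \<epsilon>)) * exp (- (n * (y\<^sup>2 / 2)))"
      by (simp add: algebra_simps flip: exp_add)
    also have "\<dots> \<le> C / sqrt n * exp (- (n * (y\<^sup>2 / 2)))" using e by (intro mult_right_mono) auto
    also have "\<dots> = d / sqrt n / 3 * exp (- (n * (y\<^sup>2 / 2) + \<bar>y\<bar> * c + c\<^sup>2 / 2))"
    proof -
      have "- (n * (y\<^sup>2 / 2) + \<bar>y\<bar> * c + c\<^sup>2 / 2) = (- \<bar>y\<bar> * c - c\<^sup>2 / 2) + - (n * (y\<^sup>2 / 2))" by simp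
      then show ?thesis by (simp only: exp_add C_def) simp
    qed
    also have "\<dots> \<le> d / sqrt n / 3 * exp (- K\<^sup>2 / 2)"
      using K2 assms n1 by (intro mult_left_mono) auto
    also have "\<dots> \<le> measure std_normal_distribution {a..a + d / sqrt n}"
      using measure_std_normal_Icc_ge[OF _ K] assms n1 by simp
    finally show "exp (- n * (y\<^sup>2 / 2 + \<epsilon>)) \<le> measure std_normal_distribution {a..a + d / sqrt n}" .
  qed
qed

section \<open>Two phase windows\<close>

lemma filterlim_ln_real: "filterlim (\<lambda>N. ln (real N)) at_top sequentially"
  by (intro filterlim_compose[OF ln_at_top] filterlim_real_sequentially)

lemma (in prob_space) prob_normal_law:
  assumes [measurable]: "U \<in> borel_measurable M" "B \<in> sets borel" and U: "distr M borel U = normal_law 0 s" and s: "s \<ge> 0"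
  shows "prob {\<omega>\<in>space M. U \<omega> \<in> B} = measure std_normal_distribution {u. s * u \<in> B}"
proof -
  have "prob {\<omega>\<in>space M. U \<omega> \<in> B} = measure (distr M borel U) B"
    by (subst measure_distr) (auto simp: vimage_def Int_def conj_commute)
  also have "\<dots> = measure std_normal_distribution {u. s * u \<in> B}"
    unfolding U normal_law_eq_distr[OF s] by (subst measure_distr) (auto simp: vimage_def)
  finally show ?thesis .
qed

context gaussian_sample
begin

definition opposite_windows :: "real \<Rightarrow> real \<Rightarrow> nat \<Rightarrow> real \<Rightarrow> real \<Rightarrow> real \<Rightarrow> bool" where
  "opposite_windows \<sigma> \<tau> N p lo hi \<longleftrightarrow>
     (\<exists>A B. A \<in> events \<and> B \<in> events \<and> p \<le> prob A \<and> p \<le> prob B \<and>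
        (\<forall>\<omega>\<in>A. lo \<le> Re (weight (\<sigma>, \<tau>) N (X 1 \<omega>, Y 1 \<omega>)) \<and> Re (weight (\<sigma>, \<tau>) N (X 1 \<omega>, Y 1 \<omega>)) \<le> hi) \<and>
        (\<forall>\<omega>\<in>B. - hi \<le> Re (weight (\<sigma>, \<tau>) N (X 1 \<omega>, Y 1 \<omega>)) \<and> Re (weight (\<sigma>, \<tau>) N (X 1 \<omega>, Y 1 \<omega>)) \<le> - lo))"

text \<open>Decompose \<open>x = \<rho> * (\<rho> x) + (1 - \<rho>\<^sup>2) * x\<close>: \<open>X\<close> is near \<open>x * sqrt n\<close> if \<open>Y\<close> is near \<open>\<rho> x * sqrt n\<close> and the
  independent variable \<open>V = X - \<rho> Y\<close> is near \<open>(1 - \<rho>\<^sup>2) x * sqrt n\<close>, and the costs \<open>\<rho>\<^sup>2 x\<^sup>2 / 2\<close> and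
  \<open>(1 - \<rho>\<^sup>2) x\<^sup>2 / 2\<close> add up to \<open>x\<^sup>2 / 2\<close>. Windows of width of order \<open>1 / sqrt n\<close> for \<open>Y\<close> determine the phase
  \<open>\<tau> * sqrt n * Y\<close> up to \<open>\<pi> / 3\<close>, while \<open>\<sigma> * sqrt n * X\<close> varies by a bounded amount only. Since the
  phase is steered by \<open>Y\<close> and never by \<open>V\<close>, the degenerate case \<open>\<rho> = \<plusminus>1\<close> is included.\<close>

lemma two_phase_windows:
  assumes \<tau>: "\<tau> \<noteq> 0" and \<epsilon>: "\<epsilon> > 0"
  shows "\<exists>C\<ge>0. \<forall>\<^sub>F N in sequentially. opposite_windows \<sigma> \<tau> N (exp (- ln N * (x\<^sup>2 / 2 + \<epsilon>)))
      (exp (ln N * (\<sigma> * x) - C) / 2) (exp (ln N * (\<sigma> * x) + C))"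
proof -
  define s where "s = sqrt (1 - \<rho>\<^sup>2)"
  have s2: "s\<^sup>2 = 1 - \<rho>\<^sup>2" and s: "0 \<le> s" "s \<le> 1"
    using rho by (auto simp: s_def abs_square_le_1 abs_le_iff)
  define c where "c = 3 * pi / \<bar>\<tau>\<bar>"
  define d where "d = pi / (3 * \<bar>\<tau>\<bar>)"
  have cd: "c \<ge> 0" "d > 0" using \<tau> by (auto simp: c_def d_def)
  define C where "C = \<bar>\<sigma>\<bar> * (c + 1)"
  from std_normal_window[of 1 1 "\<epsilon> / 2" "s * x"] \<epsilon> obtain n1 where
    n1: "\<forall>n\<ge>n1. n \<ge> 1 \<and> (\<forall>a. \<bar>a - s * x * sqrt n\<bar> \<le> 1 / sqrt n \<and> \<bar>a + 1 / sqrt n - s * x * sqrt n\<bar> \<le> 1 / sqrt n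
      \<longrightarrow> exp (- n * ((s * x)\<^sup>2 / 2 + \<epsilon> / 2)) \<le> measure std_normal_distribution {a..a + 1 / sqrt n})" by auto
  from std_normal_window[OF cd, of "\<epsilon> / 2" "\<rho> * x"] \<epsilon> obtain n2 where
    n2: "\<forall>n\<ge>n2. n \<ge> 1 \<and> (\<forall>a. \<bar>a - \<rho> * x * sqrt n\<bar> \<le> c / sqrt n \<and> \<bar>a + d / sqrt n - \<rho> * x * sqrt n\<bar> \<le> c / sqrt n
      \<longrightarrow> exp (- n * ((\<rho> * x)\<^sup>2 / 2 + \<epsilon> / 2)) \<le> measure std_normal_distribution {a..a + d / sqrt n})" by auto
  have "\<forall>\<^sub>F N in sequentially. max n1 n2 \<le> ln (real N)"
    using filterlim_ln_real unfolding filterlim_at_top by blast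
  then have "\<forall>\<^sub>F N in sequentially. opposite_windows \<sigma> \<tau> N (exp (- ln N * (x\<^sup>2 / 2 + \<epsilon>)))
      (exp (ln N * (\<sigma> * x) - C) / 2) (exp (ln N * (\<sigma> * x) + C))"
  proof (rule eventually_mono)
    fix N assume N: "max n1 n2 \<le> ln (real N)"
    define n where "n = ln (real N)"
    define r where "r = sqrt n"
    have nn: "n \<ge> n1" "n \<ge> n2" "n \<ge> 1" using N n1 by (auto simp: n_def)
    have r: "r > 0" "r * r = n" using nn by (auto simp: r_def)
    note [measurable] = measurable_X[OF order_refl] measurable_Y[OF order_refl]
    define V where "V \<omega> = X 1 \<omega> - \<rho> * Y 1 \<omega>" for \<omega>
    have [measurable]: "V \<in> borel_measurable M" unfolding V_def by measurable
    have V: "distr M borel V = normal_law 0 s" and ind: "indep_var borel V borel (Y 1)"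
      using regression[of 1] unfolding V_def s_def by auto
    define J where "J = {v. \<bar>v - s\<^sup>2 * x * r\<bar> \<le> 1 / r}"
    have [measurable]: "J \<in> sets borel" unfolding J_def by measurable
    have PJ: "exp (- n * ((s * x)\<^sup>2 / 2 + \<epsilon> / 2)) \<le> prob {\<omega>\<in>space M. V \<omega> \<in> J}"
    proof -
      interpret N: real_distribution std_normal_distribution by (rule real_dist_normal_dist)
      have "exp (- n * ((s * x)\<^sup>2 / 2 + \<epsilon> / 2)) \<le> measure std_normal_distribution {s * x * r..s * x * r + 1 / r}"
        using n1[rule_format, OF nn(1)] r unfolding r_def[symmetric] by auto
      also have "\<dots> \<le> measure std_normal_distribution {u. s * u \<in> J}"
      proof (rule N.finite_measure_mono)
        show "{s * x * r..s * x * r + 1 / r} \<subseteq> {u. s * u \<in> J}"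
        proof
          fix u assume u: "u \<in> {s * x * r..s * x * r + 1 / r}"
          have "s * u - s\<^sup>2 * x * r = s * (u - s * x * r)"
            by (simp add: power2_eq_square algebra_simps)
          then have "\<bar>s * u - s\<^sup>2 * x * r\<bar> = s * \<bar>u - s * x * r\<bar>"
            using s by (simp add: abs_mult)
          also have "\<dots> \<le> 1 * (1 / r)" using u s by (intro mult_mono) auto
          finally show "u \<in> {u. s * u \<in> J}" by (simp add: J_def)
        qed
        have "{u. s * u \<in> J} = (\<lambda>u. s * u) -` J \<inter> space std_normal_distribution" by auto
        also have "\<dots> \<in> sets std_normal_distribution" by measurable
        finally show "{u. s * u \<in> J} \<in> N.events" .
      qed
      also have "\<dots> = prob {\<omega>\<in>space M. V \<omega> \<in> J}" by (rule prob_normal_law[symmetric]) (use V s in auto)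
      finally show ?thesis .
    qed
    \<comment> \<open>The even (\<open>j = 0\<close>) and odd (\<open>j = 1\<close>) multiples of \<open>\<pi>\<close> next to the phase at \<open>Y = \<rho> x * sqrt n\<close>.\<close>
    define \<theta> where "\<theta> j = 2 * pi * of_int \<lfloor>\<rho> * x * \<tau> * n / (2 * pi)\<rfloor> + j * pi" for j :: real
    \<comment> \<open>The window starts or ends at the target, so that its length \<open>d / r\<close> is a phase of \<open>\<pi> / 3\<close>.\<close>
    define a where "a j = (if \<tau> > 0 then \<theta> j / (r * \<tau>) else \<theta> j / (r * \<tau>) - d / r)" for j
    define I where "I j = {a j..a j + d / r}" for j
    have Iev: "I j \<in> sets borel" for j by (simp add: I_def)
    have \<theta>: "\<bar>\<theta> j - \<rho> * x * \<tau> * n\<bar> \<le> 2 * pi" if "j = 0 \<or> j = 1" for j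
    proof -
      define m where "m = \<lfloor>\<rho> * x * \<tau> * n / (2 * pi)\<rfloor>"
      have "of_int m \<le> \<rho> * x * \<tau> * n / (2 * pi)" "\<rho> * x * \<tau> * n / (2 * pi) < of_int m + 1"
        unfolding m_def by linarith+
      then have "of_int m * (2 * pi) \<le> \<rho> * x * \<tau> * n" "\<rho> * x * \<tau> * n < (of_int m + 1) * (2 * pi)"
        by (simp_all add: pos_le_divide_eq pos_divide_less_eq)
      moreover have "\<theta> j = 2 * pi * of_int m + j * pi" by (simp add: \<theta>_def m_def)
      ultimately show ?thesis using that pi_gt_zero by (auto simp: abs_le_iff algebra_simps)
    qed
    have aI: "\<bar>Z - \<rho> * x * r\<bar> \<le> c / r" "\<bar>r * \<tau> * Z - \<theta> j\<bar> \<le> pi / 3" if "Z \<in> I j" "j = 0 \<or> j = 1" for Z j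
    proof -
      have tr: "\<bar>r * \<tau>\<bar> = r * \<bar>\<tau>\<bar>" using r by (simp add: abs_mult)
      have "\<bar>Z - \<theta> j / (r * \<tau>)\<bar> \<le> d / r" using that(1) by (auto simp: I_def a_def split: if_splits)
      then have "\<bar>r * \<tau>\<bar> * \<bar>Z - \<theta> j / (r * \<tau>)\<bar> \<le> r * \<bar>\<tau>\<bar> * (d / r)"
        unfolding tr using r by (intro mult_left_mono) auto
      moreover have "\<bar>r * \<tau>\<bar> * \<bar>Z - \<theta> j / (r * \<tau>)\<bar> = \<bar>r * \<tau> * Z - \<theta> j\<bar>"
        unfolding abs_mult[symmetric] using r \<tau> by (simp add: right_diff_distrib)
      moreover have "r * \<bar>\<tau>\<bar> * (d / r) = pi / 3" using r \<tau> by (simp add: d_def)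
      ultimately show b: "\<bar>r * \<tau> * Z - \<theta> j\<bar> \<le> pi / 3" by simp
      have "\<bar>r * \<tau> * Z - \<rho> * x * \<tau> * n\<bar> \<le> 3 * pi" using b \<theta>[OF that(2)] pi_gt_zero by linarith
      moreover have "r * \<tau> * Z - \<rho> * x * \<tau> * n = r * \<tau> * (Z - \<rho> * x * r)"
        using r by (simp add: algebra_simps)
      ultimately have "r * \<bar>\<tau>\<bar> * \<bar>Z - \<rho> * x * r\<bar> \<le> 3 * pi" by (simp add: abs_mult r(1) less_imp_le)
      then show "\<bar>Z - \<rho> * x * r\<bar> \<le> c / r" using r \<tau> by (simp add: c_def field_simps)
    qed
    have PI: "exp (- n * ((\<rho> * x)\<^sup>2 / 2 + \<epsilon> / 2)) \<le> prob {\<omega>\<in>space M. Y 1 \<omega> \<in> I j}" if j: "j = 0 \<or> j = 1" for j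
    proof -
      have ai: "a j \<in> I j" "a j + d / r \<in> I j" using cd r by (auto simp: I_def)
      have "exp (- n * ((\<rho> * x)\<^sup>2 / 2 + \<epsilon> / 2)) \<le> measure std_normal_distribution (I j)"
        using n2[rule_format, OF nn(2)] aI(1)[OF ai(1) j] aI(1)[OF ai(2) j] unfolding r_def[symmetric] I_def by auto
      also have "\<dots> = prob {\<omega>\<in>space M. Y 1 \<omega> \<in> I j}"
        using prob_normal_law[of "Y 1" "I j" 1] law_Y[of 1] Iev by simp
      finally show ?thesis .
    qed
    define A where "A j = {\<omega>\<in>space M. V \<omega> \<in> J \<and> Y 1 \<omega> \<in> I j}" for j
    have Aev: "A j \<in> events" for j unfolding A_def I_def by measurable
    have PA: "exp (- n * (x\<^sup>2 / 2 + \<epsilon>)) \<le> prob (A j)" if j: "j = 0 \<or> j = 1" for j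
    proof -
      have "- n * (x\<^sup>2 / 2 + \<epsilon>) = - n * ((s * x)\<^sup>2 / 2 + \<epsilon> / 2) + - n * ((\<rho> * x)\<^sup>2 / 2 + \<epsilon> / 2)"
        by (simp add: power_mult_distrib s2 algebra_simps)
      then have "exp (- n * (x\<^sup>2 / 2 + \<epsilon>)) = exp (- n * ((s * x)\<^sup>2 / 2 + \<epsilon> / 2)) * exp (- n * ((\<rho> * x)\<^sup>2 / 2 + \<epsilon> / 2))"
        by (simp only: exp_add)
      also have "\<dots> \<le> prob {\<omega>\<in>space M. V \<omega> \<in> J} * prob {\<omega>\<in>space M. Y 1 \<omega> \<in> I j}"
        by (intro mult_mono PJ PI j) auto
      also have "\<dots> = prob (A j)"
        unfolding A_def by (rule prob_indep_random_variable[OF ind, symmetric]) (auto simp: I_def)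
      finally show ?thesis .
    qed
    have ReW: "Re (weight (\<sigma>, \<tau>) N (X 1 \<omega>, Y 1 \<omega>)) = exp (r * \<sigma> * X 1 \<omega>) * cos (r * \<tau> * Y 1 \<omega>)" for \<omega>
      by (simp add: weight_def Re_exp r_def n_def mult.assoc)
    have bX: "exp (n * (\<sigma> * x) - C) \<le> exp (r * \<sigma> * X 1 \<omega>)" "exp (r * \<sigma> * X 1 \<omega>) \<le> exp (n * (\<sigma> * x) + C)"
      if "\<omega> \<in> A j" "j = 0 \<or> j = 1" for \<omega> j
    proof -
      have 1: "\<bar>V \<omega> - s\<^sup>2 * x * r\<bar> \<le> 1 / r" using that by (simp add: A_def J_def)
      have 2: "\<bar>Y 1 \<omega> - \<rho> * x * r\<bar> \<le> c / r" using aI(1)[OF _ that(2), of "Y 1 \<omega>"] that(1) by (simp add: A_def)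
      have "X 1 \<omega> - x * r = \<rho> * (Y 1 \<omega> - \<rho> * x * r) + (V \<omega> - s\<^sup>2 * x * r)"
        unfolding V_def s2 by (simp add: algebra_simps power2_eq_square)
      then have "\<bar>X 1 \<omega> - x * r\<bar> \<le> \<bar>\<rho>\<bar> * \<bar>Y 1 \<omega> - \<rho> * x * r\<bar> + \<bar>V \<omega> - s\<^sup>2 * x * r\<bar>"
        by (simp flip: abs_mult)
      also have "\<bar>\<rho>\<bar> * \<bar>Y 1 \<omega> - \<rho> * x * r\<bar> \<le> 1 * (c / r)"
        using rho 2 by (intro mult_mono) auto
      finally have "\<bar>X 1 \<omega> - x * r\<bar> \<le> (c + 1) / r" using 1 by (simp add: add_divide_distrib)
      then have "r * \<bar>X 1 \<omega> - x * r\<bar> \<le> c + 1" using r by (simp add: field_simps)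
      then have "\<bar>\<sigma>\<bar> * (r * \<bar>X 1 \<omega> - x * r\<bar>) \<le> C" unfolding C_def by (rule mult_left_mono) simp
      moreover have "\<bar>\<sigma>\<bar> * (r * \<bar>X 1 \<omega> - x * r\<bar>) = \<bar>r * \<sigma> * X 1 \<omega> - n * (\<sigma> * x)\<bar>"
      proof -
        have "r * \<sigma> * X 1 \<omega> - n * (\<sigma> * x) = \<sigma> * (r * (X 1 \<omega> - x * r))"
          using r by (simp add: algebra_simps)
        then show ?thesis using r by (simp add: abs_mult)
      qed
      ultimately have "\<bar>r * \<sigma> * X 1 \<omega> - n * (\<sigma> * x)\<bar> \<le> C" by simp
      then show "exp (n * (\<sigma> * x) - C) \<le> exp (r * \<sigma> * X 1 \<omega>)" "exp (r * \<sigma> * X 1 \<omega>) \<le> exp (n * (\<sigma> * x) + C)"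
        by (auto simp: abs_le_iff)
    qed
    have cosb: "1 / 2 \<le> cos (r * \<tau> * Y 1 \<omega> - \<theta> j)" if "\<omega> \<in> A j" "j = 0 \<or> j = 1" for \<omega> j
    proof -
      have b: "\<bar>r * \<tau> * Y 1 \<omega> - \<theta> j\<bar> \<le> pi / 3" using aI(2)[OF _ that(2), of "Y 1 \<omega>"] that(1) by (simp add: A_def)
      have "cos (pi / 3) \<le> cos \<bar>r * \<tau> * Y 1 \<omega> - \<theta> j\<bar>"
        using b by (intro cos_monotone_0_pi_le) auto
      then show ?thesis by (simp add: cos_60)
    qed
    have c0: "cos (t - \<theta> 0) = cos t" and c1: "cos (t - \<theta> 1) = - cos t" for t
    proof -
      have "cos (t - 2 * pi * of_int m) = cos t" for m :: int and t
        using cos_int_2pin[of m] sin_int_2pin[of m] by (simp add: cos_diff mult.commute)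
      note * = this
      show "cos (t - \<theta> 0) = cos t" using * by (simp add: \<theta>_def)
      have "cos (t - \<theta> 1) = cos (t - pi - 2 * pi * of_int \<lfloor>\<rho> * x * \<tau> * n / (2 * pi)\<rfloor>)"
        by (simp add: \<theta>_def algebra_simps)
      also have "\<dots> = - cos t" unfolding * by simp
      finally show "cos (t - \<theta> 1) = - cos t" .
    qed
    have prodb: "E1 / 2 \<le> E * q" "E * q \<le> E2" if "0 < E1" "E1 \<le> E" "E \<le> E2" "1 / 2 \<le> q" "q \<le> 1" for E1 E E2 q :: real
    proof -
      have "E1 * (1 / 2) \<le> E * q" using that by (intro mult_mono) auto
      then show "E1 / 2 \<le> E * q" by simp
      have "E * q \<le> E * 1" using that by (intro mult_left_mono) auto
      then have "E * q \<le> E" by simp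
      then show "E * q \<le> E2" using that(3) by (rule order_trans)
    qed
    show "opposite_windows \<sigma> \<tau> N (exp (- ln N * (x\<^sup>2 / 2 + \<epsilon>)))
      (exp (ln N * (\<sigma> * x) - C) / 2) (exp (ln N * (\<sigma> * x) + C))"
      unfolding n_def[symmetric] opposite_windows_def ReW
    proof (rule exI[of _ "A 0"], rule exI[of _ "A 1"], intro conjI ballI)
      fix \<omega> assume w: "\<omega> \<in> A 0"
      have q: "1 / 2 \<le> cos (r * \<tau> * Y 1 \<omega>)" using cosb[OF w] unfolding c0 by simp
      note b = prodb[OF _ bX[OF w] q]
      show "exp (n * (\<sigma> * x) - C) / 2 \<le> exp (r * \<sigma> * X 1 \<omega>) * cos (r * \<tau> * Y 1 \<omega>)" by (rule b(1)) auto
      show "exp (r * \<sigma> * X 1 \<omega>) * cos (r * \<tau> * Y 1 \<omega>) \<le> exp (n * (\<sigma> * x) + C)" by (rule b(2)) auto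
    next
      fix \<omega> assume w: "\<omega> \<in> A 1"
      have q: "1 / 2 \<le> - cos (r * \<tau> * Y 1 \<omega>)" using cosb[OF w] unfolding c1 by simp
      have q1: "- cos (r * \<tau> * Y 1 \<omega>) \<le> 1" using cos_ge_minus_one[of "r * \<tau> * Y 1 \<omega>"] by linarith
      note b = prodb[OF _ bX[OF w] q q1]
      have "exp (n * (\<sigma> * x) - C) / 2 \<le> exp (r * \<sigma> * X 1 \<omega>) * (- cos (r * \<tau> * Y 1 \<omega>))" by (rule b(1)) auto
      then show "exp (r * \<sigma> * X 1 \<omega>) * cos (r * \<tau> * Y 1 \<omega>) \<le> - (exp (n * (\<sigma> * x) - C) / 2)" by simp
      have "exp (r * \<sigma> * X 1 \<omega>) * (- cos (r * \<tau> * Y 1 \<omega>)) \<le> exp (n * (\<sigma> * x) + C)" by (rule b(2)) auto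
      then show "- exp (n * (\<sigma> * x) + C) \<le> exp (r * \<sigma> * X 1 \<omega>) * cos (r * \<tau> * Y 1 \<omega>)" by simp
    qed (use Aev PA in auto)
  qed
  moreover have "C \<ge> 0" using cd by (simp add: C_def)
  ultimately show ?thesis by blast
qed

end

section \<open>The lower bound by the fluctuations\<close>

lemma AE_std_normal_neq_0: "AE g in std_normal_distribution. g \<noteq> 0"
proof -
  have "AE x in lborel. x \<noteq> (0::real)" by (rule AE_lborel_singleton)
  then show ?thesis by (subst AE_density) auto
qed

context gaussian_sample
begin

lemma char_sum_pairs:
  fixes f :: "real \<times> real \<Rightarrow> real"
  assumes [measurable]: "f \<in> borel_measurable borel"
  shows "expectation (\<lambda>\<omega>. cis (t * (\<Sum>k=1..N. f (X k \<omega>, Y k \<omega>)))) = expectation (\<lambda>\<omega>. cis (t * f (X 1 \<omega>, Y 1 \<omega>))) ^ N"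
proof -
  have pr: "cis (t * (\<Sum>k\<in>A. h k)) = (\<Prod>k\<in>A. cis (t * h k))" if "finite A" for h :: "nat \<Rightarrow> real" and A
    using that by (induction A rule: finite_induct) (auto simp: distrib_left simp flip: cis_mult)
  have ind: "indep_vars (\<lambda>_. borel) (\<lambda>k \<omega>. cis (t * f (X k \<omega>, Y k \<omega>))) {1..N}"
    by (rule indep_vars_compose2[OF indep_vars_subset[OF indep_pairs]]) auto
  have i: "integrable M (\<lambda>\<omega>. cis (t * f (X k \<omega>, Y k \<omega>)))" if "k \<in> {1..N}" for k
    by (rule integrable_const_bound[where B=1]) (use that in auto)
  have "expectation (\<lambda>\<omega>. cis (t * (\<Sum>k=1..N. f (X k \<omega>, Y k \<omega>)))) = expectation (\<lambda>\<omega>. \<Prod>k=1..N. cis (t * f (X k \<omega>, Y k \<omega>)))"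
    by (simp add: pr)
  also have "\<dots> = (\<Prod>k=1..N. expectation (\<lambda>\<omega>. cis (t * f (X k \<omega>, Y k \<omega>))))"
    by (rule indep_vars_lebesgue_integral[OF _ ind i]) auto
  also have "\<dots> = (\<Prod>k=1..N. expectation (\<lambda>\<omega>. cis (t * f (X 1 \<omega>, Y 1 \<omega>))))"
    by (intro prod.cong refl integral_pair[where f="\<lambda>z. cis (t * f z)"]) auto
  finally show ?thesis by simp
qed

text \<open>Take \<open>L = exp (n l)\<close>. By the two phase windows, \<open>1 - \<bar>\<phi> (g / L)\<bar>\<close> is at least of the order of
  \<open>g\<^sup>2\<close> times \<open>exp (n (2 (\<sigma> x - l) - x\<^sup>2 / 2 - \<epsilon>))\<close>, which exceeds \<open>1 / N\<close> by a power of \<open>N\<close> if \<open>\<epsilon>\<close> is small.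
  So \<open>\<bar>\<phi> (g / L)\<bar>\<^sup>N\<close> tends to \<open>0\<close> for every \<open>g \<noteq> 0\<close>, and dominated convergence applies. The argument requires
  \<open>l > \<sigma> x\<close>, so that \<open>Re W\<^sub>1 / L\<close> is small on the windows; the condition \<open>x\<^sup>2 < 2\<close> leaves room for such \<open>l\<close>,
  and smaller \<open>l\<close> follow by monotonicity.\<close>

lemma partition_fn_lower_phase:
  assumes \<tau>: "\<tau> \<noteq> 0" and l: "l < \<sigma> * x + (1 - x\<^sup>2 / 2) / 2" and x: "x\<^sup>2 < 2"
  shows "(\<lambda>N. prob {\<omega>\<in>space M. norm (partition_fn X Y N (\<sigma>, \<tau>) \<omega>) \<le> exp (ln N * l)}) \<longlonglongrightarrow> 0"
proof -
  define b where "b = \<sigma> * x + (1 - x\<^sup>2 / 2) / 2"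
  have "max l (\<sigma> * x) < b" using l x by (simp add: b_def)
  then obtain l0 where l0: "l < l0" "\<sigma> * x < l0" "l0 < b" using dense[of "max l (\<sigma> * x)" b] by auto
  \<comment> \<open>Half of the gap \<open>2 (b - l0)\<close> in the exponent is spent on the windows; the other half remains.\<close>
  define \<epsilon> where "\<epsilon> = b - l0"
  have \<epsilon>: "\<epsilon> > 0" using l0 by (simp add: \<epsilon>_def)
  from two_phase_windows[OF \<tau> \<epsilon>, where x=x and \<sigma>=\<sigma>] obtain C where C: "C \<ge> 0" and
    win: "\<forall>\<^sub>F N in sequentially. opposite_windows \<sigma> \<tau> N (exp (- ln N * (x\<^sup>2 / 2 + \<epsilon>)))
      (exp (ln N * (\<sigma> * x) - C) / 2) (exp (ln N * (\<sigma> * x) + C))"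
    by blast
  define L where "L N = exp (ln (real N) * l0)" for N
  define f where "f N z = Re (weight (\<sigma>, \<tau>) N z)" for N z
  define \<phi> where "\<phi> N t = expectation (\<lambda>\<omega>. cis (t * f N (X 1 \<omega>, Y 1 \<omega>)))" for N t
  have [measurable]: "f N \<in> borel_measurable borel" for N unfolding f_def[abs_def] by measurable
  have L: "L N > 0" for N by (simp add: L_def)
  let ?N = "std_normal_distribution"
  interpret Nd: real_distribution ?N by (rule real_dist_normal_dist)
  have \<phi>1: "norm (\<phi> N t) \<le> 1" for N t
  proof -
    have "norm (\<phi> N t) \<le> expectation (\<lambda>\<omega>. norm (cis (t * f N (X 1 \<omega>, Y 1 \<omega>))))"
      unfolding \<phi>_def by (rule integral_norm_bound)
    then show ?thesis by (simp add: prob_space)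
  qed
  have decay: "(\<lambda>N. norm (\<phi> N (g / L N)) ^ N) \<longlonglongrightarrow> 0" if g: "g \<noteq> 0" for g
  proof (rule tendsto_sandwich[OF _ _ tendsto_const])
    define K where "K = g\<^sup>2 * exp (- 2 * C) / 32"
    have K: "K > 0" using g by (simp add: K_def)
    have "filterlim (\<lambda>N. K * exp (\<epsilon> * ln (real N))) at_top sequentially"
      using K \<epsilon> by (intro filterlim_tendsto_pos_mult_at_top[OF tendsto_const] filterlim_compose[OF exp_at_top] filterlim_ln_real) auto
    then show "(\<lambda>N. exp (- (K * exp (\<epsilon> * ln (real N))))) \<longlonglongrightarrow> 0"
      by (intro filterlim_compose[OF exp_at_bot] filterlim_compose[OF filterlim_uminus_at_bot_at_top])
    have "(\<lambda>N. (\<bar>g\<bar> * exp C) * exp (ln (real N) * (\<sigma> * x - l0))) \<longlonglongrightarrow> 0"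
      by (intro exp_ln_tendsto_0) (use l0 in auto)
    then have "\<forall>\<^sub>F N in sequentially. (\<bar>g\<bar> * exp C) * exp (ln (real N) * (\<sigma> * x - l0)) < pi / 2"
      by (rule order_tendstoD) simp
    then show "\<forall>\<^sub>F N in sequentially. norm (\<phi> N (g / L N)) ^ N \<le> exp (- (K * exp (\<epsilon> * ln (real N))))"
      using win eventually_ge_at_top[of 1]
    proof eventually_elim
      case (elim N)
      define n where "n = ln (real N)"
      have eN: "real N = exp n" using elim(3) by (simp add: n_def)
      define p where "p = exp (- n * (x\<^sup>2 / 2 + \<epsilon>))"
      define lo where "lo = exp (n * (\<sigma> * x) - C) / 2"
      define hi where "hi = exp (n * (\<sigma> * x) + C)"
      have "opposite_windows \<sigma> \<tau> N p lo hi"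
        using elim(2) unfolding n_def[symmetric] p_def lo_def hi_def .
      then obtain A B where A: "A \<in> events" "p \<le> prob A" "\<forall>\<omega>\<in>A. lo \<le> f N (X 1 \<omega>, Y 1 \<omega>) \<and> f N (X 1 \<omega>, Y 1 \<omega>) \<le> hi"
        and B: "B \<in> events" "p \<le> prob B" "\<forall>\<omega>\<in>B. - hi \<le> f N (X 1 \<omega>, Y 1 \<omega>) \<and> f N (X 1 \<omega>, Y 1 \<omega>) \<le> - lo"
        unfolding opposite_windows_def f_def by blast
      have "exp (n * (\<sigma> * x) - C) \<le> exp (n * (\<sigma> * x) + C)" using C by simp
      moreover have "0 < exp (n * (\<sigma> * x) - C)" by simp
      ultimately have lohi: "0 < lo" "lo \<le> hi" unfolding lo_def hi_def by linarith+
      define t where "t = g / L N"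
      have t0: "\<bar>t\<bar> = \<bar>g\<bar> / L N" using L[of N] by (simp add: t_def)
      have "\<bar>t\<bar> * hi = \<bar>g\<bar> * exp (C + (n * (\<sigma> * x) - n * l0))"
        unfolding t0 hi_def L_def n_def[symmetric] by (simp add: exp_add exp_diff)
      also have "C + (n * (\<sigma> * x) - n * l0) = C + n * (\<sigma> * x - l0)" by (simp add: algebra_simps)
      finally have thi: "\<bar>t\<bar> * hi \<le> pi / 2" using elim(1) unfolding n_def[symmetric] by (simp add: exp_add)
      define d where "d = \<bar>t\<bar> * lo"
      have d: "0 \<le> d" "d \<le> pi / 2" using lohi thi mult_left_mono[OF lohi(2), of "\<bar>t\<bar>"] by (auto simp: d_def)
      have "norm (\<phi> N t) \<le> 1 - p * (1 - cos d)"
      proof (cases "t > 0")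
        case True
        then have "d = t * lo" "t * hi \<le> pi / 2" using thi by (auto simp: d_def)
        show ?thesis unfolding \<phi>_def
        proof (rule norm_char_le_two_sets[OF _ A(1) B(1) A(2) B(2) d])
          fix \<omega> assume "\<omega> \<in> A"
          from bspec[OF A(3) this] True have "t * lo \<le> t * f N (X 1 \<omega>, Y 1 \<omega>)" "t * f N (X 1 \<omega>, Y 1 \<omega>) \<le> t * hi" by auto
          then show "d \<le> t * f N (X 1 \<omega>, Y 1 \<omega>) \<and> t * f N (X 1 \<omega>, Y 1 \<omega>) \<le> pi / 2"
            using \<open>d = t * lo\<close> \<open>t * hi \<le> pi / 2\<close> by linarith
        next
          fix \<omega> assume "\<omega> \<in> B"
          from bspec[OF B(3) this] True have "t * (- hi) \<le> t * f N (X 1 \<omega>, Y 1 \<omega>)" "t * f N (X 1 \<omega>, Y 1 \<omega>) \<le> t * (- lo)" 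
            by (metis less_imp_le mult_left_mono)+
          then show "- (pi / 2) \<le> t * f N (X 1 \<omega>, Y 1 \<omega>) \<and> t * f N (X 1 \<omega>, Y 1 \<omega>) \<le> - d"
            using \<open>d = t * lo\<close> \<open>t * hi \<le> pi / 2\<close> by simp
        qed measurable
      next
        case False
        moreover have "t \<noteq> 0" using g less_imp_neq[OF L[of N]] by (simp add: t_def)
        ultimately have t: "t < 0" by simp
        then have "d = - (t * lo)" "- (t * hi) \<le> pi / 2" using thi by (auto simp: d_def)
        show ?thesis unfolding \<phi>_def
        proof (rule norm_char_le_two_sets[OF _ B(1) A(1) B(2) A(2) d])
          fix \<omega> assume "\<omega> \<in> A"
          from bspec[OF A(3) this] t have "t * f N (X 1 \<omega>, Y 1 \<omega>) \<le> t * lo" "t * hi \<le> t * f N (X 1 \<omega>, Y 1 \<omega>)" by auto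
          then show "- (pi / 2) \<le> t * f N (X 1 \<omega>, Y 1 \<omega>) \<and> t * f N (X 1 \<omega>, Y 1 \<omega>) \<le> - d"
            using \<open>d = - (t * lo)\<close> \<open>- (t * hi) \<le> pi / 2\<close> by linarith
        next
          fix \<omega> assume "\<omega> \<in> B"
          from bspec[OF B(3) this] t have "t * f N (X 1 \<omega>, Y 1 \<omega>) \<le> t * (- hi)" "t * (- lo) \<le> t * f N (X 1 \<omega>, Y 1 \<omega>)"
            by (metis less_imp_le mult_left_mono_neg)+
          then show "d \<le> t * f N (X 1 \<omega>, Y 1 \<omega>) \<and> t * f N (X 1 \<omega>, Y 1 \<omega>) \<le> pi / 2"
            using \<open>d = - (t * lo)\<close> \<open>- (t * hi) \<le> pi / 2\<close> by simp
        qed measurable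
      qed
      also have "p * (d\<^sup>2 / 8) \<le> p * (1 - cos d)"
        by (intro mult_left_mono one_minus_cos_ge d) (simp add: p_def)
      then have "1 - p * (1 - cos d) \<le> 1 + - (p * (d\<^sup>2 / 8))" by simp
      also have "\<dots> \<le> exp (- (p * (d\<^sup>2 / 8)))" by (rule exp_ge_add_one_self)
      finally have "norm (\<phi> N t) ^ N \<le> exp (- (p * (d\<^sup>2 / 8))) ^ N"
        by (intro power_mono) auto
      also have "\<dots> = exp (- (real N * (p * (d\<^sup>2 / 8))))"
        by (simp flip: exp_of_nat_mult)
      also have "real N * (p * (d\<^sup>2 / 8)) = K * exp (\<epsilon> * n)"
      proof -
        have "d\<^sup>2 = g\<^sup>2 * (exp (n * (\<sigma> * x) - C - n * l0))\<^sup>2 / 4"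
          unfolding d_def t0 lo_def L_def n_def[symmetric] by (simp add: exp_diff power_divide power_mult_distrib)
        also have "(exp (n * (\<sigma> * x) - C - n * l0))\<^sup>2 = exp (2 * (n * (\<sigma> * x) - C - n * l0))"
          by (rule exp_double[symmetric])
        finally have d2: "d\<^sup>2 / 8 = g\<^sup>2 / 32 * exp (2 * (n * (\<sigma> * x) - C - n * l0))" by simp
        have "real N * (p * (d\<^sup>2 / 8)) = g\<^sup>2 / 32 * exp (n + (- n * (x\<^sup>2 / 2 + \<epsilon>) + 2 * (n * (\<sigma> * x) - C - n * l0)))"
          unfolding d2 eN p_def by (simp only: exp_add) simp
        also have "n + (- n * (x\<^sup>2 / 2 + \<epsilon>) + 2 * (n * (\<sigma> * x) - C - n * l0)) = - 2 * C + \<epsilon> * n"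
          by (simp add: \<epsilon>_def b_def field_simps)
        finally show ?thesis by (simp only: K_def exp_add) simp
      qed
      finally show "norm (\<phi> N (g / L N)) ^ N \<le> exp (- (K * exp (\<epsilon> * ln (real N))))"
        unfolding t_def n_def .
    qed
  qed (auto intro!: always_eventually)
  have meas: "(\<lambda>g. norm (\<phi> N (g / L N)) ^ N) \<in> borel_measurable ?N" for N
  proof -
    have "(\<lambda>g. \<phi> N (g / L N)) \<in> borel_measurable borel"
      unfolding \<phi>_def by (rule borel_measurable_lebesgue_integral) measurable
    then show ?thesis by simp
  qed
  have "(\<lambda>N. LINT g|?N. norm (\<phi> N (g / L N)) ^ N) \<longlonglongrightarrow> (LINT g|?N. 0)"
  proof (rule integral_dominated_convergence[where w="\<lambda>_. 1"])
    show "AE g in ?N. (\<lambda>N. norm (\<phi> N (g / L N)) ^ N) \<longlonglongrightarrow> 0"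
      using AE_std_normal_neq_0 by eventually_elim (rule decay)
    show "AE g in ?N. norm (norm (\<phi> N (g / L N)) ^ N) \<le> 1" for N
      by (intro AE_I2) (simp add: power_le_one \<phi>1)
  qed (use meas in auto)
  then have "(\<lambda>N. 2 * (LINT g|?N. norm (\<phi> N (g / L N)) ^ N)) \<longlonglongrightarrow> 2 * 0"
    by (intro tendsto_intros) simp
  then have lim: "(\<lambda>N. 2 * (LINT g|?N. norm (\<phi> N (g / L N)) ^ N)) \<longlonglongrightarrow> 0" by simp
  show ?thesis
  proof (rule tendsto_sandwich[OF _ _ tendsto_const lim])
    show "\<forall>\<^sub>F N in sequentially. prob {\<omega>\<in>space M. norm (partition_fn X Y N (\<sigma>, \<tau>) \<omega>) \<le> exp (ln N * l)}
        \<le> 2 * (LINT g|?N. norm (\<phi> N (g / L N)) ^ N)"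
      using eventually_ge_at_top[of 1]
    proof eventually_elim
      case (elim N)
      define S where "S \<omega> = (\<Sum>k=1..N. f N (X k \<omega>, Y k \<omega>))" for \<omega>
      have SZ: "S \<omega> = Re (partition_fn X Y N (\<sigma>, \<tau>) \<omega>)" for \<omega>
        by (simp add: S_def f_def partition_fn_eq)
      have [measurable]: "S \<in> borel_measurable M" unfolding SZ[abs_def] by measurable
      have "ln N * l \<le> ln N * l0" using l0 elim by (intro mult_left_mono) auto
      then have le: "exp (ln N * l) \<le> L N" by (simp add: L_def)
      have "prob {\<omega>\<in>space M. norm (partition_fn X Y N (\<sigma>, \<tau>) \<omega>) \<le> exp (ln N * l)} \<le> prob {\<omega>\<in>space M. \<bar>S \<omega>\<bar> \<le> L N}"
      proof (rule finite_measure_mono)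
        show "{\<omega>\<in>space M. norm (partition_fn X Y N (\<sigma>, \<tau>) \<omega>) \<le> exp (ln N * l)} \<subseteq> {\<omega>\<in>space M. \<bar>S \<omega>\<bar> \<le> L N}"
          unfolding SZ using le abs_Re_le_cmod by (auto intro: order_trans)
      qed measurable
      also have "\<dots> \<le> 2 * (LINT g|?N. norm (expectation (\<lambda>\<omega>. cis (g / L N * S \<omega>))))"
        by (rule concentration_le_char[OF _ L]) measurable
      also have "(\<lambda>g. expectation (\<lambda>\<omega>. cis (g / L N * S \<omega>))) = (\<lambda>g. \<phi> N (g / L N) ^ N)"
        unfolding S_def \<phi>_def by (intro ext char_sum_pairs) measurable
      finally show ?case by (simp add: norm_power)
    qed
  qed (auto intro!: always_eventually)
qed

text \<open>Maximize \<open>\<sigma> x + (1 - x\<^sup>2 / 2) / 2\<close> over \<open>x\<^sup>2 < 2\<close>: the maximum is at \<open>x = 2 \<sigma>\<close> if \<open>2 \<sigma>\<^sup>2 < 1\<close>; otherwise the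
  supremum is approached as \<open>\<bar>x\<bar>\<close> tends to \<open>sqrt 2\<close>.\<close>

lemma partition_fn_lower_fluctuation:
  assumes \<tau>: "\<tau> \<noteq> 0" and l: "l < fluctuation_exponent \<sigma>"
  shows "(\<lambda>N. prob {\<omega>\<in>space M. norm (partition_fn X Y N (\<sigma>, \<tau>) \<omega>) \<le> exp (ln N * l)}) \<longlonglongrightarrow> 0"
proof (cases "2 * \<sigma>\<^sup>2 < 1")
  case True
  then show ?thesis using l
    by (intro partition_fn_lower_phase[where x="2 * \<sigma>"] \<tau>) (auto simp: fluctuation_exponent_def power2_eq_square field_simps)
next
  case False
  then have l: "l < sqrt 2 * \<bar>\<sigma>\<bar>" using l fluctuation_exponent_large[of \<sigma>] by simp
  let ?F = "\<lambda>x. \<bar>\<sigma>\<bar> * x + (1 - x\<^sup>2 / 2) / 2"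
  have "(?F \<longlongrightarrow> ?F (sqrt 2)) (at_left (sqrt 2))"
    by (intro tendsto_intros) auto
  then have "\<forall>\<^sub>F x in at_left (sqrt 2). l < ?F x"
    by (rule order_tendstoD) (use l in \<open>simp add: mult.commute\<close>)
  moreover have "\<forall>\<^sub>F x in at_left (sqrt 2). x < sqrt 2" by (simp add: eventually_at_filter)
  moreover have "\<forall>\<^sub>F x in at_left (sqrt 2). 0 < x" by (rule eventually_at_left_field[THEN iffD2]) (auto intro!: exI[of _ 0])
  ultimately have "\<forall>\<^sub>F x in at_left (sqrt 2). l < ?F x \<and> 0 < x \<and> x < sqrt 2" by eventually_elim auto
  then obtain x where x: "l < ?F x" "0 < x" "x < sqrt 2"
    using eventually_happens'[OF trivial_limit_at_left_real] by blast
  have "x\<^sup>2 < (sqrt 2)\<^sup>2" using x by (intro power_strict_mono) auto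
  then have x2: "x\<^sup>2 < 2" by simp
  have e1: "\<sigma> * (sgn \<sigma> * x) = \<bar>\<sigma>\<bar> * x" by (simp add: abs_sgn mult.assoc)
  have e2: "(sgn \<sigma> * x)\<^sup>2 = x\<^sup>2" using False by (auto simp: power_mult_distrib sgn_if)
  show ?thesis
    by (rule partition_fn_lower_phase[OF \<tau>, where x="sgn \<sigma> * x"]; unfold e1 e2; fact)
qed

text \<open>Without phases there is no cancellation, and \<open>Z\<close> is at least its largest summand. Each
  \<open>X\<^sub>k\<close> exceeds \<open>x * sqrt n\<close> in the direction of \<open>\<sigma>\<close> with probability much larger than \<open>1 / N\<close>
  when \<open>x < sqrt 2\<close>, so one of them does.\<close>

lemma partition_fn_lower_positive:
  assumes l: "l < sqrt 2 * \<bar>\<sigma>\<bar>" and s: "\<sigma> \<noteq> 0"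
  shows "(\<lambda>N. prob {\<omega>\<in>space M. norm (partition_fn X Y N (\<sigma>, 0) \<omega>) \<le> exp (ln N * l)}) \<longlonglongrightarrow> 0"
proof -
  define e where "e = sgn \<sigma>"
  have e: "e = 1 \<or> e = - 1" "\<sigma> = \<bar>\<sigma>\<bar> * e" using s by (auto simp: e_def sgn_if)
  have "max 0 (l / \<bar>\<sigma>\<bar>) < sqrt 2" using l s by (simp add: pos_divide_less_eq)
  then obtain x where x: "0 < x" "l / \<bar>\<sigma>\<bar> < x" "x < sqrt 2" using dense[of "max 0 (l / \<bar>\<sigma>\<bar>)" "sqrt 2"] by auto
  then have lx: "l < \<bar>\<sigma>\<bar> * x" using s by (simp add: pos_divide_less_eq mult.commute)
  have "x\<^sup>2 < (sqrt 2)\<^sup>2" using x by (intro power_strict_mono) auto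
  define \<epsilon> where "\<epsilon> = (1 - x\<^sup>2 / 2) / 2"
  have \<epsilon>: "\<epsilon> > 0" using \<open>x\<^sup>2 < (sqrt 2)\<^sup>2\<close> by (simp add: \<epsilon>_def)
  from std_normal_window[of 1 1 \<epsilon> "e * x"] \<epsilon> obtain n0 where
    n0: "\<forall>n\<ge>n0. n \<ge> 1 \<and> (\<forall>a. \<bar>a - e * x * sqrt n\<bar> \<le> 1 / sqrt n \<and> \<bar>a + 1 / sqrt n - e * x * sqrt n\<bar> \<le> 1 / sqrt n
      \<longrightarrow> exp (- n * ((e * x)\<^sup>2 / 2 + \<epsilon>)) \<le> measure std_normal_distribution {a..a + 1 / sqrt n})" by auto
  have "filterlim (\<lambda>N. exp (\<epsilon> * ln (real N))) at_top sequentially"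
    using \<epsilon> by (intro filterlim_compose[OF exp_at_top] filterlim_tendsto_pos_mult_at_top[OF tendsto_const] filterlim_ln_real) auto
  then have lim: "(\<lambda>N. exp (- exp (\<epsilon> * ln (real N)))) \<longlonglongrightarrow> 0"
    by (intro filterlim_compose[OF exp_at_bot] filterlim_compose[OF filterlim_uminus_at_bot_at_top])
  have ev: "\<forall>\<^sub>F N in sequentially. n0 \<le> ln (real N)"
    using filterlim_ln_real unfolding filterlim_at_top by blast
  show ?thesis
  proof (rule tendsto_sandwich[OF _ _ tendsto_const lim])
    show "\<forall>\<^sub>F N in sequentially. prob {\<omega>\<in>space M. norm (partition_fn X Y N (\<sigma>, 0) \<omega>) \<le> exp (ln N * l)}
       \<le> exp (- exp (\<epsilon> * ln (real N)))"
      using ev eventually_ge_at_top[of 1]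
    proof eventually_elim
      case (elim N)
      define n where "n = ln (real N)"
      define r where "r = sqrt n"
      have n1: "n \<ge> 1" using n0 elim by (simp add: n_def)
      have r: "r > 0" "r * r = n" using n1 by (auto simp: r_def)
      interpret Nd: real_distribution std_normal_distribution by (rule real_dist_normal_dist)
      define a where "a = (if e = 1 then x * r else - (x * r) - 1 / r)"
      define H where "H = {u. e * u < x * r}"
      have [measurable]: "H \<in> sets borel" unfolding H_def by measurable
      have "exp (- n * ((e * x)\<^sup>2 / 2 + \<epsilon>)) \<le> measure std_normal_distribution {a..a + 1 / r}"
      proof -
        have "\<bar>a - e * x * sqrt n\<bar> \<le> 1 / sqrt n \<and> \<bar>a + 1 / sqrt n - e * x * sqrt n\<bar> \<le> 1 / sqrt n"
          using e(1) r unfolding r_def[symmetric] by (auto simp: a_def)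
        then show ?thesis using n0 elim(1) unfolding r_def n_def by blast
      qed
      also have "\<dots> \<le> measure std_normal_distribution (- H)"
      proof (rule Nd.finite_measure_mono)
        show "{a..a + 1 / r} \<subseteq> - H" using e by (auto simp: a_def H_def)
        show "- H \<in> Nd.events" by simp
      qed
      finally have q: "exp (- n * (x\<^sup>2 / 2 + \<epsilon>)) \<le> 1 - measure std_normal_distribution H"
        using e Nd.prob_compl[of H] by (auto simp: Compl_eq_Diff_UNIV)
      have PH: "prob {\<omega>\<in>space M. X k \<omega> \<in> H} = measure std_normal_distribution H" if "k \<ge> 1" for k
        using prob_normal_law[of "X k" H 1] law_X[of k] that by simp
      have ind: "indep_vars (\<lambda>_. borel) (\<lambda>k \<omega>. fst (X k \<omega>, Y k \<omega>)) {1..}"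
        by (rule indep_vars_compose2[OF indep_pairs]) (simp add: borel_prod[symmetric])
      have "{\<omega>\<in>space M. norm (partition_fn X Y N (\<sigma>, 0) \<omega>) \<le> exp (n * l)} \<subseteq> (\<Inter>k\<in>{1..N}. X k -` H \<inter> space M)"
      proof
        fix \<omega> assume w: "\<omega> \<in> {\<omega>\<in>space M. norm (partition_fn X Y N (\<sigma>, 0) \<omega>) \<le> exp (n * l)}"
        have eq: "partition_fn X Y N (\<sigma>, 0) \<omega> = of_real (\<Sum>k=1..N. exp (r * \<sigma> * X k \<omega>))"
          unfolding partition_fn_eq of_real_sum
          by (intro sum.cong refl) (simp add: weight_def r_def n_def mult.assoc flip: exp_of_real)
        have "e * X k \<omega> < x * r" if k: "k \<in> {1..N}" for k
        proof -
          have "exp (r * \<sigma> * X k \<omega>) \<le> (\<Sum>k=1..N. exp (r * \<sigma> * X k \<omega>))"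
            using k by (intro member_le_sum) auto
          also have "\<dots> = norm (partition_fn X Y N (\<sigma>, 0) \<omega>)"
            unfolding eq norm_of_real by (rule abs_of_nonneg[symmetric]) (simp add: sum_nonneg)
          also have "\<dots> \<le> exp (n * l)" using w by simp
          finally have "r * \<sigma> * X k \<omega> \<le> n * l" by simp
          also have "n * l < n * (\<bar>\<sigma>\<bar> * x)" using lx n1 by simp
          also have "n * (\<bar>\<sigma>\<bar> * x) = r * \<bar>\<sigma>\<bar> * (x * r)" using r by (simp add: algebra_simps)
          also have "r * \<sigma> * X k \<omega> = r * \<bar>\<sigma>\<bar> * (e * X k \<omega>)" by (subst e(2)) simp
          finally show ?thesis using r s by simp
        qed
        then show "\<omega> \<in> (\<Inter>k\<in>{1..N}. X k -` H \<inter> space M)" using w by (auto simp: H_def)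
      qed
      then have "prob {\<omega>\<in>space M. norm (partition_fn X Y N (\<sigma>, 0) \<omega>) \<le> exp (n * l)} \<le> prob (\<Inter>k\<in>{1..N}. X k -` H \<inter> space M)"
        using elim(2) by (intro finite_measure_mono) auto
      also have "\<dots> = (\<Prod>k\<in>{1..N}. prob (X k -` H \<inter> space M))"
        using indep_varsD[OF ind, of "{1..N}" "\<lambda>_. H"] elim(2) by simp
      also have "\<dots> = (\<Prod>k\<in>{1..N}. measure std_normal_distribution H)"
        by (intro prod.cong refl) (simp add: PH vimage_def Int_def conj_commute)
      also have "\<dots> = (measure std_normal_distribution H) ^ N" by simp
      also have "\<dots> \<le> exp (- exp (- n * (x\<^sup>2 / 2 + \<epsilon>))) ^ N"
        using q exp_ge_add_one_self[of "- exp (- n * (x\<^sup>2 / 2 + \<epsilon>))"] by (intro power_mono) auto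
      also have "\<dots> = exp (- (real N * exp (- n * (x\<^sup>2 / 2 + \<epsilon>))))" by (simp flip: exp_of_nat_mult)
      also have "real N * exp (- n * (x\<^sup>2 / 2 + \<epsilon>)) = exp (n + - n * (x\<^sup>2 / 2 + \<epsilon>))"
        using elim(2) by (simp only: exp_add) (simp add: n_def)
      also have "n + - n * (x\<^sup>2 / 2 + \<epsilon>) = \<epsilon> * n" by (simp add: \<epsilon>_def field_simps)
      finally show ?case unfolding n_def .
    qed
  qed (auto intro!: always_eventually)
qed

end

section \<open>Negative moments of a rotating vector\<close>

text \<open>The value at zeros of the sine is \<open>\<infinity>\<close>, so that pointwise upper bounds by this function remain true
  there.\<close>

definition inv_sqrt_sin :: "real \<Rightarrow> ennreal" where
  "inv_sqrt_sin x = (if sin x = 0 then \<infinity> else ennreal (\<bar>sin x\<bar> powr (- 1 / 2)))"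

lemma inv_sqrt_sin_measurable [measurable]: "inv_sqrt_sin \<in> borel_measurable borel"
  unfolding inv_sqrt_sin_def[abs_def] by measurable

lemma inv_sqrt_sin_reflect:
  assumes "e = 1 \<or> e = - 1"
  shows "inv_sqrt_sin (of_int k * pi + e * x) = inv_sqrt_sin x"
proof -
  have "sin (of_int k * pi) = 0" by (simp add: sin_zero_iff_int2)
  moreover have "\<bar>cos (of_int k * pi)\<bar> = 1"
    using \<open>sin (of_int k * pi) = 0\<close> sin_zero_abs_cos_one by blast
  ultimately have "\<bar>sin (of_int k * pi + e * x)\<bar> = \<bar>sin x\<bar>"
    using assms by (auto simp: sin_add sin_diff abs_mult)
  moreover from this have "sin (of_int k * pi + e * x) = 0 \<longleftrightarrow> sin x = 0" by (metis abs_eq_0)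
  ultimately show ?thesis by (simp add: inv_sqrt_sin_def)
qed

lemma inv_sqrt_sin_quarter:
  "(\<integral>\<^sup>+x. inv_sqrt_sin x * indicator {0..pi/2} x \<partial>lborel) \<le> 4"
proof -
  have I: "((\<lambda>x. x powr (- 1 / 2)) has_integral ((pi/2) powr (- 1 / 2 + 1) / (- 1 / 2 + 1))) {0..pi/2}"
    by (rule has_integral_powr_from_0) auto
  have I2: "((\<lambda>x. sqrt 2 * x powr (- 1 / 2)) has_integral (sqrt 2 * ((pi/2) powr (- 1 / 2 + 1) / (- 1 / 2 + 1)))) {0..pi/2}"
    using has_integral_mult_right[OF I, of "sqrt 2"] by simp
  have pw: "inv_sqrt_sin x * indicator {0..pi/2} x \<le> ennreal (indicator {0..pi/2} x * (sqrt 2 * x powr (- 1 / 2)))" if "x \<noteq> 0" for x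
  proof (cases "x \<in> {0..pi/2}")
    case True
    then have x: "0 < x" "x \<le> pi / 2" using that by auto
    have s: "x / 2 \<le> sin x" using x by (intro half_le_sin) auto
    then have s0: "sin x > 0" using x by linarith
    have "\<bar>sin x\<bar> powr (- 1 / 2) \<le> (x / 2) powr (- 1 / 2)"
      using s s0 x by (intro powr_mono2') auto
    also have "\<dots> = sqrt 2 * x powr (- 1 / 2)"
      using x by (simp add: powr_divide powr_minus powr_half_sqrt field_simps)
    finally show ?thesis using True s0 by (simp add: inv_sqrt_sin_def ennreal_leI)
  qed auto
  have "(\<integral>\<^sup>+x. inv_sqrt_sin x * indicator {0..pi/2} x \<partial>lborel) \<le> (\<integral>\<^sup>+x. ennreal (indicator {0..pi/2} x * (sqrt 2 * x powr (- 1 / 2))) \<partial>lborel)"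
    by (rule nn_integral_mono_AE) (use AE_lborel_singleton[of "0::real"] pw in \<open>auto elim!: eventually_mono\<close>)
  also have "\<dots> = ennreal (sqrt 2 * ((pi/2) powr (- 1 / 2 + 1) / (- 1 / 2 + 1)))"
    by (rule nn_integral_has_integral_lebesgue[OF _ I2]) auto
  also have "sqrt 2 * ((pi/2) powr (- 1 / 2 + 1) / (- 1 / 2 + 1)) = 2 * (sqrt 2 * sqrt (pi / 2))"
    by (simp add: powr_half_sqrt)
  also have "sqrt 2 * sqrt (pi / 2) = sqrt pi" by (simp flip: real_sqrt_mult)
  also have "sqrt pi \<le> 2" using pi_less_4 by (intro real_le_lsqrt) auto
  then have "ennreal (2 * sqrt pi) \<le> ennreal 4" by (intro ennreal_leI) simp
  finally show ?thesis by simp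
qed

text \<open>An interval of length \<open>\<pi>\<close> is covered by four quarter periods, each next to a zero of the sine.\<close>

lemma inv_sqrt_sin_period:
  "(\<integral>\<^sup>+x. inv_sqrt_sin x * indicator {u..u+pi} x \<partial>lborel) \<le> 16"
proof -
  define k where "k = \<lfloor>u / pi\<rfloor>"
  have "of_int k \<le> u / pi" "u / pi < of_int k + 1" unfolding k_def by linarith+
  then have k: "of_int k * pi \<le> u" "u < of_int k * pi + pi"
    by (simp_all add: pos_le_divide_eq pos_divide_less_eq distrib_right)
  define Q where "Q m e = {x. 0 \<le> e * (x - of_int m * pi) \<and> e * (x - of_int m * pi) \<le> pi / 2}" for m :: int and e :: real
  have [measurable]: "Q m e \<in> sets borel" for m e unfolding Q_def by measurable
  have int: "(\<integral>\<^sup>+x. inv_sqrt_sin x * indicator (Q m e) x \<partial>lborel) \<le> 4" if e: "e = 1 \<or> e = - 1" for m e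
  proof -
    have "(\<integral>\<^sup>+x. inv_sqrt_sin x * indicator (Q m e) x \<partial>lborel) =
        \<bar>e\<bar> * (\<integral>\<^sup>+x. inv_sqrt_sin (of_int m * pi + e * x) * indicator (Q m e) (of_int m * pi + e * x) \<partial>lborel)"
      by (rule nn_integral_real_affine) (use e in auto)
    also have "\<dots> = (\<integral>\<^sup>+x. inv_sqrt_sin x * indicator {0..pi/2} x \<partial>lborel)"
    proof -
      have "indicator (Q m e) (of_int m * pi + e * x) = (indicator {0..pi/2} x :: ennreal)" for x
        using e by (auto simp: Q_def indicator_def)
      then show ?thesis using e by (auto simp: inv_sqrt_sin_reflect[OF e])
    qed
    finally show ?thesis using inv_sqrt_sin_quarter by simp
  qed
  have sub: "{u..u+pi} \<subseteq> Q k 1 \<union> Q (k + 1) (- 1) \<union> Q (k + 1) 1 \<union> Q (k + 2) (- 1)"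
  proof
    fix x assume x: "x \<in> {u..u+pi}"
    show "x \<in> Q k 1 \<union> Q (k + 1) (- 1) \<union> Q (k + 1) 1 \<union> Q (k + 2) (- 1)"
      unfolding Q_def Un_iff mem_Collect_eq using x k by (simp add: distrib_right) linarith
  qed
  have "(\<integral>\<^sup>+x. inv_sqrt_sin x * indicator {u..u+pi} x \<partial>lborel) \<le>
     (\<integral>\<^sup>+x. inv_sqrt_sin x * indicator (Q k 1) x + inv_sqrt_sin x * indicator (Q (k + 1) (- 1)) x
        + inv_sqrt_sin x * indicator (Q (k + 1) 1) x + inv_sqrt_sin x * indicator (Q (k + 2) (- 1)) x \<partial>lborel)"
    using sub by (intro nn_integral_mono) (auto split: split_indicator)
  also have "\<dots> = (\<integral>\<^sup>+x. inv_sqrt_sin x * indicator (Q k 1) x \<partial>lborel) + (\<integral>\<^sup>+x. inv_sqrt_sin x * indicator (Q (k + 1) (- 1)) x \<partial>lborel)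
     + (\<integral>\<^sup>+x. inv_sqrt_sin x * indicator (Q (k + 1) 1) x \<partial>lborel) + (\<integral>\<^sup>+x. inv_sqrt_sin x * indicator (Q (k + 2) (- 1)) x \<partial>lborel)"
    by (simp add: nn_integral_add)
  also have "\<dots> \<le> 4 + 4 + 4 + 4" by (intro add_mono int) auto
  finally show ?thesis by simp
qed

text \<open>For \<open>\<bar>u - y\<bar> \<le> h\<close> one has \<open>u\<^sup>2 \<le> 2 y\<^sup>2 + 2 h\<^sup>2\<close>, so the normal density with twice the variance
  dominates, on the whole interval \<open>[y - h, y]\<close>, a multiple of the standard normal density at \<open>y\<close>.\<close>

lemma std_normal_density_le_average:
  assumes h: "h > 0"
  shows "ennreal (std_normal_density y) \<le>
    ennreal (sqrt 2 * exp (h\<^sup>2 / 2) / h) * (\<integral>\<^sup>+u. ennreal (normal_density 0 (sqrt 2) u) * indicator {y - h..y} u \<partial>lborel)"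
proof -
  let ?c = "exp (- (h\<^sup>2 / 2)) / sqrt 2 * std_normal_density y"
  have le: "?c \<le> normal_density 0 (sqrt 2) u" if "u \<in> {y - h..y}" for u
  proof -
    have "\<bar>u - y\<bar> \<le> \<bar>h\<bar>" using that h by auto
    then have "(u - y)\<^sup>2 \<le> h\<^sup>2" by (simp add: abs_le_square_iff)
    moreover have "u\<^sup>2 \<le> 2 * y\<^sup>2 + 2 * (u - y)\<^sup>2"
      using zero_le_power2[of "u - 2 * y"] by (simp add: power2_eq_square algebra_simps)
    ultimately have "- (h\<^sup>2 / 2) - y\<^sup>2 / 2 \<le> - (u\<^sup>2 / 4)" by linarith
    then have e: "exp (- (h\<^sup>2 / 2)) * exp (- y\<^sup>2 / 2) \<le> exp (- (u\<^sup>2 / 4))" by (simp flip: exp_add)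
    have "normal_density 0 (sqrt 2) u = 1 / (sqrt 2 * sqrt (2 * pi)) * exp (- (u\<^sup>2 / 4))"
      by (simp add: normal_density_def real_sqrt_mult)
    moreover have "?c = 1 / (sqrt 2 * sqrt (2 * pi)) * (exp (- (h\<^sup>2 / 2)) * exp (- y\<^sup>2 / 2))"
      by (simp add: std_normal_density_def)
    ultimately show ?thesis using mult_left_mono[OF e, of "1 / (sqrt 2 * sqrt (2 * pi))"] by simp
  qed
  have "ennreal (?c * h) = ennreal ?c * ennreal h"
    using h by (intro ennreal_mult) auto
  also have "\<dots> = (\<integral>\<^sup>+u. ennreal ?c * indicator {y - h..y} u \<partial>lborel)"
    using h by (subst nn_integral_cmult_indicator) auto
  also have "\<dots> \<le> (\<integral>\<^sup>+u. ennreal (normal_density 0 (sqrt 2) u) * indicator {y - h..y} u \<partial>lborel)"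
    using le by (intro nn_integral_mono) (auto split: split_indicator intro: ennreal_leI)
  finally have le2: "ennreal (sqrt 2 * exp (h\<^sup>2 / 2) / h) * ennreal (?c * h) \<le> ennreal (sqrt 2 * exp (h\<^sup>2 / 2) / h) * (\<integral>\<^sup>+u. ennreal (normal_density 0 (sqrt 2) u) * indicator {y - h..y} u \<partial>lborel)"
    by (rule mult_left_mono) simp
  have "std_normal_density y = sqrt 2 * exp (h\<^sup>2 / 2) / h * (?c * h)"
    using h by (simp add: exp_minus field_simps)
  then have "ennreal (std_normal_density y) = ennreal (sqrt 2 * exp (h\<^sup>2 / 2) / h * (?c * h))"
    by (rule arg_cong)
  also have "\<dots> = ennreal (sqrt 2 * exp (h\<^sup>2 / 2) / h) * ennreal (?c * h)"
    using h by (intro ennreal_mult) auto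
  finally show ?thesis using le2 by (simp only:)
qed

text \<open>Averaging the density over one period \<open>h = \<pi> / \<bar>a\<bar>\<close> and exchanging integrals leaves the integral of a
  periodic function over a period, uniformly in the shift \<open>\<psi>\<close>.\<close>

lemma inv_sqrt_sin_normal:
  assumes a: "a \<noteq> 0"
  shows "(\<integral>\<^sup>+y. inv_sqrt_sin (a * y - \<psi>) \<partial>std_normal_distribution) \<le> ennreal (16 * exp ((pi / a)\<^sup>2 / 2))"
proof -
  define h where "h = pi / \<bar>a\<bar>"
  have h: "h > 0" using a by (simp add: h_def)
  have ah: "\<bar>a\<bar> * h = pi" using a by (simp add: h_def)
  let ?F = "\<lambda>y. inv_sqrt_sin (a * y - \<psi>)"
  let ?\<nu> = "normal_density 0 (sqrt 2)"
  let ?k = "sqrt 2 * exp (h\<^sup>2 / 2) / h"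
  have inner: "(\<integral>\<^sup>+y. ?F y * indicator {u..u+h} y \<partial>lborel) \<le> ennreal (16 / \<bar>a\<bar>)" for u
  proof -
    define v where "v = (if a > 0 then a * u - \<psi> else a * (u + h) - \<psi>)"
    have sub: "a * y - \<psi> \<in> {v..v+pi}" if "y \<in> {u..u+h}" for y
    proof (cases "a > 0")
      case True
      have "a * u \<le> a * y" "a * y \<le> a * (u + h)" using that True by auto
      then show ?thesis using True ah by (simp add: v_def distrib_left)
    next
      case False
      then have "a * (u + h) \<le> a * y" "a * y \<le> a * u" using that by (auto intro: mult_left_mono_neg)
      moreover have "v = a * (u + h) - \<psi>" "a * (u + h) = a * u - pi"
        using False ah a by (simp_all add: v_def distrib_left)
      ultimately show ?thesis unfolding atLeastAtMost_iff by linarith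
    qed
    have "ennreal \<bar>a\<bar> * (\<integral>\<^sup>+y. ?F y * indicator {u..u+h} y \<partial>lborel) \<le>
       ennreal \<bar>a\<bar> * (\<integral>\<^sup>+y. inv_sqrt_sin (- \<psi> + a * y) * indicator {v..v+pi} (- \<psi> + a * y) \<partial>lborel)"
      using sub by (intro mult_left_mono nn_integral_mono) (auto split: split_indicator)
    also have "\<dots> = (\<integral>\<^sup>+x. inv_sqrt_sin x * indicator {v..v+pi} x \<partial>lborel)"
      by (rule nn_integral_real_affine[symmetric]) (use a in auto)
    also have "\<dots> \<le> 16" by (rule inv_sqrt_sin_period)
    finally have "ennreal (1 / \<bar>a\<bar>) * (ennreal \<bar>a\<bar> * (\<integral>\<^sup>+y. ?F y * indicator {u..u+h} y \<partial>lborel)) \<le> ennreal (1 / \<bar>a\<bar>) * 16"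
      by (rule mult_left_mono) simp
    moreover have "ennreal (1 / \<bar>a\<bar>) * ennreal \<bar>a\<bar> = 1" using a by (simp flip: ennreal_mult')
    moreover have "ennreal (1 / \<bar>a\<bar>) * 16 = ennreal (16 / \<bar>a\<bar>)"
      by (simp flip: ennreal_numeral ennreal_mult')
    ultimately show ?thesis by (simp flip: mult.assoc)
  qed
  have "(\<integral>\<^sup>+y. ?F y \<partial>std_normal_distribution) = (\<integral>\<^sup>+y. ennreal (std_normal_density y) * ?F y \<partial>lborel)"
    by (rule nn_integral_density) auto
  also have "\<dots> \<le> (\<integral>\<^sup>+y. (ennreal ?k * (\<integral>\<^sup>+u. ennreal (?\<nu> u) * indicator {y - h..y} u \<partial>lborel)) * ?F y \<partial>lborel)"
    by (intro nn_integral_mono mult_right_mono std_normal_density_le_average h) simp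
  also have "\<dots> = ennreal ?k * (\<integral>\<^sup>+y. (\<integral>\<^sup>+u. ennreal (?\<nu> u) * indicator {0..h} (y - u) * ?F y \<partial>lborel) \<partial>lborel)"
  proof -
    have eq: "(ennreal ?k * (\<integral>\<^sup>+u. ennreal (?\<nu> u) * indicator {y - h..y} u \<partial>lborel)) * ?F y =
      ennreal ?k * (\<integral>\<^sup>+u. ennreal (?\<nu> u) * indicator {0..h} (y - u) * ?F y \<partial>lborel)" for y
    proof -
      have "(\<integral>\<^sup>+u. ennreal (?\<nu> u) * indicator {y - h..y} u \<partial>lborel) * ?F y = (\<integral>\<^sup>+u. ennreal (?\<nu> u) * indicator {y - h..y} u * ?F y \<partial>lborel)"
        by (rule nn_integral_multc[symmetric]) simp
      also have "\<dots> = (\<integral>\<^sup>+u. ennreal (?\<nu> u) * indicator {0..h} (y - u) * ?F y \<partial>lborel)"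
        by (intro nn_integral_cong) (auto split: split_indicator)
      finally show ?thesis by (simp add: mult.assoc)
    qed
    show ?thesis unfolding eq by (rule nn_integral_cmult) measurable
  qed
  also have "(\<integral>\<^sup>+y. (\<integral>\<^sup>+u. ennreal (?\<nu> u) * indicator {0..h} (y - u) * ?F y \<partial>lborel) \<partial>lborel)
     = (\<integral>\<^sup>+u. (\<integral>\<^sup>+y. ennreal (?\<nu> u) * indicator {0..h} (y - u) * ?F y \<partial>lborel) \<partial>lborel)"
    by (rule lborel_pair.Fubini') auto
  also have "\<dots> = (\<integral>\<^sup>+u. ennreal (?\<nu> u) * (\<integral>\<^sup>+y. ?F y * indicator {u..u+h} y \<partial>lborel) \<partial>lborel)"
  proof (intro nn_integral_cong)
    fix u
    have "(\<integral>\<^sup>+y. ennreal (?\<nu> u) * indicator {0..h} (y - u) * ?F y \<partial>lborel) = (\<integral>\<^sup>+y. ennreal (?\<nu> u) * (?F y * indicator {u..u+h} y) \<partial>lborel)"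
      by (intro nn_integral_cong) (auto split: split_indicator)
    also have "\<dots> = ennreal (?\<nu> u) * (\<integral>\<^sup>+y. ?F y * indicator {u..u+h} y \<partial>lborel)"
      by (rule nn_integral_cmult) measurable
    finally show "(\<integral>\<^sup>+y. ennreal (?\<nu> u) * indicator {0..h} (y - u) * ?F y \<partial>lborel) = ennreal (?\<nu> u) * (\<integral>\<^sup>+y. ?F y * indicator {u..u+h} y \<partial>lborel)" .
  qed
  also have "\<dots> \<le> (\<integral>\<^sup>+u. ennreal (?\<nu> u) * ennreal (16 / \<bar>a\<bar>) \<partial>lborel)"
    by (intro nn_integral_mono mult_left_mono inner) simp
  also have "\<dots> = (\<integral>\<^sup>+u. ennreal (?\<nu> u) \<partial>lborel) * ennreal (16 / \<bar>a\<bar>)"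
    by (rule nn_integral_multc) simp
  also have "(\<integral>\<^sup>+u. ennreal (?\<nu> u) \<partial>lborel) = 1"
    by (subst nn_integral_eq_integral) auto
  finally have "(\<integral>\<^sup>+y. ?F y \<partial>std_normal_distribution) \<le> ennreal ?k * ennreal (16 / \<bar>a\<bar>)"
    by (simp add: mult_left_mono)
  also have "\<dots> = ennreal (?k * (16 / \<bar>a\<bar>))" using h by (simp flip: ennreal_mult')
  also have "\<dots> \<le> ennreal (16 * exp (h\<^sup>2 / 2))"
  proof (rule ennreal_leI)
    have "sqrt 2 \<le> 2" by (intro real_le_lsqrt) auto
    then have "sqrt 2 / pi \<le> 1" using pi_gt3 by simp
    then have "16 * exp (h\<^sup>2 / 2) * (sqrt 2 / pi) \<le> 16 * exp (h\<^sup>2 / 2) * 1" by (intro mult_left_mono) auto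
    moreover have "?k * (16 / \<bar>a\<bar>) = 16 * exp (h\<^sup>2 / 2) * (sqrt 2 / pi)" using a by (simp add: h_def)
    ultimately show "?k * (16 / \<bar>a\<bar>) \<le> 16 * exp (h\<^sup>2 / 2)" by simp
  qed
  finally show ?thesis by (simp add: h_def power_divide)
qed

text \<open>The right-hand side is the distance of \<open>R * cis \<theta>\<close> from the line through \<open>0\<close> in the direction \<open>Arg z\<close>,
  which contains \<open>- z\<close>.\<close>

lemma norm_add_ge_sin:
  "norm (of_real R * cis \<theta> + z) \<ge> \<bar>R * sin (\<theta> - Arg z)\<bar>"
proof -
  have "z = of_real (norm z) * cis (Arg z)"
    using rcis_cmod_Arg[of z] by (simp add: rcis_def)
  then have "z * cis (- Arg z) = (of_real (norm z) * cis (Arg z)) * cis (- Arg z)"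
    by (rule arg_cong[where f="\<lambda>w. w * cis (- Arg z)"])
  then have "(of_real R * cis \<theta> + z) * cis (- Arg z) = of_real R * (cis \<theta> * cis (- Arg z)) + of_real (norm z) * (cis (Arg z) * cis (- Arg z))"
    by (simp only: distrib_right mult.assoc)
  also have "\<dots> = of_real R * cis (\<theta> - Arg z) + of_real (norm z)" by (simp add: cis_mult)
  finally have "Im ((of_real R * cis \<theta> + z) * cis (- Arg z)) = R * sin (\<theta> - Arg z)" by simp
  then have "\<bar>R * sin (\<theta> - Arg z)\<bar> \<le> norm ((of_real R * cis \<theta> + z) * cis (- Arg z))"
    by (metis abs_Im_le_cmod)
  then show ?thesis by (simp add: norm_mult)
qed

section \<open>Exponential moments of the logarithm\<close>

context gaussian_sample
begin

lemma nn_exp_X: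
  assumes "k \<ge> 1"
  shows "(\<integral>\<^sup>+\<omega>. ennreal (exp (c * X k \<omega>)) \<partial>M) = ennreal (exp (c\<^sup>2 / 2))"
  using exp_X[OF assms, of c] by (subst nn_integral_eq_integral) auto

lemma weight_polar: "weight (\<sigma>, \<tau>) N (x, y) = of_real (exp (sqrt (ln N) * \<sigma> * x)) * cis (sqrt (ln N) * \<tau> * y)"
  by (simp add: weight_def distrib_left exp_add cis_conv_exp mult_ac flip: exp_of_real)

text \<open>The bound \<open>\<bar>W + z\<bar> \<ge> \<bar>W\<bar> * \<bar>sin (phase - Arg z)\<bar>\<close> separates size and phase by \<open>a b \<le> a\<^sup>2 + b\<^sup>2\<close>. The
  size contributes a normal exponential moment of bounded order, and the power \<open>- 2 / n\<close> of
  the sine is at most the power \<open>- 1 / 2\<close> when \<open>n \<ge> 4\<close>.\<close>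

lemma shifted_weight_negative_moment:
  assumes \<tau>: "\<tau> \<noteq> 0" and N: "4 \<le> ln (real N)"
  shows "(\<integral>\<^sup>+\<omega>. ennreal (norm (weight (\<sigma>, \<tau>) N (X 1 \<omega>, Y 1 \<omega>) + z) powr (- 1 / ln N)) \<partial>M)
     \<le> ennreal (exp (2 * \<sigma>\<^sup>2) + 16 * exp ((pi / \<tau>)\<^sup>2 / 2))"
proof -
  define n where "n = ln (real N)"
  define r where "r = sqrt n"
  define s where "s = 1 / n"
  have n: "n \<ge> 4" using N by (simp add: n_def)
  have r: "r \<ge> 1" "r * r = n" using n by (auto simp: r_def)
  have s: "0 < s" "2 * s \<le> 1 / 2" using n by (auto simp: s_def field_simps)
  note [measurable] = measurable_X[OF order_refl] measurable_Y[OF order_refl]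
  have pw: "ennreal (norm (weight (\<sigma>, \<tau>) N (X 1 \<omega>, Y 1 \<omega>) + z) powr (- s)) \<le>
      ennreal (exp ((- 2 * s * r * \<sigma>) * X 1 \<omega>)) + inv_sqrt_sin (r * \<tau> * Y 1 \<omega> - Arg z)" for \<omega>
  proof (cases "sin (r * \<tau> * Y 1 \<omega> - Arg z) = 0")
    case True
    then show ?thesis by (simp add: inv_sqrt_sin_def)
  next
    case False
    define E where "E = exp (r * \<sigma> * X 1 \<omega>)"
    define q where "q = \<bar>sin (r * \<tau> * Y 1 \<omega> - Arg z)\<bar>"
    have q: "0 < q" "q \<le> 1" using False by (auto simp: q_def)
    have E: "E > 0" by (simp add: E_def)
    have "E * q \<le> norm (weight (\<sigma>, \<tau>) N (X 1 \<omega>, Y 1 \<omega>) + z)"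
      using norm_add_ge_sin[of E "r * \<tau> * Y 1 \<omega>" z] E unfolding weight_polar E_def q_def r_def n_def by (simp add: abs_mult)
    then have "norm (weight (\<sigma>, \<tau>) N (X 1 \<omega>, Y 1 \<omega>) + z) powr (- s) \<le> (E * q) powr (- s)"
      using E q s by (intro powr_mono2') auto
    also have "\<dots> = E powr (- s) * q powr (- s)" using E q by (simp add: powr_mult)
    also have "\<dots> \<le> E powr (- 2 * s) + q powr (- 2 * s)"
    proof -
      have "2 * (E powr (- s) * q powr (- s)) \<le> (E powr (- s))\<^sup>2 + (q powr (- s))\<^sup>2"
        using zero_le_power2[of "E powr (- s) - q powr (- s)"] by (simp add: power2_eq_square algebra_simps)
      moreover have "0 \<le> E powr (- s) * q powr (- s)" by simp
      ultimately have "E powr (- s) * q powr (- s) \<le> (E powr (- s))\<^sup>2 + (q powr (- s))\<^sup>2" by linarith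
      then show ?thesis using E q by (simp add: power2_eq_square flip: powr_add)
    qed
    also have "q powr (- 2 * s) \<le> q powr (- 1 / 2)" using q s by (intro powr_mono') auto
    also have "E powr (- 2 * s) = exp ((- 2 * s * r * \<sigma>) * X 1 \<omega>)"
      by (simp add: E_def powr_def mult_ac)
    finally have "norm (weight (\<sigma>, \<tau>) N (X 1 \<omega>, Y 1 \<omega>) + z) powr (- s) \<le> exp ((- 2 * s * r * \<sigma>) * X 1 \<omega>) + q powr (- 1 / 2)"
      by simp
    then show ?thesis using False by (simp add: inv_sqrt_sin_def q_def ennreal_leI flip: ennreal_plus)
  qed
  have "(\<integral>\<^sup>+\<omega>. ennreal (norm (weight (\<sigma>, \<tau>) N (X 1 \<omega>, Y 1 \<omega>) + z) powr (- s)) \<partial>M) \<le>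
     (\<integral>\<^sup>+\<omega>. ennreal (exp ((- 2 * s * r * \<sigma>) * X 1 \<omega>)) + inv_sqrt_sin (r * \<tau> * Y 1 \<omega> - Arg z) \<partial>M)"
    by (intro nn_integral_mono pw)
  also have "\<dots> = (\<integral>\<^sup>+\<omega>. ennreal (exp ((- 2 * s * r * \<sigma>) * X 1 \<omega>)) \<partial>M) + (\<integral>\<^sup>+\<omega>. inv_sqrt_sin (r * \<tau> * Y 1 \<omega> - Arg z) \<partial>M)"
    by (rule nn_integral_add) measurable
  also have "(\<integral>\<^sup>+\<omega>. ennreal (exp ((- 2 * s * r * \<sigma>) * X 1 \<omega>)) \<partial>M) = ennreal (exp ((- 2 * s * r * \<sigma>)\<^sup>2 / 2))"
    by (rule nn_exp_X) simp
  also have "(- 2 * s * r * \<sigma>)\<^sup>2 / 2 = 2 * \<sigma>\<^sup>2 * s"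
    using r n by (simp add: power2_eq_square s_def field_simps)
  also have "2 * \<sigma>\<^sup>2 * s \<le> 2 * \<sigma>\<^sup>2 * 1" using s by (intro mult_left_mono) auto
  then have "ennreal (exp (2 * \<sigma>\<^sup>2 * s)) \<le> ennreal (exp (2 * \<sigma>\<^sup>2))" by (intro ennreal_leI) simp
  also have "(\<integral>\<^sup>+\<omega>. inv_sqrt_sin (r * \<tau> * Y 1 \<omega> - Arg z) \<partial>M) = (\<integral>\<^sup>+y. inv_sqrt_sin (r * \<tau> * y - Arg z) \<partial>distr M borel (Y 1))"
    by (rule nn_integral_distr[symmetric]) measurable
  also have "distr M borel (Y 1) = std_normal_distribution"
    using law_Y[of 1] by (simp add: normal_law_def)
  also have "(\<integral>\<^sup>+y. inv_sqrt_sin (r * \<tau> * y - Arg z) \<partial>std_normal_distribution) \<le> ennreal (16 * exp ((pi / (r * \<tau>))\<^sup>2 / 2))"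
    by (rule inv_sqrt_sin_normal) (use r \<tau> in auto)
  also have "(pi / (r * \<tau>))\<^sup>2 = (pi / \<tau>)\<^sup>2 / r\<^sup>2" by (simp add: power_divide power_mult_distrib field_simps)
  also have "\<dots> \<le> (pi / \<tau>)\<^sup>2 / 1" using r n by (intro divide_left_mono) (auto simp: power2_eq_square)
  then have "ennreal (16 * exp ((pi / \<tau>)\<^sup>2 / r\<^sup>2 / 2)) \<le> ennreal (16 * exp ((pi / \<tau>)\<^sup>2 / 2))"
    by (intro ennreal_leI) simp
  finally have "(\<integral>\<^sup>+\<omega>. ennreal (norm (weight (\<sigma>, \<tau>) N (X 1 \<omega>, Y 1 \<omega>) + z) powr (- s)) \<partial>M) \<le> ennreal (exp (2 * \<sigma>\<^sup>2)) + ennreal (16 * exp ((pi / \<tau>)\<^sup>2 / 2))"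
    by (simp add: add_mono)
  then show ?thesis by (simp add: s_def n_def)
qed

text \<open>Condition on all summands but the first: the bound of the previous lemma holds uniformly in
  their sum \<open>z\<close>. For \<open>\<tau> = 0\<close> the first summand is a lower bound for the modulus.\<close>

lemma partition_fn_negative_moment:
  assumes N: "4 \<le> ln (real N)"
  shows "(\<integral>\<^sup>+\<omega>. ennreal (norm (partition_fn X Y N (\<sigma>, \<tau>) \<omega>) powr (- 1 / ln N)) \<partial>M)
     \<le> ennreal (exp (2 * \<sigma>\<^sup>2) + 16 * exp ((pi / \<tau>)\<^sup>2 / 2))"
proof (cases "\<tau> = 0")
  case True
  have N1: "N \<ge> 1" using N by (cases N) auto
  define n where "n = ln (real N)"
  define r where "r = sqrt n"
  have n: "n \<ge> 4" using N by (simp add: n_def)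
  have r: "r * r = n" using n by (auto simp: r_def)
  have pw: "norm (partition_fn X Y N (\<sigma>, \<tau>) \<omega>) powr (- 1 / n) \<le> exp ((- 1 / n * r * \<sigma>) * X 1 \<omega>)" for \<omega>
  proof -
    have eq: "partition_fn X Y N (\<sigma>, \<tau>) \<omega> = of_real (\<Sum>k=1..N. exp (r * \<sigma> * X k \<omega>))"
      unfolding partition_fn_eq of_real_sum by (intro sum.cong refl) (simp add: weight_polar True r_def n_def)
    have "exp (r * \<sigma> * X 1 \<omega>) \<le> (\<Sum>k=1..N. exp (r * \<sigma> * X k \<omega>))"
      using N1 by (intro member_le_sum) auto
    also have "\<dots> = norm (partition_fn X Y N (\<sigma>, \<tau>) \<omega>)"
      unfolding eq norm_of_real by (rule abs_of_nonneg[symmetric]) (simp add: sum_nonneg)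
    finally have "norm (partition_fn X Y N (\<sigma>, \<tau>) \<omega>) powr (- 1 / n) \<le> exp (r * \<sigma> * X 1 \<omega>) powr (- 1 / n)"
      using n by (intro powr_mono2') auto
    then show ?thesis by (simp add: powr_def mult_ac)
  qed
  have "(\<integral>\<^sup>+\<omega>. ennreal (norm (partition_fn X Y N (\<sigma>, \<tau>) \<omega>) powr (- 1 / n)) \<partial>M) \<le> (\<integral>\<^sup>+\<omega>. ennreal (exp ((- 1 / n * r * \<sigma>) * X 1 \<omega>)) \<partial>M)"
    by (intro nn_integral_mono ennreal_leI pw)
  also have "\<dots> = ennreal (exp ((- 1 / n * r * \<sigma>)\<^sup>2 / 2))" by (rule nn_exp_X) simp
  also have "(- 1 / n * r * \<sigma>)\<^sup>2 / 2 = \<sigma>\<^sup>2 * (1 / (2 * n))"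
    using r n by (simp add: power2_eq_square field_simps)
  also have "ennreal (exp (\<sigma>\<^sup>2 * (1 / (2 * n)))) \<le> ennreal (exp (2 * \<sigma>\<^sup>2) + 16 * exp ((pi / \<tau>)\<^sup>2 / 2))"
  proof (rule ennreal_leI)
    have "\<sigma>\<^sup>2 * (1 / (2 * n)) \<le> \<sigma>\<^sup>2 * 2" using n by (intro mult_left_mono) (auto simp: field_simps)
    then have "exp (\<sigma>\<^sup>2 * (1 / (2 * n))) \<le> exp (2 * \<sigma>\<^sup>2)" by simp
    then show "exp (\<sigma>\<^sup>2 * (1 / (2 * n))) \<le> exp (2 * \<sigma>\<^sup>2) + 16 * exp ((pi / \<tau>)\<^sup>2 / 2)"
      by (rule order_trans) simp
  qed
  finally show ?thesis by (simp add: n_def)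
next
  case False
  have N1: "N \<ge> 1" using N by (cases N) auto
  define K where "K = ennreal (exp (2 * \<sigma>\<^sup>2) + 16 * exp ((pi / \<tau>)\<^sup>2 / 2))"
  define P where "P \<omega> = (X 1 \<omega>, Y 1 \<omega>)" for \<omega>
  define W where "W f = (\<Sum>k\<in>{2..N}. weight (\<sigma>, \<tau>) N (f k))" for f
  \<comment> \<open>The sum of the other summands, as a pair of reals, so that it takes values in the same space as \<open>P\<close>.\<close>
  define R where "R \<omega> = (Re (W (\<lambda>k. (X k \<omega>, Y k \<omega>))), Im (W (\<lambda>k. (X k \<omega>, Y k \<omega>))))" for \<omega>
  have [measurable]: "W \<in> borel_measurable (Pi\<^sub>M {2..N} (\<lambda>_. borel))"
    unfolding W_def by (intro borel_measurable_sum measurable_compose[OF _ weight_measurable] measurable_component_singleton)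
  have "(\<lambda>\<omega>. W (\<lambda>k. (X k \<omega>, Y k \<omega>))) \<in> borel_measurable M"
    unfolding W_def by (intro borel_measurable_sum) auto
  note [measurable] = this
  have [measurable]: "P \<in> borel_measurable M" unfolding P_def by measurable
  have [measurable]: "R \<in> borel_measurable M" unfolding R_def by measurable
  have ind: "indep_var borel P borel R"
  proof -
    have "indep_var borel ((\<lambda>f. f 1) \<circ> (\<lambda>\<omega>. restrict (\<lambda>i. (X i \<omega>, Y i \<omega>)) {1}))
        borel ((\<lambda>f. (Re (W f), Im (W f))) \<circ> (\<lambda>\<omega>. restrict (\<lambda>i. (X i \<omega>, Y i \<omega>)) {2..N}))"
    proof (rule indep_var_compose[OF indep_var_restrict[OF indep_pairs]])
      show "(\<lambda>f. f 1) \<in> Pi\<^sub>M {1} (\<lambda>_. borel) \<rightarrow>\<^sub>M (borel :: (real \<times> real) measure)"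
        by (rule measurable_component_singleton) simp
      show "(\<lambda>f. (Re (W f), Im (W f))) \<in> Pi\<^sub>M {2..N} (\<lambda>_. borel) \<rightarrow>\<^sub>M borel" by measurable
    qed auto
    also have "((\<lambda>f. f 1) \<circ> (\<lambda>\<omega>. restrict (\<lambda>i. (X i \<omega>, Y i \<omega>)) {1})) = P"
      by (auto simp: P_def)
    also have "((\<lambda>f. (Re (W f), Im (W f))) \<circ> (\<lambda>\<omega>. restrict (\<lambda>i. (X i \<omega>, Y i \<omega>)) {2..N})) = R"
      by (auto simp: R_def W_def)
    finally show ?thesis .
  qed
  interpret PP: prob_space "distr M borel P" by (rule prob_space_distr) simp
  interpret PR: prob_space "distr M borel R" by (rule prob_space_distr) simp
  interpret PPR: pair_prob_space "distr M borel P" "distr M borel R" ..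
  define Ez :: "real \<times> real \<Rightarrow> complex" where "Ez q = of_real (fst q) + \<i> * of_real (snd q)" for q
  have [measurable]: "Ez \<in> borel_measurable borel"
    unfolding Ez_def by (intro borel_measurable_continuous_onI continuous_intros)
  define f where "f = (\<lambda>(p, q). ennreal (norm (weight (\<sigma>, \<tau>) N p + Ez q) powr (- 1 / ln N)))"
  have f[measurable]: "f \<in> borel_measurable (borel \<Otimes>\<^sub>M borel)" unfolding f_def by measurable
  have Z: "partition_fn X Y N (\<sigma>, \<tau>) \<omega> = weight (\<sigma>, \<tau>) N (P \<omega>) + Ez (R \<omega>)" for \<omega>
  proof -
    have "{1..N} = insert 1 {2..N}" using N1 by auto
    then have "partition_fn X Y N (\<sigma>, \<tau>) \<omega> = weight (\<sigma>, \<tau>) N (P \<omega>) + W (\<lambda>k. (X k \<omega>, Y k \<omega>))"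
      unfolding partition_fn_eq P_def W_def by simp
    then show ?thesis by (simp add: R_def Ez_def complex_eq_iff)
  qed
  have "(\<integral>\<^sup>+\<omega>. ennreal (norm (partition_fn X Y N (\<sigma>, \<tau>) \<omega>) powr (- 1 / ln N)) \<partial>M) = (\<integral>\<^sup>+\<omega>. f (P \<omega>, R \<omega>) \<partial>M)"
    by (simp add: Z f_def)
  also have "\<dots> = (\<integral>\<^sup>+v. f v \<partial>distr M (borel \<Otimes>\<^sub>M borel) (\<lambda>\<omega>. (P \<omega>, R \<omega>)))"
    by (rule nn_integral_distr[symmetric]) measurable
  also have "distr M (borel \<Otimes>\<^sub>M borel) (\<lambda>\<omega>. (P \<omega>, R \<omega>)) = distr M borel P \<Otimes>\<^sub>M distr M borel R"
    using ind unfolding indep_var_distribution_eq by simp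
  also have "(\<integral>\<^sup>+v. f v \<partial>(distr M borel P \<Otimes>\<^sub>M distr M borel R)) = (\<integral>\<^sup>+q. (\<integral>\<^sup>+p. f (p, q) \<partial>distr M borel P) \<partial>distr M borel R)"
    by (rule PPR.nn_integral_snd[symmetric]) simp
  also have "\<dots> \<le> (\<integral>\<^sup>+q. K \<partial>distr M borel R)"
  proof (rule nn_integral_mono)
    fix q
    have "(\<integral>\<^sup>+p. f (p, q) \<partial>distr M borel P) = (\<integral>\<^sup>+\<omega>. f (P \<omega>, q) \<partial>M)"
      by (rule nn_integral_distr) measurable
    also have "\<dots> \<le> K"
      using shifted_weight_negative_moment[OF False N, of \<sigma> "Ez q"] by (simp add: f_def P_def K_def)
    finally show "(\<integral>\<^sup>+p. f (p, q) \<partial>distr M borel P) \<le> K" .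
  qed
  also have "\<dots> = K" using PR.emeasure_space_1 by simp
  finally show ?thesis by (simp add: K_def)
qed

text \<open>With \<open>m\<close> an upper bound for the expectation of \<open>\<bar>Z\<bar>\<close>, use \<open>t powr (1 / n) \<le> 1 + t\<close> for \<open>t = \<bar>Z\<bar> / m\<close>.\<close>

lemma partition_fn_positive_moment:
  assumes N: "1 \<le> ln (real N)"
  shows "(\<integral>\<^sup>+\<omega>. ennreal (norm (partition_fn X Y N (\<sigma>, \<tau>) \<omega>) powr (1 / ln N)) \<partial>M) \<le> ennreal (2 * exp (1 + \<sigma>\<^sup>2 / 2))"
proof -
  have N1: "N \<ge> 1" using N by (cases N) auto
  define n where "n = ln (real N)"
  define r where "r = sqrt n"
  have n: "n \<ge> 1" "real N = exp n" using N N1 by (auto simp: n_def)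
  have r: "r * r = n" using n by (auto simp: r_def)
  define m where "m = exp (n * (1 + \<sigma>\<^sup>2 / 2))"
  define b where "b = exp (1 + \<sigma>\<^sup>2 / 2)"
  have m: "m > 0" by (simp add: m_def)
  have mb: "m powr (1 / n) = b" using n by (simp add: m_def b_def powr_def)
  let ?Z = "\<lambda>\<omega>. norm (partition_fn X Y N (\<sigma>, \<tau>) \<omega>)"
  have pw: "?Z \<omega> powr (1 / n) \<le> b + (b / m) * (\<Sum>k=1..N. exp (r * \<sigma> * X k \<omega>))" for \<omega>
  proof -
    have "?Z \<omega> \<le> (\<Sum>k=1..N. norm (weight (\<sigma>, \<tau>) N (X k \<omega>, Y k \<omega>)))"
      unfolding partition_fn_eq by (rule norm_sum)
    also have "\<dots> = (\<Sum>k=1..N. exp (r * \<sigma> * X k \<omega>))" by (simp add: norm_weight r_def n_def)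
    finally have le: "?Z \<omega> \<le> (\<Sum>k=1..N. exp (r * \<sigma> * X k \<omega>))" .
    have "(?Z \<omega> / m) powr (1 / n) \<le> 1 + ?Z \<omega> / m"
    proof (cases "?Z \<omega> / m \<le> 1")
      case True
      then have "(?Z \<omega> / m) powr (1 / n) \<le> 1 powr (1 / n)" using m n by (intro powr_mono2) auto
      then show ?thesis using m by (simp add: add_increasing2)
    next
      case False
      then have "(?Z \<omega> / m) powr (1 / n) \<le> (?Z \<omega> / m) powr 1" using n by (intro powr_mono) auto
      then show ?thesis using False by simp
    qed
    then have "b * (?Z \<omega> / m) powr (1 / n) \<le> b * (1 + ?Z \<omega> / m)"
      by (rule mult_left_mono) (simp add: b_def)
    moreover have "b * (?Z \<omega> / m) powr (1 / n) = ?Z \<omega> powr (1 / n)"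
      using m by (simp add: powr_divide mb b_def)
    ultimately have "?Z \<omega> powr (1 / n) \<le> b + (b / m) * ?Z \<omega>" by (simp add: algebra_simps)
    also have "(b / m) * ?Z \<omega> \<le> (b / m) * (\<Sum>k=1..N. exp (r * \<sigma> * X k \<omega>))"
      using le m by (intro mult_left_mono) (auto simp: b_def)
    finally show ?thesis by simp
  qed
  have iS: "integrable M (\<lambda>\<omega>. \<Sum>k=1..N. exp (r * \<sigma> * X k \<omega>))"
    by (intro Bochner_Integration.integrable_sum exp_X) auto
  have "expectation (\<lambda>\<omega>. \<Sum>k=1..N. exp (r * \<sigma> * X k \<omega>)) = (\<Sum>k=1..N. expectation (\<lambda>\<omega>. exp (r * \<sigma> * X k \<omega>)))"
    by (intro Bochner_Integration.integral_sum exp_X) auto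
  also have "\<dots> = (\<Sum>k=1..N. exp ((r * \<sigma>)\<^sup>2 / 2))" by (intro sum.cong refl exp_X) auto
  also have "\<dots> = exp n * exp ((r * \<sigma>)\<^sup>2 / 2)" by (simp add: n(2))
  also have "\<dots> = m" unfolding m_def exp_add[symmetric] using r
    by (simp add: power2_eq_square algebra_simps)
  finally have eS: "expectation (\<lambda>\<omega>. \<Sum>k=1..N. exp (r * \<sigma> * X k \<omega>)) = m" .
  have "(\<integral>\<^sup>+\<omega>. ennreal (?Z \<omega> powr (1 / n)) \<partial>M) \<le> (\<integral>\<^sup>+\<omega>. ennreal (b + (b / m) * (\<Sum>k=1..N. exp (r * \<sigma> * X k \<omega>))) \<partial>M)"
    by (intro nn_integral_mono ennreal_leI pw)
  also have "\<dots> = ennreal (expectation (\<lambda>\<omega>. b + (b / m) * (\<Sum>k=1..N. exp (r * \<sigma> * X k \<omega>))))"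
  proof (rule nn_integral_eq_integral)
    show "integrable M (\<lambda>\<omega>. b + (b / m) * (\<Sum>k=1..N. exp (r * \<sigma> * X k \<omega>)))" using iS by simp
  qed (intro AE_I2 order_trans[OF powr_ge_zero pw])
  also have "expectation (\<lambda>\<omega>. b + (b / m) * (\<Sum>k=1..N. exp (r * \<sigma> * X k \<omega>))) = b + (b / m) * m"
    using iS by (simp add: prob_space eS[simplified])
  also have "\<dots> = 2 * b" using m by simp
  finally show ?thesis by (simp add: b_def n_def)
qed

lemma log_partition_fn_exp_moment:
  "\<exists>K. \<forall>\<^sub>F N in sequentially. (\<integral>\<^sup>+\<omega>. ennreal (exp \<bar>log_partition_fn X Y N (\<sigma>, \<tau>) \<omega>\<bar>) \<partial>M) \<le> ennreal K"
proof -
  define K1 where "K1 = exp (2 * \<sigma>\<^sup>2) + 16 * exp ((pi / \<tau>)\<^sup>2 / 2)"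
  define K2 where "K2 = 2 * exp (1 + \<sigma>\<^sup>2 / 2)"
  have K: "K1 \<ge> 0" "K2 \<ge> 0" by (auto simp: K1_def K2_def intro!: add_nonneg_nonneg)
  have "\<forall>\<^sub>F N in sequentially. 4 \<le> ln (real N)"
    using filterlim_ln_real unfolding filterlim_at_top by blast
  then have "\<forall>\<^sub>F N in sequentially. (\<integral>\<^sup>+\<omega>. ennreal (exp \<bar>log_partition_fn X Y N (\<sigma>, \<tau>) \<omega>\<bar>) \<partial>M) \<le> ennreal (1 + K2 + K1)"
  proof eventually_elim
    case (elim N)
    let ?Z = "\<lambda>\<omega>. norm (partition_fn X Y N (\<sigma>, \<tau>) \<omega>)"
    have pw: "exp \<bar>log_partition_fn X Y N (\<sigma>, \<tau>) \<omega>\<bar> \<le> 1 + ?Z \<omega> powr (1 / ln N) + ?Z \<omega> powr (- 1 / ln N)" for \<omega>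
    proof (cases "?Z \<omega> = 0")
      case True
      then show ?thesis by (simp add: log_partition_fn_def)
    next
      case False
      define v where "v = log_partition_fn X Y N (\<sigma>, \<tau>) \<omega>"
      have "?Z \<omega> powr (1 / ln N) = exp v" "?Z \<omega> powr (- 1 / ln N) = exp (- v)"
        using False by (simp_all add: powr_def v_def log_partition_fn_def)
      moreover have "exp \<bar>v\<bar> \<le> 1 + exp v + exp (- v)"
        by (cases "v \<ge> 0") (auto simp: add_increasing2 add_increasing)
      ultimately show ?thesis by (simp add: v_def)
    qed
    have "(\<integral>\<^sup>+\<omega>. ennreal (exp \<bar>log_partition_fn X Y N (\<sigma>, \<tau>) \<omega>\<bar>) \<partial>M) \<le>
       (\<integral>\<^sup>+\<omega>. ennreal 1 + ennreal (?Z \<omega> powr (1 / ln N)) + ennreal (?Z \<omega> powr (- 1 / ln N)) \<partial>M)"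
      by (intro nn_integral_mono) (use pw in \<open>auto simp flip: ennreal_plus intro: ennreal_leI simp del: ennreal_1\<close>)
    also have "\<dots> = ennreal 1 + (\<integral>\<^sup>+\<omega>. ennreal (?Z \<omega> powr (1 / ln N)) \<partial>M) + (\<integral>\<^sup>+\<omega>. ennreal (?Z \<omega> powr (- 1 / ln N)) \<partial>M)"
      by (simp add: nn_integral_add emeasure_space_1)
    also have "\<dots> \<le> ennreal 1 + ennreal K2 + ennreal K1"
      unfolding K1_def K2_def using elim
      by (intro add_mono order_refl partition_fn_positive_moment partition_fn_negative_moment) auto
    also have "\<dots> = ennreal (1 + K2 + K1)" using K by (simp add: ennreal_plus)
    finally show ?case .
  qed
  then show ?thesis by blast
qed

end

section \<open>From probability to mean of order q\<close>

lemma powr_le_exp_const: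
  assumes "p \<ge> 0"
  shows "\<exists>K\<ge>0. \<forall>x::real. \<bar>x\<bar> powr p \<le> K * exp \<bar>x\<bar>"
proof -
  define m where "m = nat \<lceil>p\<rceil>"
  have m: "p \<le> real m" by (simp add: m_def) linarith
  have "\<bar>x\<bar> powr p \<le> (1 + fact m) * exp \<bar>x\<bar>" for x :: real
  proof (cases "\<bar>x\<bar> \<le> 1")
    case True
    then have "\<bar>x\<bar> powr p \<le> 1 powr p" using assms by (intro powr_mono2) auto
    also have "\<dots> \<le> (1 + fact m) * exp \<bar>x\<bar>"
      using mult_mono[of 1 "1 + fact m :: real" 1 "exp \<bar>x\<bar>"] by simp
    finally show ?thesis .
  next
    case False
    then have "\<bar>x\<bar> powr p \<le> \<bar>x\<bar> powr (real m)" using m by (intro powr_mono) auto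
    also have "\<dots> = \<bar>x\<bar> ^ m" using False by (simp add: powr_realpow)
    also have "\<dots> \<le> fact m * exp \<bar>x\<bar>"
    proof -
      have "\<bar>x\<bar> ^ m /\<^sub>R fact m \<le> exp \<bar>x\<bar>"
        unfolding exp_def using sum_le_suminf[OF summable_exp_generic[of "\<bar>x\<bar>"], of "{m}"] by simp
      then show ?thesis by (simp add: field_simps)
    qed
    also have "\<dots> \<le> (1 + fact m) * exp \<bar>x\<bar>" by (intro mult_right_mono) auto
    finally show ?thesis .
  qed
  then show ?thesis by (intro exI[of _ "1 + fact m"]) auto
qed

text \<open>Uniform integrability: \<open>\<bar>x\<bar> powr q\<close> is at most \<open>\<epsilon> powr q + R powr q * indicator {\<bar>x\<bar> > \<epsilon>} + \<bar>x\<bar> powr (q + 1) / R\<close>, and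
  all absolute moments are bounded by the exponential one.\<close>

lemma (in prob_space) converges_in_Lq_if_exp_moment:
  fixes f :: "nat \<Rightarrow> 'a \<Rightarrow> real"
  assumes P: "converges_in_probability M f (\<lambda>_. c)"
    and E: "\<forall>\<^sub>F N in sequentially. (\<integral>\<^sup>+\<omega>. ennreal (exp \<bar>f N \<omega>\<bar>) \<partial>M) \<le> ennreal K"
    and q: "q \<ge> 1"
  shows "converges_in_Lq M q f (\<lambda>_. c)"
proof -
  have [measurable]: "f N \<in> borel_measurable M" for N using P by (simp add: converges_in_probability_def)
  have pr: "(\<lambda>N. prob {\<omega>\<in>space M. \<bar>f N \<omega> - c\<bar> > \<epsilon>}) \<longlonglongrightarrow> 0" if "\<epsilon> > 0" for \<epsilon>
    using P that by (simp add: converges_in_probability_def)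
  have mom: "\<exists>B\<ge>0. \<forall>d. \<forall>\<^sub>F N in sequentially. integrable M (\<lambda>\<omega>. \<bar>f N \<omega> - d\<bar> powr p) \<and> expectation (\<lambda>\<omega>. \<bar>f N \<omega> - d\<bar> powr p) \<le> exp \<bar>d\<bar> * B"
    if p: "p \<ge> 0" for p
  proof -
    obtain A where A: "A \<ge> 0" "\<And>x::real. \<bar>x\<bar> powr p \<le> A * exp \<bar>x\<bar>" using powr_le_exp_const[OF p] by auto
    have "\<forall>\<^sub>F N in sequentially. integrable M (\<lambda>\<omega>. \<bar>f N \<omega> - d\<bar> powr p) \<and> expectation (\<lambda>\<omega>. \<bar>f N \<omega> - d\<bar> powr p) \<le> exp \<bar>d\<bar> * (A * \<bar>K\<bar>)" for d
      using E
    proof eventually_elim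
      case (elim N)
      have iE: "integrable M (\<lambda>\<omega>. exp \<bar>f N \<omega>\<bar>)"
        by (rule integrableI_bounded) (use elim in \<open>auto intro: le_less_trans\<close>)
      have eE: "expectation (\<lambda>\<omega>. exp \<bar>f N \<omega>\<bar>) \<le> \<bar>K\<bar>"
      proof -
        have "ennreal (expectation (\<lambda>\<omega>. exp \<bar>f N \<omega>\<bar>)) \<le> ennreal K"
          using elim iE by (subst nn_integral_eq_integral[symmetric]) auto
        also have "\<dots> \<le> ennreal \<bar>K\<bar>" by (intro ennreal_leI) simp
        finally show ?thesis by simp
      qed
      have le: "\<bar>f N \<omega> - d\<bar> powr p \<le> exp \<bar>d\<bar> * A * exp \<bar>f N \<omega>\<bar>" for \<omega>
      proof -
        have "\<bar>f N \<omega> - d\<bar> powr p \<le> A * exp \<bar>f N \<omega> - d\<bar>" by (rule A(2))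
        also have "\<dots> \<le> A * exp (\<bar>d\<bar> + \<bar>f N \<omega>\<bar>)" using A(1) by (intro mult_left_mono) auto
        finally show ?thesis by (simp add: exp_add mult_ac)
      qed
      have i2: "integrable M (\<lambda>\<omega>. exp \<bar>d\<bar> * A * exp \<bar>f N \<omega>\<bar>)" using iE by simp
      have i: "integrable M (\<lambda>\<omega>. \<bar>f N \<omega> - d\<bar> powr p)"
        by (rule Bochner_Integration.integrable_bound[OF i2]) (auto intro!: AE_I2 order_trans[OF le])
      have "expectation (\<lambda>\<omega>. \<bar>f N \<omega> - d\<bar> powr p) \<le> expectation (\<lambda>\<omega>. exp \<bar>d\<bar> * A * exp \<bar>f N \<omega>\<bar>)"
        by (rule integral_mono[OF i i2 le])
      also have "\<dots> = exp \<bar>d\<bar> * A * expectation (\<lambda>\<omega>. exp \<bar>f N \<omega>\<bar>)" by simp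
      also have "\<dots> \<le> exp \<bar>d\<bar> * A * \<bar>K\<bar>" using eE A by (intro mult_left_mono) auto
      finally show ?case using i by (simp add: mult.assoc)
    qed
    then show ?thesis using A(1) by (intro exI[of _ "A * \<bar>K\<bar>"]) auto
  qed
  have q0: "q \<ge> 0" "q + 1 \<ge> 0" using q by auto
  obtain B1 where "\<forall>d. \<forall>\<^sub>F N in sequentially. integrable M (\<lambda>\<omega>. \<bar>f N \<omega> - d\<bar> powr q) \<and> expectation (\<lambda>\<omega>. \<bar>f N \<omega> - d\<bar> powr q) \<le> exp \<bar>d\<bar> * B1"
    using mom[OF q0(1)] by auto
  then have int_q: "\<forall>\<^sub>F N in sequentially. integrable M (\<lambda>\<omega>. \<bar>f N \<omega> - d\<bar> powr q)" for d
    by (auto elim: eventually_mono)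
  obtain B2 where B2: "B2 \<ge> 0" "\<And>d. \<forall>\<^sub>F N in sequentially. integrable M (\<lambda>\<omega>. \<bar>f N \<omega> - d\<bar> powr (q + 1)) \<and> expectation (\<lambda>\<omega>. \<bar>f N \<omega> - d\<bar> powr (q + 1)) \<le> exp \<bar>d\<bar> * B2"
    using mom[OF q0(2)] by auto
  define B where "B = exp \<bar>c\<bar> * B2"
  have B: "B \<ge> 0" using B2(1) by (simp add: B_def)
  have lim: "(\<lambda>N. expectation (\<lambda>\<omega>. \<bar>f N \<omega> - c\<bar> powr q)) \<longlonglongrightarrow> 0"
  proof (rule LIMSEQ_I)
    fix e :: real assume e: "0 < e"
    define \<epsilon> where "\<epsilon> = (e / 4) powr (1 / q)"
    have \<epsilon>: "\<epsilon> > 0" "\<epsilon> powr q = e / 4" using e q by (auto simp: \<epsilon>_def powr_powr)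
    define R where "R = max 1 (4 * B / e)"
    have R: "R > 0" "B / R \<le> e / 4"
    proof -
      show "R > 0" by (simp add: R_def)
      have "4 * B / e \<le> R" by (simp add: R_def)
      then show "B / R \<le> e / 4" using \<open>R > 0\<close> e by (simp add: field_simps)
    qed
    have "(\<lambda>N. R powr q * prob {\<omega>\<in>space M. \<bar>f N \<omega> - c\<bar> > \<epsilon>}) \<longlonglongrightarrow> R powr q * 0"
      by (intro tendsto_intros pr \<epsilon>)
    then have "\<forall>\<^sub>F N in sequentially. R powr q * prob {\<omega>\<in>space M. \<bar>f N \<omega> - c\<bar> > \<epsilon>} < e / 4"
      by (rule order_tendstoD) (use e in simp)
    then have "\<forall>\<^sub>F N in sequentially. norm (expectation (\<lambda>\<omega>. \<bar>f N \<omega> - c\<bar> powr q) - 0) < e"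
      using int_q[of c] B2(2)[of c]
    proof eventually_elim
      case (elim N)
      let ?A = "{\<omega>\<in>space M. \<bar>f N \<omega> - c\<bar> > \<epsilon>}"
      have pw: "\<bar>f N \<omega> - c\<bar> powr q \<le> \<epsilon> powr q + R powr q * indicator ?A \<omega> + (1 / R) * \<bar>f N \<omega> - c\<bar> powr (q + 1)"
        if "\<omega> \<in> space M" for \<omega>
      proof -
        define x where "x = \<bar>f N \<omega> - c\<bar>"
        have x: "x \<ge> 0" by (simp add: x_def)
        have nn: "0 \<le> \<epsilon> powr q" "0 \<le> R powr q" "0 \<le> (1 / R) * x powr (q + 1)" using R by auto
        consider "x \<le> \<epsilon>" | "\<epsilon> < x" "x \<le> R" | "\<epsilon> < x" "R < x" by linarith
        then have "x powr q \<le> \<epsilon> powr q + R powr q * (if \<epsilon> < x then 1 else 0) + (1 / R) * x powr (q + 1)"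
        proof cases
          case 1
          then have "x powr q \<le> \<epsilon> powr q" using x q by (intro powr_mono2) auto
          then show ?thesis using nn by (simp add: add_increasing2)
        next
          case 2
          then have "x powr q \<le> R powr q" using x q by (intro powr_mono2) auto
          then show ?thesis using nn unfolding if_P[OF 2(1)] by linarith
        next
          case 3
          have "x powr q * 1 \<le> x powr q * (x / R)" using 3 R by (intro mult_left_mono) auto
          also have "\<dots> = (1 / R) * x powr (q + 1)" using 3 R by (simp add: powr_add)
          finally show ?thesis using nn unfolding if_P[OF 3(1)] by linarith
        qed
        then show ?thesis using that by (cases "\<epsilon> < x") (simp_all add: x_def indicator_def)
      qed
      have iA: "integrable M (\<lambda>\<omega>. indicator ?A \<omega> :: real)"
        by (rule integrable_real_indicator) (auto simp: emeasure_eq_measure)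
      have iR: "integrable M (\<lambda>\<omega>. \<epsilon> powr q + R powr q * indicator ?A \<omega> + (1 / R) * \<bar>f N \<omega> - c\<bar> powr (q + 1))"
        using elim(3) iA by (intro Bochner_Integration.integrable_add integrable_mult_right integrable_const) auto
      have "expectation (\<lambda>\<omega>. \<bar>f N \<omega> - c\<bar> powr q) \<le> expectation (\<lambda>\<omega>. \<epsilon> powr q + R powr q * indicator ?A \<omega> + (1 / R) * \<bar>f N \<omega> - c\<bar> powr (q + 1))"
        by (rule integral_mono[OF elim(2) iR pw])
      also have "\<dots> = expectation (\<lambda>\<omega>. \<epsilon> powr q + R powr q * indicator ?A \<omega>) + expectation (\<lambda>\<omega>. (1 / R) * \<bar>f N \<omega> - c\<bar> powr (q + 1))"
        using elim(3) iA by (intro Bochner_Integration.integral_add Bochner_Integration.integrable_add integrable_mult_right integrable_const) auto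
      also have "expectation (\<lambda>\<omega>. \<epsilon> powr q + R powr q * indicator ?A \<omega>) = expectation (\<lambda>\<omega>. \<epsilon> powr q) + expectation (\<lambda>\<omega>. R powr q * indicator ?A \<omega>)"
        using iA by (intro Bochner_Integration.integral_add integrable_mult_right integrable_const) auto
      also have "\<dots> = \<epsilon> powr q + R powr q * prob ?A" by (simp add: prob_space)
      also have "expectation (\<lambda>\<omega>. (1 / R) * \<bar>f N \<omega> - c\<bar> powr (q + 1)) = (1 / R) * expectation (\<lambda>\<omega>. \<bar>f N \<omega> - c\<bar> powr (q + 1))"
        by (rule integral_mult_right_zero)
      also have "\<dots> \<le> (1 / R) * B" using elim(3) R by (intro mult_left_mono) (auto simp: B_def)
      also have "\<epsilon> powr q + R powr q * prob ?A + (1 / R) * B < e"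
      proof -
        have "(1 / R) * B \<le> e / 4" using R(2) by simp
        then show ?thesis using \<epsilon>(2) elim(1) e by linarith
      qed
      finally show ?case by (simp add: Bochner_Integration.integral_nonneg)
    qed
    then show "\<exists>no. \<forall>n\<ge>no. norm (expectation (\<lambda>\<omega>. \<bar>f n \<omega> - c\<bar> powr q) - 0) < e"
      by (simp add: eventually_sequentially)
  qed
  have "\<forall>\<^sub>F N in sequentially. in_Lq M q (f N)"
    using int_q[of 0] by (auto simp: in_Lq_def)
  then show ?thesis using lim by (simp add: converges_in_Lq_def in_Lq_def)
qed

section \<open>The limit\<close>

text \<open>The competition of the two exponents: for \<open>\<bar>\<sigma>\<bar> \<le> sqrt 2\<close> the sign is that of \<open>sqrt 2 - \<bar>\<sigma>\<bar> - \<bar>\<tau>\<bar>\<close>,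
  whose zeros separate \<open>B1\<close> from \<open>B2\<close>.\<close>

lemma mean_minus_fluctuation_large:
  assumes "1 \<le> 2 * \<sigma>\<^sup>2"
  shows "(1 + (\<sigma>\<^sup>2 - \<tau>\<^sup>2) / 2) - fluctuation_exponent \<sigma> = ((sqrt 2 - \<bar>\<sigma>\<bar>)\<^sup>2 - \<tau>\<^sup>2) / 2"
proof -
  have "(sqrt 2 - \<bar>\<sigma>\<bar>)\<^sup>2 = 2 - 2 * sqrt 2 * \<bar>\<sigma>\<bar> + \<sigma>\<^sup>2"
    by (simp add: power2_diff)
  then show ?thesis unfolding fluctuation_exponent_large[OF assms] by (simp add: field_simps)
qed

text \<open>The limit in a form in which the bounds apply: the larger of the exponents of mean and fluctuations,
  where the mean counts for \<open>\<bar>\<sigma>\<bar> \<le> sqrt 2\<close> only.\<close>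

definition free_energy :: "real \<Rightarrow> real \<Rightarrow> real" where
  "free_energy \<sigma> \<tau> =
     (if \<bar>\<sigma>\<bar> \<le> sqrt 2 then max (fluctuation_exponent \<sigma>) (1 + (\<sigma>\<^sup>2 - \<tau>\<^sup>2) / 2) else fluctuation_exponent \<sigma>)"

lemma abs_le_sqrt2:
  assumes "2 * \<sigma>\<^sup>2 \<le> 1"
  shows "\<bar>\<sigma>\<bar> \<le> sqrt 2"
  using assms by (intro real_le_rsqrt) simp

lemma large_if_gt_sqrt2:
  assumes "sqrt 2 \<le> \<bar>\<sigma>\<bar>"
  shows "1 \<le> 2 * \<sigma>\<^sup>2"
proof -
  have "(sqrt 2)\<^sup>2 \<le> \<bar>\<sigma>\<bar>\<^sup>2" using assms by (intro power_mono) auto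
  then show ?thesis by simp
qed

context gaussian_sample
begin

lemma partition_fn_upper:
  assumes "free_energy \<sigma> \<tau> < l"
  shows "(\<lambda>N. prob {\<omega>\<in>space M. exp (ln N * l) \<le> norm (partition_fn X Y N (\<sigma>, \<tau>) \<omega>)}) \<longlonglongrightarrow> 0"
proof (cases "\<bar>\<sigma>\<bar> \<le> sqrt 2")
  case True
  then show ?thesis using assms by (intro partition_fn_upper_small) (auto simp: free_energy_def)
next
  case False
  then show ?thesis using assms fluctuation_exponent_large[OF large_if_gt_sqrt2, of \<sigma>]
    by (intro partition_fn_upper_large) (auto simp: free_energy_def)
qed

lemma partition_fn_lower:
  assumes l: "l < free_energy \<sigma> \<tau>"
  shows "(\<lambda>N. prob {\<omega>\<in>space M. norm (partition_fn X Y N (\<sigma>, \<tau>) \<omega>) \<le> exp (ln N * l)}) \<longlonglongrightarrow> 0"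
proof (cases "\<bar>\<sigma>\<bar> \<le> sqrt 2 \<and> fluctuation_exponent \<sigma> < 1 + (\<sigma>\<^sup>2 - \<tau>\<^sup>2) / 2")
  case True
  then show ?thesis using l by (intro partition_fn_lower_mean) (auto simp: free_energy_def)
next
  case False
  then have l2: "l < fluctuation_exponent \<sigma>" using l by (auto simp: free_energy_def split: if_splits)
  show ?thesis
  proof (cases "\<tau> = 0")
    case False
    then show ?thesis using l2 by (rule partition_fn_lower_fluctuation)
  next
    case True
    have large: "1 \<le> 2 * \<sigma>\<^sup>2"
    proof (rule ccontr)
      assume "\<not> 1 \<le> 2 * \<sigma>\<^sup>2"
      then show False
        using \<open>\<not> (\<bar>\<sigma>\<bar> \<le> sqrt 2 \<and> _)\<close> abs_le_sqrt2[of \<sigma>] True by (simp add: fluctuation_exponent_def)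
    qed
    then have "\<sigma> \<noteq> 0" by auto
    then show ?thesis
      using l2 unfolding fluctuation_exponent_large[OF large] True by (intro partition_fn_lower_positive)
  qed
qed

lemma log_partition_fn_measurable [measurable]: "log_partition_fn X Y N \<beta> \<in> borel_measurable M"
  unfolding log_partition_fn_def[abs_def] by measurable

text \<open>The event \<open>Z = 0\<close>, on which the logarithm is \<open>0\<close> by convention, is contained in the event that \<open>\<bar>Z\<bar>\<close> is small.\<close>

lemma log_partition_fn_in_probability:
  "converges_in_probability M (\<lambda>N. log_partition_fn X Y N (\<sigma>, \<tau>)) (\<lambda>_. free_energy \<sigma> \<tau>)"
  unfolding converges_in_probability_def
proof (intro conjI allI impI)
  fix \<epsilon> :: real assume \<epsilon>: "\<epsilon> > 0"
  let ?p = "free_energy \<sigma> \<tau>" and ?Z = "\<lambda>N \<omega>. norm (partition_fn X Y N (\<sigma>, \<tau>) \<omega>)"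
  let ?U = "\<lambda>N. {\<omega>\<in>space M. exp (ln (real N) * (?p + \<epsilon>)) \<le> ?Z N \<omega>}"
  let ?L = "\<lambda>N. {\<omega>\<in>space M. ?Z N \<omega> \<le> exp (ln (real N) * (?p - \<epsilon>))}"
  show "(\<lambda>N. prob {\<omega> \<in> space M. \<bar>log_partition_fn X Y N (\<sigma>, \<tau>) \<omega> - ?p\<bar> > \<epsilon>}) \<longlonglongrightarrow> 0"
  proof (rule tendsto_sandwich[OF _ _ tendsto_const])
    have "(\<lambda>N. prob (?U N) + prob (?L N)) \<longlonglongrightarrow> 0 + 0"
      by (intro tendsto_add partition_fn_upper partition_fn_lower) (use \<epsilon> in auto)
    then show "(\<lambda>N. prob (?U N) + prob (?L N)) \<longlonglongrightarrow> 0" by simp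
    show "\<forall>\<^sub>F N in sequentially. prob {\<omega> \<in> space M. \<bar>log_partition_fn X Y N (\<sigma>, \<tau>) \<omega> - ?p\<bar> > \<epsilon>} \<le> prob (?U N) + prob (?L N)"
      using eventually_ge_at_top[of 2]
    proof eventually_elim
      case (elim N)
      then have n: "ln (real N) > 0" by simp
      have "{\<omega> \<in> space M. \<bar>log_partition_fn X Y N (\<sigma>, \<tau>) \<omega> - ?p\<bar> > \<epsilon>} \<subseteq> ?U N \<union> ?L N"
      proof
        fix \<omega> assume w: "\<omega> \<in> {\<omega> \<in> space M. \<bar>log_partition_fn X Y N (\<sigma>, \<tau>) \<omega> - ?p\<bar> > \<epsilon>}"
        show "\<omega> \<in> ?U N \<union> ?L N"
        proof (cases "?Z N \<omega> = 0")
          case True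
          then show ?thesis using w by simp
        next
          case False
          define v where "v = log_partition_fn X Y N (\<sigma>, \<tau>) \<omega>"
          have Z: "?Z N \<omega> = exp (ln N * v)" using False n by (simp add: v_def log_partition_fn_def)
          have "v \<ge> ?p + \<epsilon> \<or> v \<le> ?p - \<epsilon>" using w by (auto simp: v_def)
          then have "exp (ln N * (?p + \<epsilon>)) \<le> ?Z N \<omega> \<or> ?Z N \<omega> \<le> exp (ln N * (?p - \<epsilon>))"
            unfolding Z using n by auto
          then show ?thesis using w by auto
        qed
      qed
      then have "prob {\<omega> \<in> space M. \<bar>log_partition_fn X Y N (\<sigma>, \<tau>) \<omega> - ?p\<bar> > \<epsilon>} \<le> prob (?U N \<union> ?L N)"
        by (rule finite_measure_mono) measurable
      also have "\<dots> \<le> prob (?U N) + prob (?L N)"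
        by (rule measure_Un_le) measurable
      finally show ?case .
    qed
  qed (auto intro!: always_eventually)
qed auto

end

section \<open>The three regions\<close>

text \<open>Only the line \<open>2 \<sigma>\<^sup>2 = 1\<close> needs an argument, as \<open>B2\<close> and \<open>B3\<close> omit it: points of the line with
  \<open>\<bar>\<sigma>\<bar> + \<bar>\<tau>\<bar> > sqrt 2\<close> are limits of points \<open>(c \<sigma>, \<tau>)\<close> of \<open>B2\<close> with \<open>c > 1\<close>.\<close>

lemma closure_B1_subset:
  "closure B1 \<subseteq> {z. 2 * (fst z)\<^sup>2 \<le> 1 \<and> (fst z)\<^sup>2 + (snd z)\<^sup>2 \<le> 1} \<union> {z. 1 \<le> 2 * (fst z)\<^sup>2 \<and> \<bar>fst z\<bar> + \<bar>snd z\<bar> \<le> sqrt 2}"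
  (is "_ \<subseteq> ?C")
proof (rule closure_minimal)
  show "closed ?C"
    by (intro closed_Un closed_Collect_conj closed_Collect_le continuous_intros)
  show "B1 \<subseteq> ?C"
  proof
    fix z assume z: "z \<in> B1"
    obtain \<sigma> \<tau> where [simp]: "z = (\<sigma>, \<tau>)" by (cases z)
    have n: "(\<sigma>, \<tau>) \<notin> closure (B2 \<union> B3)" using z by (simp add: B1_def)
    then have n2: "(\<sigma>, \<tau>) \<notin> B2" "(\<sigma>, \<tau>) \<notin> B3" using closure_subset[of "B2 \<union> B3"] by (meson UnI1 UnI2 subsetD)+
    consider "2 * \<sigma>\<^sup>2 < 1" | "2 * \<sigma>\<^sup>2 > 1" | "2 * \<sigma>\<^sup>2 = 1" by linarith
    then show "z \<in> ?C"
    proof cases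
      case 1
      then show ?thesis using n2(2) by (auto simp: B3_def)
    next
      case 2
      then show ?thesis using n2(1) by (auto simp: B2_def)
    next
      case 3
      have "\<bar>\<sigma>\<bar> + \<bar>\<tau>\<bar> \<le> sqrt 2"
      proof (rule ccontr)
        assume "\<not> \<bar>\<sigma>\<bar> + \<bar>\<tau>\<bar> \<le> sqrt 2"
        then have gt: "\<bar>\<sigma>\<bar> + \<bar>\<tau>\<bar> > sqrt 2" by simp
        define c where "c k = 1 + 1 / real (Suc k)" for k
        have mem: "(\<sigma> * c k, \<tau>) \<in> B2 \<union> B3" for k
        proof -
          have c: "c k > 1" by (simp add: c_def)
          have "1 * 1 < c k * c k" using c by (intro mult_strict_mono) auto
          then have "1 < (c k)\<^sup>2" by (simp add: power2_eq_square)
          then have "1 < (2 * \<sigma>\<^sup>2) * (c k)\<^sup>2" unfolding 3 by simp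
          also have "\<dots> = 2 * (\<sigma> * c k)\<^sup>2" by (simp add: power_mult_distrib)
          finally have "1 < 2 * (\<sigma> * c k)\<^sup>2" .
          moreover have "\<bar>\<sigma>\<bar> * 1 \<le> \<bar>\<sigma>\<bar> * c k" using c by (intro mult_left_mono) auto
          then have "\<bar>\<sigma>\<bar> \<le> \<bar>\<sigma> * c k\<bar>" using c by (simp add: abs_mult)
          ultimately show ?thesis using gt by (auto simp: B2_def)
        qed
        have "(\<lambda>k. 1 / real (Suc k)) \<longlonglongrightarrow> 0" using LIMSEQ_Suc[OF lim_1_over_n] by simp
        then have "(\<lambda>k. (\<sigma> * c k, \<tau>)) \<longlonglongrightarrow> (\<sigma> * (1 + 0), \<tau>)"
          unfolding c_def by (intro tendsto_intros)
        then have "(\<sigma>, \<tau>) \<in> closure (B2 \<union> B3)"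
          unfolding closure_sequential
          by (intro exI[of _ "\<lambda>k. (\<sigma> * c k, \<tau>)"] conjI allI mem) simp
        with n show False by simp
      qed
      then show ?thesis using 3 by simp
    qed
  qed
qed

lemma closure_B2_subset: "closure B2 \<subseteq> {z. 1 \<le> 2 * (fst z)\<^sup>2 \<and> sqrt 2 \<le> \<bar>fst z\<bar> + \<bar>snd z\<bar>}"
  by (rule closure_minimal)
     (auto simp: B2_def intro!: closed_Collect_conj closed_Collect_le continuous_intros)

lemma closure_B3_subset: "closure B3 \<subseteq> {z. 2 * (fst z)\<^sup>2 \<le> 1 \<and> 1 \<le> (fst z)\<^sup>2 + (snd z)\<^sup>2}"
  by (rule closure_minimal)
     (auto simp: B3_def intro!: closed_Collect_conj closed_Collect_le continuous_intros)

lemma free_energy_B1: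
  assumes "(\<sigma>, \<tau>) \<in> closure B1"
  shows "free_energy \<sigma> \<tau> = 1 + 1 / 2 * (\<sigma>\<^sup>2 - \<tau>\<^sup>2)"
proof -
  from closure_B1_subset assms consider "2 * \<sigma>\<^sup>2 \<le> 1" "\<sigma>\<^sup>2 + \<tau>\<^sup>2 \<le> 1" | "1 \<le> 2 * \<sigma>\<^sup>2" "\<bar>\<sigma>\<bar> + \<bar>\<tau>\<bar> \<le> sqrt 2" by auto
  then have "\<bar>\<sigma>\<bar> \<le> sqrt 2 \<and> fluctuation_exponent \<sigma> \<le> 1 + (\<sigma>\<^sup>2 - \<tau>\<^sup>2) / 2"
  proof cases
    case 1
    then show ?thesis using abs_le_sqrt2 by (simp add: fluctuation_exponent_def field_simps)
  next
    case 2
    have "\<bar>\<tau>\<bar>\<^sup>2 \<le> (sqrt 2 - \<bar>\<sigma>\<bar>)\<^sup>2" using 2 by (intro power_mono) auto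
    then have "0 \<le> (1 + (\<sigma>\<^sup>2 - \<tau>\<^sup>2) / 2) - fluctuation_exponent \<sigma>"
      unfolding mean_minus_fluctuation_large[OF 2(1)] by simp
    then show ?thesis using 2(2) by auto
  qed
  then show ?thesis by (simp add: free_energy_def)
qed

lemma free_energy_B2:
  assumes "(\<sigma>, \<tau>) \<in> closure B2"
  shows "free_energy \<sigma> \<tau> = sqrt 2 * \<bar>\<sigma>\<bar>"
proof -
  from closure_B2_subset assms have 2: "1 \<le> 2 * \<sigma>\<^sup>2" "sqrt 2 \<le> \<bar>\<sigma>\<bar> + \<bar>\<tau>\<bar>" by auto
  have "1 + (\<sigma>\<^sup>2 - \<tau>\<^sup>2) / 2 \<le> fluctuation_exponent \<sigma>" if "\<bar>\<sigma>\<bar> \<le> sqrt 2"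
  proof -
    have "(sqrt 2 - \<bar>\<sigma>\<bar>)\<^sup>2 \<le> \<bar>\<tau>\<bar>\<^sup>2" using 2 that by (intro power_mono) auto
    then have "(1 + (\<sigma>\<^sup>2 - \<tau>\<^sup>2) / 2) - fluctuation_exponent \<sigma> \<le> 0"
      unfolding mean_minus_fluctuation_large[OF 2(1)] by simp
    then show ?thesis by simp
  qed
  then show ?thesis using fluctuation_exponent_large[OF 2(1)] by (simp add: free_energy_def)
qed

lemma free_energy_B3:
  assumes "(\<sigma>, \<tau>) \<in> closure B3"
  shows "free_energy \<sigma> \<tau> = 1 / 2 + \<sigma>\<^sup>2"
proof -
  from closure_B3_subset assms have 3: "2 * \<sigma>\<^sup>2 \<le> 1" "1 \<le> \<sigma>\<^sup>2 + \<tau>\<^sup>2" by auto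
  then show ?thesis using abs_le_sqrt2[OF 3(1)] by (simp add: free_energy_def fluctuation_exponent_def field_simps)
qed

theorem theorem2p15:
  fixes M :: "'a measure" and X Y :: "nat \<Rightarrow> 'a \<Rightarrow> real" and \<rho> :: real
  assumes "prob_space M"
    and "\<rho> \<in> {-1..1}"
    and "gaussian_iid_sequence M \<rho> X Y"
  shows "\<exists>p :: real \<times> real \<Rightarrow> real.
    (\<forall>\<beta>. converges_in_probability M (\<lambda>N. log_partition_fn X Y N \<beta>) (\<lambda>_. p \<beta>) \<and>
         (\<forall>q\<ge>1. converges_in_Lq M q (\<lambda>N. log_partition_fn X Y N \<beta>) (\<lambda>_. p \<beta>))) \<and>
    (\<forall>\<sigma> \<tau>.
       ((\<sigma>, \<tau>) \<in> closure B1 \<longrightarrow> p (\<sigma>, \<tau>) = 1 + 1 / 2 * (\<sigma>\<^sup>2 - \<tau>\<^sup>2)) \<and>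
       ((\<sigma>, \<tau>) \<in> closure B2 \<longrightarrow> p (\<sigma>, \<tau>) = sqrt 2 * \<bar>\<sigma>\<bar>) \<and>
       ((\<sigma>, \<tau>) \<in> closure B3 \<longrightarrow> p (\<sigma>, \<tau>) = 1 / 2 + \<sigma>\<^sup>2))"
proof -
  interpret prob_space M by fact
  interpret gaussian_sample M \<rho> X Y
    by unfold_locales (use assms(2,3) in auto)
  have "converges_in_probability M (\<lambda>N. log_partition_fn X Y N (\<sigma>, \<tau>)) (\<lambda>_. free_energy \<sigma> \<tau>) \<and>
      (\<forall>q\<ge>1. converges_in_Lq M q (\<lambda>N. log_partition_fn X Y N (\<sigma>, \<tau>)) (\<lambda>_. free_energy \<sigma> \<tau>))" for \<sigma> \<tau>
    using converges_in_Lq_if_exp_moment log_partition_fn_in_probability log_partition_fn_exp_moment by blast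
  then show ?thesis
    by (intro exI[of _ "\<lambda>(\<sigma>, \<tau>). free_energy \<sigma> \<tau>"] conjI allI impI)
       (auto simp: free_energy_B1 free_energy_B2 free_energy_B3)
qed

end
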